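(* Let $\phi_b\ne0$, $\alpha\in[0,1)$, and let $m_b\ge0$, $m_\infty>0$, $v_b>0$, $v_\infty>0$ be constants satisfying $$m_b+(1+\alpha)m_\infty=1,\qquad m_bv_b^{-2}+(1+\alpha)m_\infty v_\infty^{-2}<1.$$ There exist positive constants $\varepsilon_0$, $\delta_0$ and $C_0$ (independent of $\phi_b$) such that if $|\phi_b|<\delta_0$, then $$\sup_{x\in\mathbb{R}_+}|\rho_\varepsilon(x)-\rho(x)|+\sup_{x\in\mathbb{R}_+}|\rho_\varepsilon u_\varepsilon(x)-\rho u(x)|+\sup_{x\in\mathbb{R}_+}|\phi_\varepsilon(x)-\phi(x)|\le C_0\varepsilon$$ for any $\varepsilon\in(0,\varepsilon_0)$. Here $(f_\varepsilon,\phi_\varepsilon)$ is the solution of the problem (VP) of the context with $(f_b,f_\infty)=(g_{b,\varepsilon},g_{\infty,\varepsilon})$, $$\rho_\varepsilon(x):=\int_{\mathbb{R}^3}f_\varepsilon(x,\xi)\,d\xi,\qquad u_\varepsilon(x):=\frac1{\rho_\varepsilon(x)}\int_{\mathbb{R}^3}\xi_1f_\varepsilon(x,\xi)\,d\xi,$$ the function $\phi=\phi(x)$ is the (unique) monotone solution of the boundary value problem $$\partial_{xx}\phi=\frac{m_bv_b}{\sqrt{v_b^2+2\phi}}+\frac{(1+\alpha)m_\infty v_\infty}{\sqrt{v_\infty^2+2\phi}}-n_e(\phi),\quad x>0,\qquad \phi(0)=\phi_b,\quad \lim_{x\to\infty}\phi(x)=0,$$ and $\rho=\rho(x)$, $u=u(x)$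 are defined as $$\rho(x):=\frac{m_bv_b}{\sqrt{v_b^2+2\phi(x)}}+\frac{(1+\alpha)m_\infty v_\infty}{\sqrt{v_\infty^2+2\phi(x)}},\qquad u(x):=\frac{m_bv_b+(\alpha-1)m_\infty v_\infty}{\rho(x)}.$$
   Context: Notation: $\mathbb{R}_+=\{x>0\}$, $\overline{\mathbb{R}_+}=[0,\infty)$; $\xi=(\xi_1,\xi_2,\xi_3)=(\xi_1,\xi')\in\mathbb{R}^3$; $\mathbb{R}^3_+=\{\xi\in\mathbb{R}^3:\xi_1>0\}$. $\chi(s)$ is the one-dimensional indicator function of $\{s>0\}$; an expression multiplied by a vanishing $\chi$-factor is $0$. The function $n_e\in C^2(\mathbb{R})$ is given with $n_e(0)=1$, $n_e'(0)=-1$. The problem (VP), with data $\alpha\in[0,1]$, $\phi_b\in\mathbb{R}$ and nonnegative functions $f_b$ on $\mathbb{R}^3_+$ and $f_\infty$ on $\mathbb{R}^3$, is to find $f=f(x,\xi)$, $\phi=\phi(x)$ with $$\xi_1\partial_xf+\partial_x\phi\,\partial_{\xi_1}f=0,\qquad \partial_{xx}\phi=\int_{\mathbb{R}^3}f\,d\xi-n_e(\phi),\qquad x>0,\ \xi\in\mathbb{R}^3,$$ $$f(0,\xi)=f_b(\xi)+\alpha f(0,-\xi_1,\xi')\ (\xi_1>0),\quad \phi(0)=\phi_b,\quad \lim_{x\to\infty}f(x,\xi)=f_\infty(\xi),\quad \lim_{x\to\infty}\phi(x)=0.$$ $(f,\phi)$ is called a solution of (VP) if: (1) $f\in L^1_{loc}(\overline{\mathbb{R}_+}\times\mathbb{R}^3)\cap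 C(\overline{\mathbb{R}_+};L^1(\mathbb{R}^3))$ and $\phi\in C^1(\overline{\mathbb{R}_+})\cap C^2(\mathbb{R}_+)$; (2) $f\ge0$, and either $\partial_x\phi(x)>0$ for all $x\in\overline{\mathbb{R}_+}$ or $\partial_x\phi(x)<0$ for all $x\in\overline{\mathbb{R}_+}$; (3) $(f,\xi_1\partial_x\psi+\partial_x\phi\,\partial_{\xi_1}\psi)_{L^2(\mathbb{R}_+\times\mathbb{R}^3)}+(f_b,\xi_1\psi(0,\cdot))_{L^2(\mathbb{R}^3_+)}=0$ for all $\psi\in\mathcal{X}$, where $\mathcal{X}=\{\psi\in C_0^1(\overline{\mathbb{R}_+}\times\mathbb{R}^3): \alpha\psi(0,\xi_1,\xi')=\psi(0,-\xi_1,\xi')\text{ for }(\xi_1,\xi')\in\mathbb{R}^3_+\}$ ($C^1$ functions with compact support in $\overline{\mathbb{R}_+}\times\mathbb{R}^3$), and $\lim_{x\to\infty}\|f(x,\cdot)-f_\infty\|_{L^1(\mathbb{R}^3)}=0$; (4) $\phi$ solves $\partial_{xx}\phi=\int_{\mathbb{R}^3}f\,d\xi-n_e(\phi)$ for $x>0$ with $\phi(0)=\phi_b$ and $\lim_{x\to\infty}\phi(x)=0$ in the classical sense. Approximate data: fix $\varphi\in C_0^\infty(\mathbb{R}^3)$ with $\varphi\ge0$, $\operatorname{supp}\varphi\subset\{|\xi|<1\}$, $\int_{\mathbb{R}^3}\varphi\,d\xi=1$, and for $0<\varepsilon<1$ set $$g_{b,\varepsilon}(\xi):=\frac{m_b}{\varepsilon^3}\varphi\left(\frac{(\sqrt{\xi_1^2-2\phi_b},\xi')-(v_b,0,0)}{\varepsilon}\right)\chi(\xi_1^2-2\phi_b),\quad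 \xi\in\mathbb{R}^3_+,$$ $$g_{\infty,\varepsilon}(\xi):=\frac{m_\infty}{\varepsilon^3}\varphi\left(\frac{\xi-(-v_\infty,0,0)}{\varepsilon}\right)+\frac{m_b}{\varepsilon^3}\varphi\left(\frac{\xi-(v_b,0,0)}{\varepsilon}\right)+\alpha\frac{m_\infty}{\varepsilon^3}\varphi\left(\frac{(-\xi_1,\xi')+(v_\infty,0,0)}{\varepsilon}\right),\quad \xi\in\mathbb{R}^3.$$ For $\varepsilon$ and $|\phi_b|\neq0$ sufficiently small, the problem (VP) with $(f_b,f_\infty)=(g_{b,\varepsilon},g_{\infty,\varepsilon})$ has a unique solution, denoted $(f_\varepsilon,\phi_\varepsilon)$, and the limiting boundary value problem for $\phi$ has a unique monotone solution in $C^2(\overline{\mathbb{R}_+})$. *)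

theory Defs
  imports "HOL-Analysis.Analysis"
begin

section \<open>Function spaces\<close>

text \<open>Derivative relative to a set: one-sided at the endpoint \<open>0\<close> of \<open>{0..}\<close>, the usual
  derivative at interior points.\<close>

definition deriv_on :: "real set \<Rightarrow> (real \<Rightarrow> real) \<Rightarrow> real \<Rightarrow> real" where
  "deriv_on S g x = vector_derivative g (at x within S)"

definition C1_on :: "real set \<Rightarrow> (real \<Rightarrow> real) \<Rightarrow> bool" where
  "C1_on S g \<longleftrightarrow> g differentiable_on S \<and> continuous_on S (deriv_on S g)"

definition C2_on :: "real set \<Rightarrow> (real \<Rightarrow> real) \<Rightarrow> bool" where
  "C2_on S g \<longleftrightarrow> C1_on S g \<and> C1_on S (deriv_on S g)"

definition dir_deriv :: "'a::real_normed_vector \<Rightarrow> ('a \<Rightarrow> real) \<Rightarrow> 'a \<Rightarrow> real" where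
  "dir_deriv v g z = deriv (\<lambda>s. g (z + s *\<^sub>R v)) 0"

primrec Ck :: "nat \<Rightarrow> ('a::euclidean_space \<Rightarrow> real) \<Rightarrow> bool" where
  "Ck 0 g \<longleftrightarrow> continuous_on UNIV g"
| "Ck (Suc k) g \<longleftrightarrow> g differentiable_on UNIV \<and> (\<forall>b\<in>Basis. Ck k (dir_deriv b g))"

definition mollifier :: "(real^3 \<Rightarrow> real) \<Rightarrow> bool" where
  "mollifier \<eta> \<longleftrightarrow> (\<forall>k. Ck k \<eta>) \<and> (\<forall>\<xi>. \<eta> \<xi> \<ge> 0) \<and>
     closure {\<xi>. \<eta> \<xi> \<noteq> 0} \<subseteq> ball 0 1 \<and> (LINT \<xi>|lborel. \<eta> \<xi>) = 1"

definition L1_norm :: "(real^3 \<Rightarrow> real) \<Rightarrow> ennreal" where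
  "L1_norm g = (\<integral>\<^sup>+ \<xi>. ennreal \<bar>g \<xi>\<bar> \<partial>lborel)"

section \<open>Solutions of the problem (VP)\<close>

abbreviation phase_space :: "(real \<times> (real^3)) set" where
  "phase_space \<equiv> {0..} \<times> UNIV"

definition reflect1 :: "real^3 \<Rightarrow> real^3" where
  "reflect1 \<xi> = vector [- \<xi>$1, \<xi>$2, \<xi>$3]"

text \<open>The space \<open>\<X>\<close>. A function is \<open>C\<^sup>1\<close> on the closed half-space if it is Frechet differentiable
  relative to it, with a derivative that is continuous up to the boundary.\<close>

definition test_function :: "real \<Rightarrow> (real \<times> (real^3) \<Rightarrow> real) \<Rightarrow> bool" where
  "test_function \<alpha> \<psi> \<longleftrightarrow>
     (\<exists>D :: real \<times> (real^3) \<Rightarrow> (real \<times> (real^3)) \<Rightarrow>\<^sub>L real.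
        (\<forall>z\<in>phase_space. (\<psi> has_derivative blinfun_apply (D z)) (at z within phase_space)) \<and>
        continuous_on phase_space D) \<and>
     compact (closure {z \<in> phase_space. \<psi> z \<noteq> 0}) \<and>
     (\<forall>\<xi>. \<xi>$1 > 0 \<longrightarrow> \<alpha> * \<psi> (0, \<xi>) = \<psi> (0, reflect1 \<xi>))"

text \<open>The distribution function is represented by its slices \<open>f x\<close>; each slice (and \<open>f\<close> itself, on
  compact sets) stands for its class modulo null sets, hence the sign condition is imposed almost
  everywhere. Only arguments \<open>x \<ge> 0\<close> matter.\<close>

definition VP_solution ::
  "(real \<Rightarrow> real) \<Rightarrow> real \<Rightarrow> real \<Rightarrow> (real^3 \<Rightarrow> real) \<Rightarrow> (real^3 \<Rightarrow> real) \<Rightarrow>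
   (real \<Rightarrow> real^3 \<Rightarrow> real) \<Rightarrow> (real \<Rightarrow> real) \<Rightarrow> bool" where
  "VP_solution n\<^sub>e \<alpha> \<phi>\<^sub>b f\<^sub>b f_inf f \<phi> \<longleftrightarrow>
     (\<forall>K. compact K \<and> K \<subseteq> phase_space \<longrightarrow> set_integrable lborel K (\<lambda>(x, \<xi>). f x \<xi>)) \<and>
     (\<forall>x\<ge>0. integrable lborel (f x)) \<and>
     (\<forall>x\<ge>0. ((\<lambda>y. L1_norm (\<lambda>\<xi>. f y \<xi> - f x \<xi>)) \<longlongrightarrow> 0) (at x within {0..})) \<and>
     C1_on {0..} \<phi> \<and> C2_on {0<..} \<phi> \<and>
     (\<forall>x\<ge>0. AE \<xi> in lborel. f x \<xi> \<ge> 0) \<and>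
     ((\<forall>x\<ge>0. deriv_on {0..} \<phi> x > 0) \<or> (\<forall>x\<ge>0. deriv_on {0..} \<phi> x < 0)) \<and>
     (\<forall>\<psi>. test_function \<alpha> \<psi> \<longrightarrow>
        (LINT (x, \<xi>):{0<..} \<times> UNIV|lborel.
            f x \<xi> * (\<xi>$1 * dir_deriv (1, 0) \<psi> (x, \<xi>)
                     + deriv \<phi> x * dir_deriv (0, axis 1 1) \<psi> (x, \<xi>)))
        + (LINT \<xi>:{\<xi>. \<xi>$1 > 0}|lborel. f\<^sub>b \<xi> * (\<xi>$1 * \<psi> (0, \<xi>))) = 0) \<and>
     ((\<lambda>x. L1_norm (\<lambda>\<xi>. f x \<xi> - f_inf \<xi>)) \<longlongrightarrow> 0) at_top \<and>
     (\<forall>x>0. deriv (deriv \<phi>) x = (LINT \<xi>|lborel. f x \<xi>) - n\<^sub>e (\<phi> x)) \<and>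
     \<phi> 0 = \<phi>\<^sub>b \<and> (\<phi> \<longlongrightarrow> 0) at_top"

section \<open>Approximate data and the limiting problem\<close>

definition g_b ::
  "(real^3 \<Rightarrow> real) \<Rightarrow> real \<Rightarrow> real \<Rightarrow> real \<Rightarrow> real \<Rightarrow> real^3 \<Rightarrow> real" where
  "g_b \<eta> m\<^sub>b v\<^sub>b \<phi>\<^sub>b \<epsilon> \<xi> =
     m\<^sub>b / \<epsilon>^3 * \<eta> ((1/\<epsilon>) *\<^sub>R (vector [sqrt ((\<xi>$1)^2 - 2 * \<phi>\<^sub>b), \<xi>$2, \<xi>$3] - vector [v\<^sub>b, 0, 0]))
     * indicator {0<..} ((\<xi>$1)^2 - 2 * \<phi>\<^sub>b)"

definition g_inf ::
  "(real^3 \<Rightarrow> real) \<Rightarrow> real \<Rightarrow> real \<Rightarrow> real \<Rightarrow> real \<Rightarrow> real \<Rightarrow> real \<Rightarrow> real^3 \<Rightarrow> real" where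
  "g_inf \<eta> \<alpha> m\<^sub>b m_inf v\<^sub>b v_inf \<epsilon> \<xi> =
     m_inf / \<epsilon>^3 * \<eta> ((1/\<epsilon>) *\<^sub>R (\<xi> - vector [- v_inf, 0, 0]))
     + m\<^sub>b / \<epsilon>^3 * \<eta> ((1/\<epsilon>) *\<^sub>R (\<xi> - vector [v\<^sub>b, 0, 0]))
     + \<alpha> * (m_inf / \<epsilon>^3) * \<eta> ((1/\<epsilon>) *\<^sub>R (reflect1 \<xi> + vector [v_inf, 0, 0]))"

definition vp_density :: "(real \<Rightarrow> real^3 \<Rightarrow> real) \<Rightarrow> real \<Rightarrow> real" where
  "vp_density f x = (LINT \<xi>|lborel. f x \<xi>)"

definition vp_velocity :: "(real \<Rightarrow> real^3 \<Rightarrow> real) \<Rightarrow> real \<Rightarrow> real" where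
  "vp_velocity f x = 1 / vp_density f x * (LINT \<xi>|lborel. \<xi>$1 * f x \<xi>)"

definition lim_density ::
  "real \<Rightarrow> real \<Rightarrow> real \<Rightarrow> real \<Rightarrow> real \<Rightarrow> (real \<Rightarrow> real) \<Rightarrow> real \<Rightarrow> real" where
  "lim_density \<alpha> m\<^sub>b m_inf v\<^sub>b v_inf \<phi> x =
     m\<^sub>b * v\<^sub>b / sqrt (v\<^sub>b^2 + 2 * \<phi> x) + (1 + \<alpha>) * m_inf * v_inf / sqrt (v_inf^2 + 2 * \<phi> x)"

definition lim_velocity ::
  "real \<Rightarrow> real \<Rightarrow> real \<Rightarrow> real \<Rightarrow> real \<Rightarrow> (real \<Rightarrow> real) \<Rightarrow> real \<Rightarrow> real" where
  "lim_velocity \<alpha> m\<^sub>b m_inf v\<^sub>b v_inf \<phi> x =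
     (m\<^sub>b * v\<^sub>b + (\<alpha> - 1) * m_inf * v_inf) / lim_density \<alpha> m\<^sub>b m_inf v\<^sub>b v_inf \<phi> x"

definition limit_solution ::
  "(real \<Rightarrow> real) \<Rightarrow> real \<Rightarrow> real \<Rightarrow> real \<Rightarrow> real \<Rightarrow> real \<Rightarrow> real \<Rightarrow> (real \<Rightarrow> real) \<Rightarrow> bool" where
  "limit_solution n\<^sub>e \<alpha> \<phi>\<^sub>b m\<^sub>b m_inf v\<^sub>b v_inf \<phi> \<longleftrightarrow>
     C2_on {0..} \<phi> \<and> (monotone_on {0..} (\<le>) (\<le>) \<phi> \<or> monotone_on {0..} (\<le>) (\<ge>) \<phi>) \<and>
     (\<forall>x>0. deriv (deriv \<phi>) x = lim_density \<alpha> m\<^sub>b m_inf v\<^sub>b v_inf \<phi> x - n\<^sub>e (\<phi> x)) \<and>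
     \<phi> 0 = \<phi>\<^sub>b \<and> (\<phi> \<longlongrightarrow> 0) at_top"

end

theory Submission
  imports Defs
begin

text \<open>
  Along characteristics the energy \<open>e = \<xi>\<^sub>1\<^sup>2 / 2 - \<phi>\<^sub>\<epsilon>(x)\<close>, the components \<open>\<xi>\<^sub>2, \<xi>\<^sub>3\<close> and, between turning points, the
  sign of \<open>\<xi>\<^sub>1\<close> do not change. Testing the weak form with functions of these invariants shows that the flux
  \<open>\<integral> \<xi>\<^sub>1 \<Psi> f d\<xi>\<close> of each such function \<open>\<Psi>\<close> is independent of \<open>x\<close>, hence equal to its value at infinity
  (\<open>flux_conserved\<close>). Particles with enough energy to reach infinity are therefore determined by the data
  there. Particles without it would oscillate between the wall and a turning point, and since \<open>\<alpha> < 1\<close> and no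
  such particle is emitted, there are none (\<open>no_trapped_particles\<close>). It follows (\<open>moments_from_infinity\<close>) that
  the density of a solution is
  \<open>\<integral> \<bar>\<xi>\<^sub>1\<bar> / sqrt (\<xi>\<^sub>1\<^sup>2 + 2 \<phi>\<^sub>\<epsilon>(x)) g_inf(\<xi>) d\<xi>\<close> and its current is \<open>\<integral> \<xi>\<^sub>1 g_inf(\<xi>) d\<xi>\<close>.

  The data \<open>g_inf\<close> consist of bumps of width \<open>\<epsilon>\<close> around speeds \<open>v\<^sub>b\<close> and \<open>v_inf\<close>, so for small potentials the density
  is \<open>N(\<phi>\<^sub>\<epsilon>(x)) + O(\<epsilon>)\<close>, where \<open>N(\<phi>)\<close> is the density of the limiting problem, and the current
  is the limiting one up to \<open>\<epsilon>\<close> (\<open>approximate_moments\<close>). Hence \<open>\<phi>\<^sub>\<epsilon>'' = N(\<phi>\<^sub>\<epsilon>) - n\<^sub>e(\<phi>\<^sub>\<epsilon>) + O(\<epsilon>)\<close> and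
  \<open>\<phi>'' = N(\<phi>) - n\<^sub>e(\<phi>)\<close>, with equal values at \<open>0\<close> and at infinity. The Bohm condition
  \<open>m\<^sub>b / v\<^sub>b\<^sup>2 + (1 + \<alpha>) m_inf / v_inf\<^sup>2 < 1\<close> says that \<open>N - n\<^sub>e\<close> has a positive derivative at \<open>0\<close>
  (\<open>charge_monotone_near_0\<close>), and the maximum principle (\<open>potential_stability\<close>) bounds \<open>\<phi>\<^sub>\<epsilon> - \<phi>\<close> by a
  multiple of \<open>\<epsilon>\<close>. The bounds on density and current follow, because \<open>N\<close> is Lipschitz continuous near \<open>0\<close>. Both
  potentials are monotone and take values between \<open>\<phi>\<^sub>b\<close> and \<open>0\<close>, so for small \<open>\<phi>\<^sub>b\<close> they stay in the
  neighbourhood of \<open>0\<close> in which these estimates hold.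
\<close>

section \<open>Continuously differentiable cutoffs on the line\<close>

definition C1_line :: "(real \<Rightarrow> real) \<Rightarrow> bool" where
  "C1_line h \<longleftrightarrow> (\<exists>h'. (\<forall>t. (h has_real_derivative h' t) (at t)) \<and> continuous_on UNIV h')"

lemma C1_lineI:
  assumes "\<And>t. (h has_real_derivative h' t) (at t)" and "continuous_on UNIV h'"
  shows "C1_line h"
  using assms unfolding C1_line_def by blast

text \<open>With the existential witness replaced by \<open>deriv h\<close>, closure proofs can name the derivative.\<close>

lemma C1_line_deriv:
  assumes "C1_line h"
  shows "(h has_real_derivative deriv h t) (at t)" and "continuous_on UNIV (deriv h)"
proof -
  obtain h' where h': "\<And>t. (h has_real_derivative h' t) (at t)" "continuous_on UNIV h'"
    using assms unfolding C1_line_def by blast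
  then have "deriv h = h'" by (auto intro: DERIV_imp_deriv)
  with h' show "(h has_real_derivative deriv h t) (at t)" "continuous_on UNIV (deriv h)" by auto
qed

lemma C1_line_continuous:
  assumes "C1_line h" and "continuous_on A g"
  shows "continuous_on A (\<lambda>x. h (g x))"
proof -
  have "continuous_on UNIV h"
    using C1_line_deriv(1)[OF assms(1)] by (meson DERIV_isCont continuous_at_imp_continuous_on)
  then show ?thesis using assms(2) by (rule continuous_on_compose2) auto
qed

lemma C1_line_deriv_continuous:
  assumes "C1_line h" and "continuous_on A g"
  shows "continuous_on A (\<lambda>x. deriv h (g x))"
  using C1_line_deriv(2)[OF assms(1)] assms(2) by (rule continuous_on_compose2) auto

lemma C1_line_const: "C1_line (\<lambda>t. c)"
  by (rule C1_lineI[where h' = "\<lambda>t. 0"]) auto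

lemma C1_line_id: "C1_line (\<lambda>t. t)"
  by (rule C1_lineI[where h' = "\<lambda>t. 1"]) auto

lemma C1_line_add:
  assumes "C1_line g" and "C1_line h"
  shows "C1_line (\<lambda>t. g t + h t)"
proof (rule C1_lineI[where h' = "\<lambda>t. deriv g t + deriv h t"])
  show "((\<lambda>t. g t + h t) has_real_derivative deriv g t + deriv h t) (at t)" for t
    by (rule DERIV_add[OF C1_line_deriv(1)[OF assms(1)] C1_line_deriv(1)[OF assms(2)]])
  show "continuous_on UNIV (\<lambda>t. deriv g t + deriv h t)"
    by (intro continuous_on_add C1_line_deriv(2) assms)
qed

lemma C1_line_mult:
  assumes "C1_line g" and "C1_line h"
  shows "C1_line (\<lambda>t. g t * h t)"
proof (rule C1_lineI[where h' = "\<lambda>t. deriv g t * h t + deriv h t * g t"])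
  show "((\<lambda>t. g t * h t) has_real_derivative deriv g t * h t + deriv h t * g t) (at t)" for t
    by (rule DERIV_mult[OF C1_line_deriv(1)[OF assms(1)] C1_line_deriv(1)[OF assms(2)]])
  show "continuous_on UNIV (\<lambda>t. deriv g t * h t + deriv h t * g t)"
    by (intro continuous_on_add continuous_on_mult C1_line_deriv(2)
        C1_line_continuous[OF assms(1) continuous_on_id] C1_line_continuous[OF assms(2) continuous_on_id] assms)
qed

lemma C1_line_compose:
  assumes "C1_line g" and "C1_line h"
  shows "C1_line (\<lambda>t. g (h t))"
proof (rule C1_lineI[where h' = "\<lambda>t. deriv g (h t) * deriv h t"])
  show "((\<lambda>t. g (h t)) has_real_derivative deriv g (h t) * deriv h t) (at t)" for t
    by (rule DERIV_chain2[OF C1_line_deriv(1)[OF assms(1)] C1_line_deriv(1)[OF assms(2)]])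
  show "continuous_on UNIV (\<lambda>t. deriv g (h t) * deriv h t)"
    by (intro continuous_on_mult C1_line_deriv(2) assms
        C1_line_deriv_continuous[OF assms(1) C1_line_continuous[OF assms(2) continuous_on_id]])
qed

lemma C1_line_diff:
  assumes "C1_line g" and "C1_line h"
  shows "C1_line (\<lambda>t. g t - h t)"
  using C1_line_add[OF assms(1) C1_line_mult[OF C1_line_const[of "-1"] assms(2)]] by simp

lemma C1_line_inverse_sqrt:
  assumes h: "C1_line h" and pos: "\<And>t. h t > 0"
  shows "C1_line (\<lambda>t. 1 / sqrt (h t))"
proof (rule C1_lineI[where h' = "\<lambda>t. - (deriv h t / 2) / (h t * sqrt (h t))"])
  fix t
  show "((\<lambda>t. 1 / sqrt (h t)) has_real_derivative - (deriv h t / 2) / (h t * sqrt (h t))) (at t)"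
    using pos[of t] by (auto intro!: derivative_eq_intros C1_line_deriv(1)[OF h] simp: field_simps)
next
  show "continuous_on UNIV (\<lambda>t. - (deriv h t / 2) / (h t * sqrt (h t)))"
    using pos
    by (intro continuous_intros C1_line_deriv_continuous[OF h continuous_on_id]
        C1_line_continuous[OF h continuous_on_id])
       (auto simp: less_imp_neq[THEN not_sym])
qed

text \<open>The simplest \<open>C\<^sup>1\<close> function that vanishes exactly on a half-line; every cutoff below is composed from
  it, so that no cutoff needs a pasting argument.\<close>

definition pos_square :: "real \<Rightarrow> real" where
  "pos_square t = (max 0 t)\<^sup>2"

lemma pos_square_has_derivative: "(pos_square has_real_derivative 2 * max 0 t) (at t)"
proof (cases "t = 0")
  case True
  have "((\<lambda>h. pos_square h / h) \<longlongrightarrow> 0) (at 0)"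
  proof (rule Lim_null_comparison)
    show "\<forall>\<^sub>F h in at 0. norm (pos_square h / h) \<le> \<bar>h\<bar>"
      by (rule always_eventually) (auto simp: pos_square_def max_def power2_eq_square)
    show "((\<lambda>h::real. \<bar>h\<bar>) \<longlongrightarrow> 0) (at 0)"
      by (auto intro!: tendsto_eq_intros)
  qed
  then show ?thesis using True by (simp add: DERIV_def pos_square_def)
next
  case False
  show ?thesis
  proof (cases "t > 0")
    case True
    have "((\<lambda>t. t\<^sup>2) has_real_derivative 2 * max 0 t) (at t)"
      using True by (auto intro!: derivative_eq_intros)
    then show ?thesis
      by (rule has_field_derivative_transform_within_open[where S="{0<..}"])
         (use True in \<open>auto simp: pos_square_def\<close>)
  next
    case F: False
    have "((\<lambda>t. 0) has_real_derivative 2 * max 0 t) (at t)"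
      using F by (auto intro!: derivative_eq_intros)
    then show ?thesis
      by (rule has_field_derivative_transform_within_open[where S="{..<0}"])
         (use F False in \<open>auto simp: pos_square_def\<close>)
  qed
qed

lemma C1_pos_square: "C1_line pos_square"
  by (rule C1_lineI[OF pos_square_has_derivative]) (auto intro!: continuous_intros)

text \<open>A \<open>C\<^sup>1\<close> transition from \<open>0\<close> on the negative axis to \<open>1\<close> beyond \<open>1\<close>.\<close>

definition smooth_step :: "real \<Rightarrow> real" where
  "smooth_step t = 1 - pos_square (1 - pos_square t)"

lemma C1_smooth_step: "C1_line smooth_step"
  unfolding smooth_step_def
  by (intro C1_line_diff C1_line_const C1_line_compose[OF C1_pos_square] C1_pos_square)

lemma smooth_step_has_derivative:
  "(smooth_step has_real_derivative 4 * max 0 (1 - pos_square t) * max 0 t) (at t)"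
  unfolding smooth_step_def
proof -
  have "((\<lambda>t. 1 - pos_square t) has_real_derivative 0 - 2 * max 0 t) (at t)"
    by (rule DERIV_diff[OF DERIV_const pos_square_has_derivative])
  from DERIV_diff[OF DERIV_const DERIV_chain2[OF pos_square_has_derivative this], of 1]
  show "((\<lambda>t. 1 - pos_square (1 - pos_square t)) has_real_derivative
      4 * max 0 (1 - pos_square t) * max 0 t) (at t)"
    by (simp add: mult.assoc)
qed

lemma smooth_step_eq_0: "t \<le> 0 \<Longrightarrow> smooth_step t = 0"
  by (simp add: smooth_step_def pos_square_def)

lemma smooth_step_eq_1: "1 \<le> t \<Longrightarrow> smooth_step t = 1"
  by (simp add: smooth_step_def pos_square_def)

lemma smooth_step_nonneg: "0 \<le> smooth_step t"
  and smooth_step_le_1: "smooth_step t \<le> 1"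
proof -
  have "0 \<le> pos_square s" for s by (simp add: pos_square_def)
  then have "pos_square (1 - pos_square t) \<le> 1"
    by (simp add: pos_square_def power_le_one)
  then show "0 \<le> smooth_step t" by (simp add: smooth_step_def)
  show "smooth_step t \<le> 1" by (simp add: smooth_step_def pos_square_def)
qed

lemma smooth_step_pos: "0 < t \<Longrightarrow> 0 < smooth_step t"
proof -
  assume "0 < t"
  then have "0 < pos_square t" by (auto simp: pos_square_def)
  then have "max 0 (1 - pos_square t) < 1" by simp
  then have "(max 0 (1 - pos_square t))\<^sup>2 < 1" 
    by (metis abs_of_nonneg abs_square_less_1 max.cobounded1)
  then show ?thesis by (simp add: smooth_step_def pos_square_def)
qed

lemma deriv_smooth_step_eq_0: "t \<le> 0 \<or> 1 \<le> t \<Longrightarrow> deriv smooth_step t = 0"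
proof -
  have "deriv smooth_step t = 4 * max 0 (1 - pos_square t) * max 0 t"
    by (rule DERIV_imp_deriv[OF smooth_step_has_derivative])
  moreover have "1 \<le> t \<Longrightarrow> 1 \<le> pos_square t" by (simp add: pos_square_def)
  ultimately show "t \<le> 0 \<or> 1 \<le> t \<Longrightarrow> deriv smooth_step t = 0" by auto
qed

text \<open>The sign function, regularised on \<open>{-\<delta>..\<delta>}\<close>. Test functions use it to treat particles that move to the right
  and to the left differently.\<close>

definition smooth_sign :: "real \<Rightarrow> real \<Rightarrow> real" where
  "smooth_sign \<delta> y = smooth_step (y / \<delta>) - smooth_step (- y / \<delta>)"

lemma C1_line_scale: "C1_line (\<lambda>t. a * t + b)"
  by (intro C1_line_add C1_line_mult C1_line_const C1_line_id)

lemma C1_smooth_sign: "C1_line (smooth_sign \<delta>)"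
proof -
  have "C1_line (\<lambda>y. smooth_step ((1 / \<delta>) * y + 0) - smooth_step ((- 1 / \<delta>) * y + 0))"
    by (intro C1_line_diff C1_line_compose[OF C1_smooth_step] C1_line_scale)
  then show ?thesis by (simp add: smooth_sign_def[abs_def])
qed

lemma smooth_sign_minus: "smooth_sign \<delta> (- y) = - smooth_sign \<delta> y"
  by (simp add: smooth_sign_def)

lemma abs_smooth_sign_le_1: "\<bar>smooth_sign \<delta> y\<bar> \<le> 1"
  using smooth_step_nonneg[of "y / \<delta>"] smooth_step_nonneg[of "- y / \<delta>"]
    smooth_step_le_1[of "y / \<delta>"] smooth_step_le_1[of "- y / \<delta>"]
  unfolding smooth_sign_def abs_le_iff by linarith

lemma smooth_sign_eq_1: "\<delta> > 0 \<Longrightarrow> \<delta> \<le> y \<Longrightarrow> smooth_sign \<delta> y = 1"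
  by (simp add: smooth_sign_def smooth_step_eq_1 smooth_step_eq_0)

lemma smooth_sign_pos: "\<delta> > 0 \<Longrightarrow> y > 0 \<Longrightarrow> smooth_sign \<delta> y > 0"
  by (simp add: smooth_sign_def smooth_step_pos smooth_step_eq_0)

lemma mult_smooth_sign_pos: "\<delta> > 0 \<Longrightarrow> y \<noteq> 0 \<Longrightarrow> y * smooth_sign \<delta> y > 0"
  using smooth_sign_pos[of \<delta> y] smooth_sign_pos[of \<delta> "- y"] smooth_sign_minus[of \<delta> y]
  by (cases "y > 0") (auto simp: mult_neg_neg)

lemma mult_smooth_sign_nonneg: "\<delta> > 0 \<Longrightarrow> y * smooth_sign \<delta> y \<ge> 0"
  using mult_smooth_sign_pos[of \<delta> y] by (cases "y = 0") auto

lemma mult_smooth_sign_eq_abs: "\<delta> > 0 \<Longrightarrow> \<delta> \<le> \<bar>y\<bar> \<Longrightarrow> y * smooth_sign \<delta> y = \<bar>y\<bar>"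
  using smooth_sign_eq_1[of \<delta> y] smooth_sign_eq_1[of \<delta> "- y"] smooth_sign_minus[of \<delta> y]
  by (cases "y > 0") auto

lemma deriv_smooth_sign_eq_0:
  assumes "\<delta> > 0" and "\<delta> \<le> \<bar>y\<bar>"
  shows "deriv (smooth_sign \<delta>) y = 0"
proof -
  have s: "((\<lambda>y. smooth_step (c * y)) has_real_derivative deriv smooth_step (c * y) * c) (at y)" for c
    by (rule DERIV_chain2[OF C1_line_deriv(1)[OF C1_smooth_step]]) (auto intro!: derivative_eq_intros)
  have "(smooth_sign \<delta> has_real_derivative
      deriv smooth_step (1 / \<delta> * y) * (1 / \<delta>) - deriv smooth_step (- 1 / \<delta> * y) * (- 1 / \<delta>)) (at y)"
    using DERIV_diff[OF s[of "1 / \<delta>"] s[of "- 1 / \<delta>"]] by (simp add: smooth_sign_def[abs_def])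
  moreover have "deriv smooth_step (1 / \<delta> * y) = 0" "deriv smooth_step (- 1 / \<delta> * y) = 0"
  proof -
    have "\<bar>y / \<delta>\<bar> \<ge> 1" using assms by simp
    then have "y / \<delta> \<le> 0 \<and> 1 \<le> - y / \<delta> \<or> - y / \<delta> \<le> 0 \<and> 1 \<le> y / \<delta>" by linarith
    then show "deriv smooth_step (1 / \<delta> * y) = 0" "deriv smooth_step (- 1 / \<delta> * y) = 0"
      by (auto intro!: deriv_smooth_step_eq_0)
  qed
  ultimately show ?thesis by (simp add: DERIV_imp_deriv)
qed

definition plateau :: "nat \<Rightarrow> real \<Rightarrow> real" where
  "plateau n t = smooth_step (real n + 1 - t) * smooth_step (real n + 1 + t)"

lemma C1_plateau: "C1_line (plateau n)"
  unfolding plateau_def[abs_def]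
  by (intro C1_line_mult C1_line_compose[OF C1_smooth_step] C1_line_add C1_line_diff C1_line_const C1_line_id)

lemma plateau_nonneg: "0 \<le> plateau n t" and plateau_le_1: "plateau n t \<le> 1"
  by (auto simp: plateau_def smooth_step_nonneg smooth_step_le_1 mult_le_one)

lemma plateau_eq_0: "real n + 1 \<le> \<bar>t\<bar> \<Longrightarrow> plateau n t = 0"
  by (auto simp: plateau_def smooth_step_eq_0 abs_if split: if_splits)

lemma plateau_eq_1: "\<bar>t\<bar> \<le> real n \<Longrightarrow> plateau n t = 1"
  by (auto simp: plateau_def smooth_step_eq_1 abs_le_iff)

section \<open>Functions on phase space\<close>

text \<open>The regularity that the definition of a test function asks for.\<close>

definition C1_phase :: "(real \<times> (real^3) \<Rightarrow> real) \<Rightarrow> bool" where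
  "C1_phase \<psi> \<longleftrightarrow> (\<exists>D :: real \<times> (real^3) \<Rightarrow> (real \<times> (real^3)) \<Rightarrow>\<^sub>L real.
        (\<forall>z\<in>phase_space. (\<psi> has_derivative blinfun_apply (D z)) (at z within phase_space)) \<and>
        continuous_on phase_space D)"

lemma C1_phase_continuous: "C1_phase \<psi> \<Longrightarrow> continuous_on phase_space \<psi>"
  unfolding C1_phase_def by (meson has_derivative_continuous_on)

lemma C1_phaseI:
  assumes "\<And>z. z \<in> phase_space \<Longrightarrow> (\<psi> has_derivative blinfun_apply (D z)) (at z within phase_space)"
    and "continuous_on phase_space D"
  shows "C1_phase \<psi>"
  using assms unfolding C1_phase_def by blast

lemma C1_phase_const: "C1_phase (\<lambda>z. c)"
  by (rule C1_phaseI[where D = "\<lambda>z. 0"]) (auto simp: zero_blinfun.rep_eq)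

lemma C1_phase_linear:
  assumes "bounded_linear l"
  shows "C1_phase l"
  by (rule C1_phaseI[where D = "\<lambda>z. Blinfun l"])
     (auto simp: bounded_linear_Blinfun_apply[OF assms] intro: bounded_linear_imp_has_derivative assms)

lemma C1_phase_add:
  assumes "C1_phase g" and "C1_phase h"
  shows "C1_phase (\<lambda>z. g z + h z)"
proof -
  obtain D E where *: "\<forall>z\<in>phase_space. (g has_derivative blinfun_apply (D z)) (at z within phase_space)"
      "continuous_on phase_space D"
      "\<forall>z\<in>phase_space. (h has_derivative blinfun_apply (E z)) (at z within phase_space)"
      "continuous_on phase_space E"
    using assms unfolding C1_phase_def by blast
  show ?thesis
    by (rule C1_phaseI[where D = "\<lambda>z. D z + E z"])
       (use * in \<open>auto intro!: derivative_eq_intros continuous_intros simp: plus_blinfun.rep_eq fun_eq_iff\<close>)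
qed

lemma C1_phase_mult:
  assumes "C1_phase g" and "C1_phase h"
  shows "C1_phase (\<lambda>z. g z * h z)"
proof -
  obtain D E where *: "\<forall>z\<in>phase_space. (g has_derivative blinfun_apply (D z)) (at z within phase_space)"
      "continuous_on phase_space D"
      "\<forall>z\<in>phase_space. (h has_derivative blinfun_apply (E z)) (at z within phase_space)"
      "continuous_on phase_space E"
    using assms unfolding C1_phase_def by blast
  show ?thesis
  proof (rule C1_phaseI[where D = "\<lambda>z. g z *\<^sub>R E z + h z *\<^sub>R D z"])
    fix z assume z: "z \<in> phase_space"
    show "((\<lambda>z. g z * h z) has_derivative blinfun_apply (g z *\<^sub>R E z + h z *\<^sub>R D z)) (at z within phase_space)"
      by (rule has_derivative_eq_rhs[OF has_derivative_mult[OF *(1)[rule_format, OF z] *(3)[rule_format, OF z]]])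
         (auto simp: plus_blinfun.rep_eq scaleR_blinfun.rep_eq fun_eq_iff)
  next
    show "continuous_on phase_space (\<lambda>z. g z *\<^sub>R E z + h z *\<^sub>R D z)"
      by (intro continuous_on_add continuous_on_scaleR C1_phase_continuous assms *)
  qed
qed

lemma C1_phase_compose:
  assumes "C1_line h" and "C1_phase g"
  shows "C1_phase (\<lambda>z. h (g z))"
proof -
  obtain D where *: "\<forall>z\<in>phase_space. (g has_derivative blinfun_apply (D z)) (at z within phase_space)"
      "continuous_on phase_space D"
    using assms(2) unfolding C1_phase_def by blast
  show ?thesis
  proof (rule C1_phaseI[where D = "\<lambda>z. deriv h (g z) *\<^sub>R D z"])
    fix z assume z: "z \<in> phase_space"
    have h: "(h has_derivative (\<lambda>y. y * deriv h (g z))) (at (g z))"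
      using C1_line_deriv(1)[OF assms(1)]
      by (metis (no_types, lifting) ext has_field_derivative_def mult.commute)
    show "((\<lambda>z. h (g z)) has_derivative blinfun_apply (deriv h (g z) *\<^sub>R D z)) (at z within phase_space)"
      by (rule has_derivative_eq_rhs[OF has_derivative_compose[OF *(1)[rule_format, OF z] h]])
         (auto simp: scaleR_blinfun.rep_eq fun_eq_iff)
  next
    show "continuous_on phase_space (\<lambda>z. deriv h (g z) *\<^sub>R D z)"
      by (intro continuous_on_scaleR C1_line_deriv_continuous[OF assms(1) C1_phase_continuous[OF assms(2)]] *)
  qed
qed

lemma C1_on_has_derivative:
  assumes "C1_on {0..} \<phi>" and "x \<ge> 0"
  shows "(\<phi> has_real_derivative deriv_on {0..} \<phi> x) (at x within {0..})"
proof -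
  have "\<phi> differentiable (at x within {0..})"
    using assms unfolding C1_on_def differentiable_on_def by auto
  then show ?thesis unfolding deriv_on_def
    by (simp add: vector_derivative_works has_real_derivative_iff_has_vector_derivative)
qed

lemma C1_on_DERIV:
  assumes "C1_on {0..} \<phi>" and "x > 0"
  shows "(\<phi> has_real_derivative deriv_on {0..} \<phi> x) (at x)" and "deriv \<phi> x = deriv_on {0..} \<phi> x"
proof -
  have "at x within {0..} = at x"
    using assms(2) by (intro at_within_interior) (simp add: interior_real_atLeast)
  then show *: "(\<phi> has_real_derivative deriv_on {0..} \<phi> x) (at x)"
    using C1_on_has_derivative[OF assms(1), of x] assms(2) by simp
  show "deriv \<phi> x = deriv_on {0..} \<phi> x" by (rule DERIV_imp_deriv[OF *])
qed

lemma C1_phase_potential: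
  assumes "C1_on {0..} \<phi>"
  shows "C1_phase (\<lambda>z. \<phi> (fst z))"
proof (rule C1_phaseI[where D = "\<lambda>z. deriv_on {0..} \<phi> (fst z) *\<^sub>R Blinfun fst"])
  fix z :: "real \<times> (real^3)" assume z: "z \<in> phase_space"
  have "(\<phi> has_derivative (\<lambda>y. y * deriv_on {0..} \<phi> (fst z))) (at (fst z) within fst ` phase_space)"
    using C1_on_has_derivative[OF assms, of "fst z"] z
    by (auto simp: has_field_derivative_def mult.commute[of _ "deriv_on _ _ _"] intro: has_derivative_subset)
  from has_derivative_in_compose[OF has_derivative_fst[OF has_derivative_ident] this]
  show "((\<lambda>z. \<phi> (fst z)) has_derivative blinfun_apply (deriv_on {0..} \<phi> (fst z) *\<^sub>R Blinfun fst))
      (at z within phase_space)"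
    by (rule has_derivative_eq_rhs)
       (auto simp: scaleR_blinfun.rep_eq bounded_linear_Blinfun_apply[OF bounded_linear_fst] fun_eq_iff)
next
  have "continuous_on phase_space (\<lambda>z::real \<times> (real^3). deriv_on {0..} \<phi> (fst z))"
    using assms unfolding C1_on_def
    by (intro continuous_on_compose2[of "{0..}" "deriv_on {0..} \<phi>" _ fst] continuous_intros) auto
  then show "continuous_on phase_space (\<lambda>z. deriv_on {0..} \<phi> (fst z) *\<^sub>R (Blinfun fst :: (real \<times> (real^3)) \<Rightarrow>\<^sub>L real))"
    by (intro continuous_intros)
qed

section \<open>Fluxes of invariants\<close>

lemma C1_line_compact_support_bounded:
  assumes "C1_line h" and "\<And>t. \<bar>t\<bar> > R \<Longrightarrow> h t = 0"
  obtains C where "C \<ge> 0" and "\<And>t. \<bar>h t\<bar> \<le> C"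
proof -
  have "compact (h ` {-R..R})"
    by (intro compact_continuous_image C1_line_continuous[OF assms(1) continuous_on_id] compact_Icc)
  then obtain C where C: "\<And>t. t \<in> {-R..R} \<Longrightarrow> \<bar>h t\<bar> \<le> C"
    by (metis bounded_iff compact_imp_bounded image_eqI real_norm_def)
  have "\<bar>h t\<bar> \<le> max 0 C" for t
  proof (cases "\<bar>t\<bar> > R")
    case False
    then have "t \<in> {-R..R}" by auto
    then show ?thesis using C by fastforce
  qed (use assms(2) in auto)
  then show ?thesis using that[of "max 0 C"] by auto
qed

text \<open>The slices converge in \<open>L\<^sup>1\<close> and the weights are uniformly bounded and converge pointwise, which is the form in
  which \<open>f\<close> and the potential depend on \<open>x\<close> and behave as \<open>x\<close> tends to infinity.\<close>

lemma L1_pairing_tendsto: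
  fixes g :: "nat \<Rightarrow> real^3 \<Rightarrow> real"
  assumes g: "\<And>n. integrable lborel (g n)" and g0: "integrable lborel g0"
    and lim: "(\<lambda>n. L1_norm (\<lambda>\<xi>. g n \<xi> - g0 \<xi>)) \<longlonglongrightarrow> 0"
    and W[measurable]: "\<And>n. W n \<in> borel_measurable borel"
    and bound: "\<And>n \<xi>. \<bar>W n \<xi>\<bar> \<le> C" and W0: "\<And>\<xi>. (\<lambda>n. W n \<xi>) \<longlonglongrightarrow> W0 \<xi>"
  shows "(\<lambda>n. LINT \<xi>|lborel. g n \<xi> * W n \<xi>) \<longlonglongrightarrow> (LINT \<xi>|lborel. g0 \<xi> * W0 \<xi>)"
proof -
  have [measurable]: "g n \<in> borel_measurable borel" "g0 \<in> borel_measurable borel" for n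
    using g g0 by (auto dest: borel_measurable_integrable)
  have W0m[measurable]: "W0 \<in> borel_measurable borel"
    by (rule borel_measurable_LIMSEQ_real[where u = W]) (auto intro: W0)
  have int_mult: "integrable lborel (\<lambda>\<xi>. h \<xi> * W n \<xi>)" if "integrable lborel h" for h n
  proof (rule Bochner_Integration.integrable_bound[where f = "\<lambda>\<xi>. C * \<bar>h \<xi>\<bar>"])
    have [measurable]: "h \<in> borel_measurable borel" using that by (auto dest: borel_measurable_integrable)
    show "(\<lambda>\<xi>. h \<xi> * W n \<xi>) \<in> borel_measurable lborel" by simp
    show "integrable lborel (\<lambda>\<xi>. C * \<bar>h \<xi>\<bar>)" using that by auto
    have "\<bar>h \<xi>\<bar> * \<bar>W n \<xi>\<bar> \<le> \<bar>C * h \<xi>\<bar>" for \<xi>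
    proof -
      have "0 \<le> C" using bound[of n \<xi>] by linarith
      then show ?thesis using bound[of n \<xi>] by (simp add: abs_mult mult.commute[of C] mult_left_mono)
    qed
    then show "AE \<xi> in lborel. norm (h \<xi> * W n \<xi>) \<le> norm (C * \<bar>h \<xi>\<bar>)"
      by (auto simp: abs_mult)
  qed
  have dom: "(\<lambda>n. LINT \<xi>|lborel. g0 \<xi> * W n \<xi>) \<longlonglongrightarrow> (LINT \<xi>|lborel. g0 \<xi> * W0 \<xi>)"
  proof (rule integral_dominated_convergence[where w = "\<lambda>\<xi>. C * \<bar>g0 \<xi>\<bar>"])
    show "integrable lborel (\<lambda>\<xi>. C * \<bar>g0 \<xi>\<bar>)" using g0 by auto
    show "AE \<xi> in lborel. (\<lambda>n. g0 \<xi> * W n \<xi>) \<longlonglongrightarrow> g0 \<xi> * W0 \<xi>"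
      by (auto intro!: tendsto_intros W0)
    show "AE \<xi> in lborel. norm (g0 \<xi> * W n \<xi>) \<le> C * \<bar>g0 \<xi>\<bar>" for n
      using bound by (auto simp: abs_mult mult.commute[of C] intro!: mult_left_mono)
  qed simp_all
  define a where "a n = (LINT \<xi>|lborel. \<bar>g n \<xi> - g0 \<xi>\<bar>)" for n
  have int_diff: "integrable lborel (\<lambda>\<xi>. g n \<xi> - g0 \<xi>)" for n using g g0 by auto
  have "L1_norm (\<lambda>\<xi>. g n \<xi> - g0 \<xi>) = ennreal (a n)" for n
    unfolding L1_norm_def a_def using int_diff[of n]
    by (intro nn_integral_eq_integral integrable_abs) auto
  with lim have "(\<lambda>n. ennreal (a n)) \<longlonglongrightarrow> ennreal 0" by simp
  moreover have "0 \<le> a n" for n unfolding a_def by simp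
  ultimately have "a \<longlonglongrightarrow> 0" by (intro tendsto_ennrealD) auto
  then have Ca: "(\<lambda>n. C * a n) \<longlonglongrightarrow> 0" by (auto intro: tendsto_mult_right_zero)
  have bd: "norm (LINT \<xi>|lborel. (g n \<xi> - g0 \<xi>) * W n \<xi>) \<le> C * a n" for n
  proof -
    have "norm (LINT \<xi>|lborel. (g n \<xi> - g0 \<xi>) * W n \<xi>) \<le> (LINT \<xi>|lborel. C * \<bar>g n \<xi> - g0 \<xi>\<bar>)"
    proof (rule Bochner_Integration.integral_norm_bound_integral[OF int_mult[OF int_diff]])
      show "integrable lborel (\<lambda>\<xi>. C * \<bar>g n \<xi> - g0 \<xi>\<bar>)" using int_diff[of n] by auto
      show "norm ((g n \<xi> - g0 \<xi>) * W n \<xi>) \<le> C * \<bar>g n \<xi> - g0 \<xi>\<bar>" for \<xi>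
        using bound by (auto simp: abs_mult mult.commute[of C] intro!: mult_left_mono)
    qed
    then show ?thesis unfolding a_def by simp
  qed
  have "(\<lambda>n. LINT \<xi>|lborel. (g n \<xi> - g0 \<xi>) * W n \<xi>) \<longlonglongrightarrow> 0"
    by (rule Lim_null_comparison[OF always_eventually Ca]) (use bd in auto)
  from tendsto_add[OF this dom]
  show ?thesis using int_mult[OF g] int_mult[OF g0] int_mult[OF int_diff]
    by (simp add: left_diff_distrib)
qed

text \<open>The energy \<open>\<xi>\<^sub>1\<^sup>2 / 2 - t\<close> (with \<open>t\<close> the value of the potential), the sign of \<open>\<xi>\<^sub>1\<close> away from turning points, and
  \<open>\<xi>\<^sub>2, \<xi>\<^sub>3\<close> are the invariants of a particle. The weight is \<open>\<xi>\<^sub>1\<close> times a function of these invariants, so that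
  its pairing with a slice of \<open>f\<close> measures a flux through the plane of that slice.\<close>

definition flux_weight :: "(real \<Rightarrow> real) \<Rightarrow> (real \<Rightarrow> real) \<Rightarrow> (real \<Rightarrow> real) \<Rightarrow> real \<Rightarrow> real^3 \<Rightarrow> real" where
  "flux_weight \<sigma> p q t \<xi> = \<xi>$1 * \<sigma> (\<xi>$1) * p ((\<xi>$1)\<^sup>2 / 2 - t) * q (\<xi>$2) * q (\<xi>$3)"

lemma flux_weight_continuous:
  assumes "C1_line \<sigma>" and "C1_line p" and "C1_line q" and "continuous_on A t" and "continuous_on A v"
  shows "continuous_on A (\<lambda>z. flux_weight \<sigma> p q (t z) (v z))"
  unfolding flux_weight_def
  by (intro continuous_intros C1_line_continuous[OF assms(1)] C1_line_continuous[OF assms(2)]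
      C1_line_continuous[OF assms(3)] assms(4,5)) simp

lemma flux_weight_measurable:
  assumes "C1_line \<sigma>" and "C1_line p" and "C1_line q"
  shows "flux_weight \<sigma> p q t \<in> borel_measurable borel"
  by (rule borel_measurable_continuous_onI) (intro flux_weight_continuous continuous_intros assms)

lemma flux_weight_bounded:
  assumes "C1_line p" and "C1_line q" and \<sigma>: "\<And>y. \<bar>\<sigma> y\<bar> \<le> 1"
    and p: "\<And>e. \<bar>e\<bar> > R \<Longrightarrow> p e = 0" and q: "\<And>y. \<bar>y\<bar> > R \<Longrightarrow> q y = 0"
  obtains C where "\<And>t \<xi>. \<bar>t\<bar> \<le> T \<Longrightarrow> \<bar>flux_weight \<sigma> p q t \<xi>\<bar> \<le> C"
proof -
  obtain P where P: "P \<ge> 0" "\<And>e. \<bar>p e\<bar> \<le> P"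
    using C1_line_compact_support_bounded[OF assms(1) p] by blast
  obtain Q where Q: "Q \<ge> 0" "\<And>y. \<bar>q y\<bar> \<le> Q"
    using C1_line_compact_support_bounded[OF assms(2) q] by blast
  have "\<bar>flux_weight \<sigma> p q t \<xi>\<bar> \<le> sqrt (2 * (\<bar>R\<bar> + \<bar>T\<bar>)) * 1 * P * Q * Q" if t: "\<bar>t\<bar> \<le> T" for t \<xi>
  proof (cases "\<bar>(\<xi>$1)\<^sup>2 / 2 - t\<bar> > R")
    case True
    then show ?thesis using p[OF True] P Q by (simp add: flux_weight_def)
  next
    case False
    then have "(\<xi>$1)\<^sup>2 / 2 \<le> \<bar>R\<bar> + \<bar>T\<bar>" using t by linarith
    then have "(\<xi>$1)\<^sup>2 \<le> 2 * (\<bar>R\<bar> + \<bar>T\<bar>)" by simp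
    then have "\<bar>\<xi>$1\<bar> \<le> sqrt (2 * (\<bar>R\<bar> + \<bar>T\<bar>))" using real_le_rsqrt by fastforce
    then show ?thesis unfolding flux_weight_def abs_mult
      by (intro mult_mono \<sigma> P Q mult_nonneg_nonneg) (use P Q in auto)
  qed
  then show ?thesis by (rule that)
qed

locale VP =
  fixes n\<^sub>e :: "real \<Rightarrow> real" and \<alpha> \<phi>\<^sub>b :: real and f\<^sub>b f_inf :: "real^3 \<Rightarrow> real"
    and f :: "real \<Rightarrow> real^3 \<Rightarrow> real" and \<phi> :: "real \<Rightarrow> real"
  assumes solution: "VP_solution n\<^sub>e \<alpha> \<phi>\<^sub>b f\<^sub>b f_inf f \<phi>"
begin

lemma f_locally_integrable: "compact K \<Longrightarrow> K \<subseteq> phase_space \<Longrightarrow> set_integrable lborel K (\<lambda>(x, \<xi>). f x \<xi>)"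
  and f_integrable: "x \<ge> 0 \<Longrightarrow> integrable lborel (f x)"
  and f_L1_continuous: "x \<ge> 0 \<Longrightarrow> ((\<lambda>y. L1_norm (\<lambda>\<xi>. f y \<xi> - f x \<xi>)) \<longlongrightarrow> 0) (at x within {0..})"
  and phi_C1: "C1_on {0..} \<phi>" and phi_C2: "C2_on {0<..} \<phi>"
  and f_nonneg: "x \<ge> 0 \<Longrightarrow> AE \<xi> in lborel. f x \<xi> \<ge> 0"
  and phi_sign: "(\<forall>x\<ge>0. deriv_on {0..} \<phi> x > 0) \<or> (\<forall>x\<ge>0. deriv_on {0..} \<phi> x < 0)"
  and weak_form: "test_function \<alpha> \<psi> \<Longrightarrow>
        (LINT (x, \<xi>):{0<..} \<times> UNIV|lborel.
            f x \<xi> * (\<xi>$1 * dir_deriv (1, 0) \<psi> (x, \<xi>)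
                     + deriv \<phi> x * dir_deriv (0, axis 1 1) \<psi> (x, \<xi>)))
        + (LINT \<xi>:{\<xi>. \<xi>$1 > 0}|lborel. f\<^sub>b \<xi> * (\<xi>$1 * \<psi> (0, \<xi>))) = 0"
  and f_limit: "((\<lambda>x. L1_norm (\<lambda>\<xi>. f x \<xi> - f_inf \<xi>)) \<longlongrightarrow> 0) at_top"
  and poisson: "x > 0 \<Longrightarrow> deriv (deriv \<phi>) x = (LINT \<xi>|lborel. f x \<xi>) - n\<^sub>e (\<phi> x)"
  and phi_0: "\<phi> 0 = \<phi>\<^sub>b" and phi_limit: "(\<phi> \<longlongrightarrow> 0) at_top"
  using solution unfolding VP_solution_def by blast+

lemma phi_continuous: "continuous_on {0..} \<phi>"
  using phi_C1 unfolding C1_on_def by (blast intro: differentiable_imp_continuous_on)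

lemma phi_monotone:
  "(strict_mono_on {0..} \<phi> \<and> (\<forall>x\<ge>0. \<phi> x \<le> 0)) \<or>
   (strict_antimono_on {0..} \<phi> \<and> (\<forall>x\<ge>0. 0 \<le> \<phi> x))"
  using phi_sign
proof
  assume pos: "\<forall>x\<ge>0. deriv_on {0..} \<phi> x > 0"
  have inc: "\<phi> x < \<phi> y" if "0 \<le> x" "x < y" for x y
  proof (rule DERIV_pos_imp_increasing_open[OF that(2)])
    show "\<exists>d. (\<phi> has_real_derivative d) (at u) \<and> 0 < d" if "x < u" "u < y" for u
      using C1_on_DERIV(1)[OF phi_C1, of u] pos that \<open>0 \<le> x\<close> by auto
    show "continuous_on {x..y} \<phi>" by (rule continuous_on_subset[OF phi_continuous]) (use that in auto)
  qed
  have "\<phi> x \<le> 0" if "x \<ge> 0" for x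
    by (rule tendsto_lowerbound[OF phi_limit])
       (use inc that in \<open>auto intro!: eventually_at_top_linorderI[of "x + 1"] less_imp_le\<close>)
  with inc show ?thesis by (auto intro!: strict_mono_onI)
next
  assume neg: "\<forall>x\<ge>0. deriv_on {0..} \<phi> x < 0"
  have dec: "\<phi> x > \<phi> y" if "0 \<le> x" "x < y" for x y
  proof (rule DERIV_neg_imp_decreasing_open[OF that(2)])
    show "\<exists>d. (\<phi> has_real_derivative d) (at u) \<and> d < 0" if "x < u" "u < y" for u
      using C1_on_DERIV(1)[OF phi_C1, of u] neg that \<open>0 \<le> x\<close> by auto
    show "continuous_on {x..y} \<phi>" by (rule continuous_on_subset[OF phi_continuous]) (use that in auto)
  qed
  have "0 \<le> \<phi> x" if "x \<ge> 0" for x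
    by (rule tendsto_upperbound[OF phi_limit])
       (use dec that in \<open>auto intro!: eventually_at_top_linorderI[of "x + 1"] less_imp_le\<close>)
  with dec show ?thesis by (auto intro!: monotone_onI)
qed

lemma phi_bound: "x \<ge> 0 \<Longrightarrow> \<bar>\<phi> x\<bar> \<le> \<bar>\<phi>\<^sub>b\<bar>"
  using phi_monotone phi_0
  by (cases "x = 0") (force dest: strict_mono_onD[of "{0..}" \<phi> 0 x] monotone_onD[of "{0..}" _ _ \<phi> 0 x])+

text \<open>No particle of energy above \<open>max 0 (- \<phi> x)\<close> meets a turning point to the right of \<open>x\<close>: this number bounds the
  potential energy \<open>- \<phi>\<close> there, whatever the direction in which \<open>\<phi>\<close> is monotone.\<close>

lemma phi_barrier: "0 \<le> x \<Longrightarrow> x \<le> y \<Longrightarrow> - \<phi> y \<le> max 0 (- \<phi> x)"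
  using phi_monotone
  by (cases "x = y") (force dest: strict_mono_onD[of "{0..}" \<phi> x y] monotone_onD[of "{0..}" _ _ \<phi> x y])+

definition flux :: "(real \<Rightarrow> real) \<Rightarrow> (real \<Rightarrow> real) \<Rightarrow> (real \<Rightarrow> real) \<Rightarrow> real \<Rightarrow> real" where
  "flux \<sigma> p q x = (LINT \<xi>|lborel. f x \<xi> * flux_weight \<sigma> p q (\<phi> x) \<xi>)"

lemma flux_continuous:
  assumes C1: "C1_line \<sigma>" "C1_line p" "C1_line q" and \<sigma>: "\<And>y. \<bar>\<sigma> y\<bar> \<le> 1"
    and p: "\<And>e. \<bar>e\<bar> > R \<Longrightarrow> p e = 0" and q: "\<And>y. \<bar>y\<bar> > R \<Longrightarrow> q y = 0"
  shows "continuous_on {0..} (flux \<sigma> p q)"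
proof (rule continuous_on_sequentiallyI)
  fix u :: "nat \<Rightarrow> real" and a assume u: "\<forall>n. u n \<in> {0..}" "a \<in> {0..}" "u \<longlonglongrightarrow> a"
  obtain C where C: "\<And>t \<xi>. \<bar>t\<bar> \<le> \<bar>\<phi>\<^sub>b\<bar> \<Longrightarrow> \<bar>flux_weight \<sigma> p q t \<xi>\<bar> \<le> C"
    using flux_weight_bounded[where \<sigma>=\<sigma> and T="\<bar>\<phi>\<^sub>b\<bar>", OF C1(2,3) \<sigma> p q] by blast
  have "continuous (at a within {0..}) (\<lambda>y. L1_norm (\<lambda>\<xi>. f y \<xi> - f a \<xi>))"
    using f_L1_continuous[of a] u(2) unfolding continuous_within by (simp add: L1_norm_def)
  then have lim: "(\<lambda>n. L1_norm (\<lambda>\<xi>. f (u n) \<xi> - f a \<xi>)) \<longlonglongrightarrow> 0"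
    unfolding continuous_within_sequentially using u by (auto simp: o_def L1_norm_def)
  have phi: "(\<lambda>n. \<phi> (u n)) \<longlonglongrightarrow> \<phi> a"
    using phi_continuous u unfolding continuous_on_sequentially by (auto simp: o_def)
  show "(\<lambda>n. flux \<sigma> p q (u n)) \<longlonglongrightarrow> flux \<sigma> p q a"
    unfolding flux_def
  proof (rule L1_pairing_tendsto[OF _ _ lim])
    show "(\<lambda>n. flux_weight \<sigma> p q (\<phi> (u n)) \<xi>) \<longlonglongrightarrow> flux_weight \<sigma> p q (\<phi> a) \<xi>" for \<xi>
      by (rule continuous_on_tendsto_compose[OF flux_weight_continuous[OF C1 continuous_on_id continuous_on_const] phi, of UNIV])
         auto
  qed (use u in \<open>auto intro!: f_integrable flux_weight_measurable C1 C phi_bound\<close>)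
qed

lemma flux_limit:
  assumes C1: "C1_line \<sigma>" "C1_line p" "C1_line q" and \<sigma>: "\<And>y. \<bar>\<sigma> y\<bar> \<le> 1"
    and p: "\<And>e. \<bar>e\<bar> > R \<Longrightarrow> p e = 0" and q: "\<And>y. \<bar>y\<bar> > R \<Longrightarrow> q y = 0"
    and g: "integrable lborel f_inf"
  shows "(flux \<sigma> p q \<longlongrightarrow> (LINT \<xi>|lborel. f_inf \<xi> * flux_weight \<sigma> p q 0 \<xi>)) at_top"
proof (rule tendsto_at_topI_sequentially)
  fix u' :: "nat \<Rightarrow> real" assume u': "filterlim u' at_top sequentially"
  define u where "u n = max 0 (u' n)" for n
  have u: "filterlim u at_top sequentially"
    by (rule filterlim_at_top_mono[OF u']) (auto simp: u_def)
  have u0: "u n \<ge> 0" for n by (simp add: u_def)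
  obtain C where C: "\<And>t \<xi>. \<bar>t\<bar> \<le> \<bar>\<phi>\<^sub>b\<bar> \<Longrightarrow> \<bar>flux_weight \<sigma> p q t \<xi>\<bar> \<le> C"
    using flux_weight_bounded[where \<sigma>=\<sigma> and T="\<bar>\<phi>\<^sub>b\<bar>", OF C1(2,3) \<sigma> p q] by blast
  have lim: "(\<lambda>n. L1_norm (\<lambda>\<xi>. f (u n) \<xi> - f_inf \<xi>)) \<longlonglongrightarrow> 0"
    by (rule filterlim_compose[OF f_limit u])
  have phi: "(\<lambda>n. \<phi> (u n)) \<longlonglongrightarrow> 0"
    by (rule filterlim_compose[OF phi_limit u])
  have "(\<lambda>n. flux \<sigma> p q (u n)) \<longlonglongrightarrow> (LINT \<xi>|lborel. f_inf \<xi> * flux_weight \<sigma> p q 0 \<xi>)"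
    unfolding flux_def
  proof (rule L1_pairing_tendsto[OF _ g lim])
    show "(\<lambda>n. flux_weight \<sigma> p q (\<phi> (u n)) \<xi>) \<longlonglongrightarrow> flux_weight \<sigma> p q 0 \<xi>" for \<xi>
      by (rule continuous_on_tendsto_compose[OF flux_weight_continuous[OF C1 continuous_on_id continuous_on_const] phi, of UNIV])
         auto
  qed (use u0 in \<open>auto intro!: f_integrable flux_weight_measurable C1 C phi_bound\<close>)
  moreover have "\<forall>\<^sub>F n in sequentially. u n = u' n"
    using filterlim_at_top_dense[THEN iffD1, OF u', rule_format, of 0]
    by eventually_elim (simp add: u_def)
  ultimately show "(\<lambda>n. flux \<sigma> p q (u' n)) \<longlonglongrightarrow> (LINT \<xi>|lborel. f_inf \<xi> * flux_weight \<sigma> p q 0 \<xi>)"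
    by (rule Lim_transform_eventually[OF _ eventually_mono]) auto
qed

end

section \<open>The weak form for functions of the invariants\<close>

lemma reflect1_nth [simp]:
  "reflect1 \<xi> $ 1 = - (\<xi> $ 1)" "reflect1 \<xi> $ 2 = \<xi> $ 2" "reflect1 \<xi> $ 3 = \<xi> $ 3"
  by (simp_all add: reflect1_def)

lemma norm_le_components: "norm (\<xi>::real^3) \<le> \<bar>\<xi>$1\<bar> + \<bar>\<xi>$2\<bar> + \<bar>\<xi>$3\<bar>"
  using norm_le_l1_cart[of \<xi>] by (simp add: sum_3)

context VP
begin

text \<open>The test function \<open>(k + B(x) \<sigma>(\<xi>\<^sub>1)) p(e) q(\<xi>\<^sub>2) q(\<xi>\<^sub>3)\<close>, with \<open>e\<close> the energy, has a simple transport derivative: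
  \<open>e\<close> is constant along characteristics, and \<open>\<sigma>\<close> is constant wherever \<open>B p(e)\<close> does not vanish (hypothesis
  \<open>turning\<close>), so only \<open>B\<close> gets differentiated. Integrating out \<open>\<xi>\<close> leaves an identity in \<open>x\<close>. Hypothesis
  \<open>wall\<close> is the reflection condition on test functions at \<open>x = 0\<close>.\<close>

lemma weak_flux_identity:
  assumes B: "C1_line B" and C1: "C1_line \<sigma>" "C1_line p" "C1_line q" and \<sigma>: "\<And>y. \<bar>\<sigma> y\<bar> \<le> 1"
    and p: "\<And>e. \<bar>e\<bar> > R \<Longrightarrow> p e = 0" and q: "\<And>y. \<bar>y\<bar> > R \<Longrightarrow> q y = 0"
    and B': "\<And>x. x > X \<Longrightarrow> deriv B x = 0" and X: "X > 0"
    and supp: "\<And>x y. x > X \<Longrightarrow> (k + B x * \<sigma> y) * p (y\<^sup>2 / 2 - \<phi> x) = 0"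
    and turning: "\<And>x y. x > 0 \<Longrightarrow> B x * deriv \<sigma> y * p (y\<^sup>2 / 2 - \<phi> x) = 0"
    and wall: "\<And>y. y > 0 \<Longrightarrow>
      (\<alpha> * (k + B 0 * \<sigma> y) - (k + B 0 * \<sigma> (- y))) * p (y\<^sup>2 / 2 - \<phi>\<^sub>b) = 0"
  shows "integral {0..X} (\<lambda>x. deriv B x * flux \<sigma> p q x)
    + (LINT \<xi>:{\<xi>. \<xi>$1 > 0}|lborel. f\<^sub>b \<xi> *
        (\<xi>$1 * ((k + B 0 * \<sigma> (\<xi>$1)) * p ((\<xi>$1)\<^sup>2 / 2 - \<phi>\<^sub>b) * q (\<xi>$2) * q (\<xi>$3)))) = 0"
proof -
  define \<psi> :: "real \<times> (real^3) \<Rightarrow> real" where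
    "\<psi> z = (k + B (fst z) * \<sigma> (snd z $ 1)) * p ((snd z $ 1)\<^sup>2 / 2 - \<phi> (fst z))
           * q (snd z $ 2) * q (snd z $ 3)" for z
  define L where "L = sqrt (2 * (\<bar>R\<bar> + \<bar>\<phi>\<^sub>b\<bar>)) + 2 * \<bar>R\<bar>"
  define K :: "(real \<times> (real^3)) set" where "K = {0..X} \<times> cball 0 L"
  have compact_K: "compact K" unfolding K_def by (intro compact_Times compact_Icc compact_cball)
  have K_sub: "K \<subseteq> phase_space" unfolding K_def by auto
  have pq_supp: "norm \<xi> \<le> L"
    if x: "x \<ge> 0" and nz: "p ((\<xi>$1)\<^sup>2 / 2 - \<phi> x) * q (\<xi>$2) * q (\<xi>$3) \<noteq> 0" for x and \<xi> :: "real^3"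
  proof -
    have "\<bar>(\<xi>$1)\<^sup>2 / 2 - \<phi> x\<bar> \<le> R" "\<bar>\<xi>$2\<bar> \<le> R" "\<bar>\<xi>$3\<bar> \<le> R"
      using nz p q by (force simp: not_less[symmetric])+
    moreover have "\<bar>\<phi> x\<bar> \<le> \<bar>\<phi>\<^sub>b\<bar>" by (rule phi_bound[OF x])
    ultimately have "(\<xi>$1)\<^sup>2 / 2 \<le> \<bar>R\<bar> + \<bar>\<phi>\<^sub>b\<bar>" "\<bar>\<xi>$2\<bar> \<le> \<bar>R\<bar>" "\<bar>\<xi>$3\<bar> \<le> \<bar>R\<bar>" by linarith+
    moreover from this have "(\<xi>$1)\<^sup>2 \<le> 2 * (\<bar>R\<bar> + \<bar>\<phi>\<^sub>b\<bar>)" by simp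
    then have "\<bar>\<xi>$1\<bar> \<le> sqrt (2 * (\<bar>R\<bar> + \<bar>\<phi>\<^sub>b\<bar>))" using real_le_rsqrt by fastforce
    ultimately show ?thesis unfolding L_def using norm_le_components[of \<xi>] by linarith
  qed
  have C1_\<psi>: "C1_phase \<psi>"
  proof -
    have lin: "bounded_linear (\<lambda>z::real \<times> (real^3). snd z $ i)" for i
      by (rule bounded_linear_compose[OF bounded_linear_vec_nth bounded_linear_snd])
    note coord = C1_phase_linear[OF lin]
    have e: "C1_phase (\<lambda>z. (1 / 2) * (snd z $ 1 * snd z $ 1) + (-1) * \<phi> (fst z))"
      by (intro C1_phase_add C1_phase_mult C1_phase_const coord C1_phase_potential phi_C1)
    have "C1_phase (\<lambda>z. (k + B (fst z) * \<sigma> (snd z $ 1))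
        * p ((1 / 2) * (snd z $ 1 * snd z $ 1) + (-1) * \<phi> (fst z)) * q (snd z $ 2) * q (snd z $ 3))"
      by (intro C1_phase_add C1_phase_mult C1_phase_const C1_phase_compose[OF B]
          C1_phase_compose[OF C1(1)] C1_phase_compose[OF C1(2)] C1_phase_compose[OF C1(3)]
          coord e C1_phase_linear[OF bounded_linear_fst])
    then show ?thesis unfolding \<psi>_def by (simp add: power2_eq_square)
  qed
  have test: "test_function \<alpha> \<psi>"
    unfolding test_function_def
  proof (intro conjI allI impI)
    show "\<exists>D :: real \<times> (real^3) \<Rightarrow> (real \<times> (real^3)) \<Rightarrow>\<^sub>L real.
        (\<forall>z\<in>phase_space. (\<psi> has_derivative blinfun_apply (D z)) (at z within phase_space)) \<and>
        continuous_on phase_space D"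
      using C1_\<psi> unfolding C1_phase_def .
    have "{z \<in> phase_space. \<psi> z \<noteq> 0} \<subseteq> K"
    proof clarsimp
      fix x \<xi> assume x: "0 \<le> x" and nz: "\<psi> (x, \<xi>) \<noteq> 0"
      have "x \<le> X" using nz supp[of x "\<xi>$1"] by (force simp: \<psi>_def)
      moreover have "norm \<xi> \<le> L" by (rule pq_supp[OF x]) (use nz in \<open>auto simp: \<psi>_def\<close>)
      ultimately show "(x, \<xi>) \<in> K" using x by (simp add: K_def)
    qed
    then show "compact (closure {z \<in> phase_space. \<psi> z \<noteq> 0})"
      by (meson bounded_subset compact_K compact_closure compact_imp_bounded)
    show "\<alpha> * \<psi> (0, \<xi>) = \<psi> (0, reflect1 \<xi>)" if "\<xi>$1 > 0" for \<xi> :: "real^3"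
    proof -
      have "\<alpha> * \<psi> (0, \<xi>) - \<psi> (0, reflect1 \<xi>) =
        (\<alpha> * (k + B 0 * \<sigma> (\<xi>$1)) - (k + B 0 * \<sigma> (- (\<xi>$1)))) * p ((\<xi>$1)\<^sup>2 / 2 - \<phi>\<^sub>b) * q (\<xi>$2) * q (\<xi>$3)"
        by (simp add: \<psi>_def phi_0 algebra_simps)
      then show ?thesis using wall[OF that] by simp
    qed
  qed
  have transport: "\<xi>$1 * dir_deriv (1, 0) \<psi> (x, \<xi>) + deriv \<phi> x * dir_deriv (0, axis 1 1) \<psi> (x, \<xi>)
      = deriv B x * flux_weight \<sigma> p q (\<phi> x) \<xi>" if x: "x > 0" for x and \<xi> :: "real^3"
  proof -
    define y where "y = \<xi>$1"
    define c where "c = q (\<xi>$2) * q (\<xi>$3)"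
    define p' where "p' = deriv p (y\<^sup>2 / 2 - \<phi> x)"
    have phi': "(\<phi> has_real_derivative deriv \<phi> x) (at x)"
      using C1_on_DERIV[OF phi_C1 x] by simp
    have shift: "((\<lambda>s. h (c + s)) has_real_derivative d) (at 0)"
      if "(h has_real_derivative d) (at c)" for h :: "real \<Rightarrow> real" and c d
      using DERIV_shift[of h d 0 c] that by (simp add: add.commute)
    have Bs: "((\<lambda>s. B (x + s)) has_real_derivative deriv B x) (at 0)"
      by (rule shift[OF C1_line_deriv(1)[OF B]])
    have phis: "((\<lambda>s. \<phi> (x + s)) has_real_derivative deriv \<phi> x) (at 0)"
      by (rule shift[OF phi'])
    have "((\<lambda>s. p (y\<^sup>2 / 2 - \<phi> (x + s))) has_real_derivative p' * (0 - deriv \<phi> x)) (at 0)"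
      unfolding p'_def
      by (rule DERIV_chain2[where g = "\<lambda>s. y\<^sup>2 / 2 - \<phi> (x + s)" and f = p, OF _ DERIV_diff[OF DERIV_const phis]])
         (simp add: C1_line_deriv(1)[OF C1(2)])
    note px = this
    have sig: "((\<lambda>s. \<sigma> (y + s)) has_real_derivative deriv \<sigma> y) (at 0)"
      by (rule shift[OF C1_line_deriv(1)[OF C1(1)]])
    have ys: "((\<lambda>s. (y + s)\<^sup>2 / 2 - \<phi> x) has_real_derivative y) (at 0)"
      by (auto intro!: derivative_eq_intros)
    have py: "((\<lambda>s. p ((y + s)\<^sup>2 / 2 - \<phi> x)) has_real_derivative p' * y) (at 0)"
      unfolding p'_def
      by (rule DERIV_chain2[where g = "\<lambda>s. (y + s)\<^sup>2 / 2 - \<phi> x" and f = p, OF _ ys])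
         (simp add: C1_line_deriv(1)[OF C1(2)])
    have d1: "dir_deriv (1, 0) \<psi> (x, \<xi>) =
        (deriv B x * \<sigma> y * p (y\<^sup>2 / 2 - \<phi> x) - (k + B x * \<sigma> y) * p' * deriv \<phi> x) * c"
    proof -
      have "((\<lambda>s. (k + B (x + s) * \<sigma> y) * p (y\<^sup>2 / 2 - \<phi> (x + s)) * c) has_real_derivative
        (deriv B x * \<sigma> y * p (y\<^sup>2 / 2 - \<phi> x) - (k + B x * \<sigma> y) * p' * deriv \<phi> x) * c) (at 0)"
        by (rule derivative_eq_intros Bs px refl | simp add: algebra_simps)+
      then show ?thesis
        unfolding dir_deriv_def by (intro DERIV_imp_deriv) (simp add: \<psi>_def y_def c_def mult.assoc)
    qed
    have d2: "dir_deriv (0, axis 1 1) \<psi> (x, \<xi>) =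
        (B x * deriv \<sigma> y * p (y\<^sup>2 / 2 - \<phi> x) + (k + B x * \<sigma> y) * p' * y) * c"
    proof -
      have "((\<lambda>s. (k + B x * \<sigma> (y + s)) * p ((y + s)\<^sup>2 / 2 - \<phi> x) * c) has_real_derivative
        (B x * deriv \<sigma> y * p (y\<^sup>2 / 2 - \<phi> x) + (k + B x * \<sigma> y) * p' * y) * c) (at 0)"
        by (rule derivative_eq_intros sig py refl | simp add: algebra_simps)+
      then show ?thesis
        unfolding dir_deriv_def
        by (intro DERIV_imp_deriv) (simp add: \<psi>_def y_def c_def mult.assoc axis_def)
    qed
    show ?thesis unfolding d1 d2 turning[OF x, of y]
      by (simp add: flux_weight_def y_def[symmetric] c_def algebra_simps)
  qed
  define G where "G z = deriv B (fst z) * flux_weight \<sigma> p q (\<phi> (fst z)) (snd z)" for z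
  have cont_G: "continuous_on phase_space G"
  proof -
    have ph: "continuous_on phase_space (\<lambda>z::real \<times> (real^3). \<phi> (fst z))"
      by (rule C1_phase_continuous[OF C1_phase_potential[OF phi_C1]])
    show ?thesis unfolding G_def
      by (intro continuous_on_mult C1_line_deriv_continuous[OF B] flux_weight_continuous[OF C1]
          ph continuous_intros)
  qed
  define F where "F z = indicator ({0<..} \<times> UNIV) z * (f (fst z) (snd z) * G z)" for z
  define FK where "FK z = indicator K z *\<^sub>R f (fst z) (snd z)" for z
  have FK_int: "integrable lborel FK"
    using f_locally_integrable[OF compact_K K_sub] unfolding set_integrable_def FK_def
    by (simp add: case_prod_beta)
  \<comment> \<open>\<open>f\<close> is integrable on compact sets only, so the integrand is first seen to live on \<open>K\<close>.\<close>
  have G_out: "G (x, \<xi>) = 0" if "x > 0" "(x, \<xi>) \<notin> K" for x \<xi>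
  proof (cases "x > X")
    case True
    then show ?thesis using B' by (simp add: G_def)
  next
    case False
    then have "\<not> norm \<xi> \<le> L" using that by (simp add: K_def)
    then show ?thesis using pq_supp[of x \<xi>] that by (auto simp: G_def flux_weight_def)
  qed
  have F_eq: "F z = FK z * (indicator ({0<..} \<times> UNIV) z * (indicator phase_space z *\<^sub>R G z))" for z
    using G_out[of "fst z" "snd z"] K_sub
    by (cases z) (auto simp: F_def FK_def indicator_def)
  have F_int: "integrable lborel F"
  proof -
    have "compact (G ` K)" by (intro compact_continuous_image continuous_on_subset[OF cont_G K_sub] compact_K)
    then obtain C where C: "\<And>z. z \<in> K \<Longrightarrow> \<bar>G z\<bar> \<le> C"
      by (metis bounded_iff compact_imp_bounded image_eqI real_norm_def)
    have FKm[measurable]: "FK \<in> borel_measurable borel"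
      using FK_int by (auto dest: borel_measurable_integrable)
    have ps: "phase_space \<in> sets (borel :: (real \<times> (real^3)) measure)"
      by (intro borel_closed closed_Times) auto
    have ops: "{0<..} \<times> UNIV \<in> sets (borel :: (real \<times> (real^3)) measure)"
      by (intro borel_open open_Times) auto
    have [measurable]: "(\<lambda>z. indicator phase_space z *\<^sub>R G z) \<in> borel_measurable borel"
      by (rule borel_measurable_continuous_on_indicator[OF ps cont_G])
    have "F \<in> borel_measurable borel"
      unfolding F_eq[abs_def] using ops by measurable
    moreover have "\<bar>F z\<bar> \<le> \<bar>\<bar>C\<bar> * FK z\<bar>" for z
    proof (cases "z \<in> K")
      case True
      then have "\<bar>G z\<bar> \<le> \<bar>C\<bar>" using C[of z] by linarith
      then have "\<bar>FK z\<bar> * \<bar>indicator ({0<..} \<times> UNIV) z * (indicator phase_space z *\<^sub>R G z)\<bar> \<le> \<bar>FK z\<bar> * \<bar>C\<bar>"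
        by (intro mult_left_mono) (auto simp: indicator_def)
      then show ?thesis unfolding F_eq by (simp add: abs_mult mult.commute)
    qed (simp add: F_eq FK_def)
    ultimately show ?thesis
      by (intro Bochner_Integration.integrable_bound[OF integrable_mult_right[OF FK_int, of "\<bar>C\<bar>"]]) auto
  qed
  have bulk: "(LINT (x, \<xi>):{0<..} \<times> UNIV|lborel.
            f x \<xi> * (\<xi>$1 * dir_deriv (1, 0) \<psi> (x, \<xi>)
                     + deriv \<phi> x * dir_deriv (0, axis 1 1) \<psi> (x, \<xi>)))
      = integral {0..X} (\<lambda>x. deriv B x * flux \<sigma> p q x)"
  proof -
    have "(LINT (x, \<xi>):{0<..} \<times> UNIV|lborel.
            f x \<xi> * (\<xi>$1 * dir_deriv (1, 0) \<psi> (x, \<xi>)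
                     + deriv \<phi> x * dir_deriv (0, axis 1 1) \<psi> (x, \<xi>))) = integral\<^sup>L lborel F"
      unfolding set_lebesgue_integral_def
      by (intro Bochner_Integration.integral_cong refl)
         (auto simp: F_def G_def indicator_def transport)
    also have "\<dots> = integral\<^sup>L (lborel \<Otimes>\<^sub>M lborel) F" by (simp add: lborel_prod)
    also have "\<dots> = (LINT x|lborel. LINT \<xi>|lborel. F (x, \<xi>))"
      by (rule lborel_pair.integral_fst'[symmetric]) (simp add: lborel_prod F_int)
    also have "\<dots> = (LINT x|lborel. indicator {0<..} x * (deriv B x * flux \<sigma> p q x))"
    proof (intro Bochner_Integration.integral_cong refl)
      fix x :: real
      have "(LINT \<xi>|lborel. F (x, \<xi>)) =
        (LINT \<xi>|lborel. (indicator {0<..} x * deriv B x) * (f x \<xi> * flux_weight \<sigma> p q (\<phi> x) \<xi>))"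
        by (intro Bochner_Integration.integral_cong refl) (simp add: F_def G_def indicator_def)
      then show "(LINT \<xi>|lborel. F (x, \<xi>)) = indicator {0<..} x * (deriv B x * flux \<sigma> p q x)"
        by (simp add: flux_def)
    qed
    also have "\<dots> = (LINT x:{0..X}|lborel. deriv B x * flux \<sigma> p q x)"
    proof -
      have half_open: "indicator {0<..} x * (deriv B x * flux \<sigma> p q x) =
          indicator {0<..X} x *\<^sub>R (deriv B x * flux \<sigma> p q x)" for x
        using B'[of x] by (auto simp: indicator_def)
      have "(LINT x:{0<..X}|lborel. deriv B x * flux \<sigma> p q x) = (LINT x:{0..X}|lborel. deriv B x * flux \<sigma> p q x)"
        unfolding set_lebesgue_integral_def
      proof (rule integral_cong_AE)
        have m: "(\<lambda>x. indicator {0..X} x *\<^sub>R (deriv B x * flux \<sigma> p q x)) \<in> borel_measurable borel"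
          by (intro borel_measurable_continuous_on_indicator continuous_on_mult
              C1_line_deriv_continuous[OF B continuous_on_id]
              continuous_on_subset[OF flux_continuous[OF C1 \<sigma> p q]]) auto
        then show "(\<lambda>x. indicator {0..X} x *\<^sub>R (deriv B x * flux \<sigma> p q x)) \<in> borel_measurable lborel"
          by simp
        have "(\<lambda>x. indicator {0<..X} x *\<^sub>R (deriv B x * flux \<sigma> p q x)) =
            (\<lambda>x. indicator {0<..} x * (indicator {0..X} x *\<^sub>R (deriv B x * flux \<sigma> p q x)))"
          by (intro ext) (simp split: split_indicator)
        then show "(\<lambda>x. indicator {0<..X} x *\<^sub>R (deriv B x * flux \<sigma> p q x)) \<in> borel_measurable lborel"
          using m by simp
        show "AE x in lborel. indicator {0<..X} x *\<^sub>R (deriv B x * flux \<sigma> p q x) =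
            indicator {0..X} x *\<^sub>R (deriv B x * flux \<sigma> p q x)"
          using AE_lborel_singleton[of "0::real"] by eventually_elim (auto simp: indicator_def)
      qed
      then show ?thesis unfolding half_open set_lebesgue_integral_def .
    qed
    also have "\<dots> = integral {0..X} (\<lambda>x. deriv B x * flux \<sigma> p q x)"
    proof (rule set_borel_integral_eq_integral(2)[OF borel_integrable_atLeastAtMost'])
      show "continuous_on {0..X} (\<lambda>x. deriv B x * flux \<sigma> p q x)"
        by (intro continuous_on_mult C1_line_deriv_continuous[OF B continuous_on_id]
            continuous_on_subset[OF flux_continuous[OF C1 \<sigma> p q]]) auto
    qed
    finally show ?thesis .
  qed
  show ?thesis using weak_form[OF test] unfolding bulk by (simp add: \<psi>_def phi_0)
qed

end

section \<open>Conservation of fluxes\<close>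

text \<open>A du Bois-Reymond lemma. The test function is built from \<open>M\<close> itself: with \<open>w\<close> a parabolic arch on \<open>{x0..X}\<close> and \<open>c\<close> the
  \<open>w\<close>-weighted mean of \<open>M\<close>, the primitive \<open>B\<close> of \<open>(M - c) w\<close> vanishes at both ends of the interval, and
  orthogonality turns into \<open>\<integral>(M - c)\<^sup>2 w = 0\<close>.\<close>

lemma orthogonal_to_derivatives_imp_constant:
  fixes M :: "real \<Rightarrow> real"
  assumes M: "continuous_on {0..} M" and x0: "0 \<le> x0"
    and orth: "\<And>B X. C1_line B \<Longrightarrow> (\<And>x. x \<le> x0 \<Longrightarrow> B x = 0) \<Longrightarrow> (\<And>x. X \<le> x \<Longrightarrow> B x = 0) \<Longrightarrow>
      (\<And>x. X < x \<Longrightarrow> deriv B x = 0) \<Longrightarrow> x0 < X \<Longrightarrow> integral {0..X} (\<lambda>x. deriv B x * M x) = 0"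
    and xy: "x0 < x" "x0 < y"
  shows "M x = M y"
proof -
  define X where "X = max x y + 1"
  have X: "x0 < X" "x < X" "y < X" "0 < X" using xy x0 unfolding X_def by auto
  define w where "w t = max 0 ((t - x0) * (X - t))" for t
  have w_cont: "continuous_on A w" for A unfolding w_def by (intro continuous_intros)
  have w_nonneg: "0 \<le> w t" for t by (simp add: w_def)
  have w_pos: "0 < w t" if "x0 < t" "t < X" for t using that by (simp add: w_def)
  have w_out: "w t = 0" if "t \<le> x0 \<or> X \<le> t" for t
    using that X by (auto simp: w_def mult_nonneg_nonpos mult_nonpos_nonneg)
  \<comment> \<open>\<open>M\<close> is continuous on the half-line only; \<open>max 0\<close> extends it to a function with a global primitive.\<close>
  have M_cont: "continuous_on A (\<lambda>t. M (max 0 t))" for A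
    by (rule continuous_on_compose2[OF M]) (auto intro!: continuous_intros)
  have "integral {0..X} w \<noteq> 0"
  proof
    assume "integral {0..X} w = 0"
    then have "\<forall>t\<in>{0..X}. w t = 0"
      using integral_eq_0_iff[OF w_cont X(4)] w_nonneg by blast
    moreover have "x \<in> {0..X}" using xy(1) x0 X(2) by simp
    ultimately show False using w_pos[OF xy(1) X(2)] by fastforce
  qed
  define c where "c = integral {0..X} (\<lambda>t. M (max 0 t) * w t) / integral {0..X} w"
  define h where "h t = (M (max 0 t) - c) * w t" for t
  have h_cont: "continuous_on A h" for A
    unfolding h_def by (intro continuous_intros M_cont w_cont)
  have h_out: "h t = 0" if "t \<le> x0 \<or> X \<le> t" for t using w_out[OF that] by (simp add: h_def)
  have int_h: "integral {0..X} h = 0"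
  proof -
    have "integral {0..X} h = integral {0..X} (\<lambda>t. M (max 0 t) * w t) - integral {0..X} (\<lambda>t. c * w t)"
      unfolding h_def left_diff_distrib
      by (intro Henstock_Kurzweil_Integration.integral_diff integrable_continuous_real continuous_intros M_cont w_cont)
    then show ?thesis using \<open>integral {0..X} w \<noteq> 0\<close> by (simp add: c_def)
  qed
  obtain F where F: "\<And>t. (F has_real_derivative h t) (at t)"
  proof -
    have "isCont h t" for t using h_cont[of UNIV] by (simp add: continuous_on_eq_continuous_at)
    then have "\<exists>F. \<forall>t. -\<infinity> < ereal t \<longrightarrow> ereal t < \<infinity> \<longrightarrow> (F has_vector_derivative h t) (at t)"
      by (intro einterval_antiderivative) auto
    then show ?thesis using that by (auto simp: has_real_derivative_iff_has_vector_derivative)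
  qed
  define B where "B t = F t - F 0" for t
  have B_deriv: "(B has_real_derivative h t) (at t)" for t
    using DERIV_diff[OF F[of t] DERIV_const[of "F 0"]] by (simp add: B_def[abs_def])
  have dB: "deriv B t = h t" for t by (rule DERIV_imp_deriv[OF B_deriv])
  have B_int: "B t = integral {0..t} h" if "0 \<le> t" for t
  proof -
    have "(h has_integral (B t - B 0)) {0..t}"
    proof (rule fundamental_theorem_of_calculus[OF that])
      show "(B has_vector_derivative h s) (at s within {0..t})" if "s \<in> {0..t}" for s
        using has_field_derivative_at_within[OF B_deriv[of s]]
        unfolding has_real_derivative_iff_has_vector_derivative .
    qed
    from integral_unique[OF this] show ?thesis by (simp add: B_def)
  qed
  have B_C1: "C1_line B" by (rule C1_lineI[OF B_deriv h_cont])
  have B_left: "B t = 0" if "t \<le> x0" for t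
  proof -
    have "B t = B x0"
    proof (cases "t = x0")
      case False
      have "B x0 = B t"
      proof (rule DERIV_isconst_end[of t x0 B])
        show "t < x0" using False that by simp
        show "continuous_on {t..x0} B"
          by (rule continuous_at_imp_continuous_on) (use DERIV_isCont[OF B_deriv] in blast)
        show "(B has_real_derivative 0) (at x)" if "t < x" "x < x0" for x
          using B_deriv[of x] h_out[of x] that by simp
      qed
      then show ?thesis by simp
    qed simp
    moreover have "B x0 = 0"
      using B_int[OF x0] h_out by (metis (no_types, lifting) atLeastAtMost_iff integral_0 integral_cong)
    ultimately show ?thesis by simp
  qed
  have B_right: "B t = 0" if "X \<le> t" for t
  proof -
    have "integral {0..t} h = integral {0..X} h + integral {X..t} h"
      using that X by (intro Henstock_Kurzweil_Integration.integral_combine[symmetric] integrable_continuous_real h_cont) auto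
    moreover have "integral {X..t} h = 0" using h_out by (metis (no_types, lifting) atLeastAtMost_iff integral_0 integral_cong)
    ultimately show ?thesis using B_int[of t] int_h that X by simp
  qed
  have "integral {0..X} (\<lambda>t. deriv B t * M t) = 0"
    by (rule orth[OF B_C1 B_left B_right _ X(1)]) (simp_all add: dB h_out)
  moreover have "integral {0..X} (\<lambda>t. deriv B t * M t) = integral {0..X} (\<lambda>t. (M (max 0 t) - c)\<^sup>2 * w t + c * h t)"
    by (rule integral_cong) (simp add: dB h_def power2_eq_square algebra_simps)
  moreover have "\<dots> = integral {0..X} (\<lambda>t. (M (max 0 t) - c)\<^sup>2 * w t) + integral {0..X} (\<lambda>t. c * h t)"
    by (intro Henstock_Kurzweil_Integration.integral_add integrable_continuous_real continuous_intros M_cont w_cont h_cont)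
  ultimately have "integral {0..X} (\<lambda>t. (M (max 0 t) - c)\<^sup>2 * w t) = 0" by (simp add: int_h)
  moreover have "continuous_on {0..X} (\<lambda>t. (M (max 0 t) - c)\<^sup>2 * w t)"
    by (intro continuous_intros M_cont w_cont)
  ultimately have zero: "\<forall>t\<in>{0..X}. (M (max 0 t) - c)\<^sup>2 * w t = 0"
    using integral_eq_0_iff[of 0 X "\<lambda>t. (M (max 0 t) - c)\<^sup>2 * w t"] X(4) w_nonneg by simp
  have "M t = c" if "x0 < t" "t < X" for t
    using zero[rule_format, of t] w_pos[OF that] that x0 by simp
  then show ?thesis using xy X by simp
qed

context VP
begin

lemma flux_integrable:
  assumes C1: "C1_line \<sigma>" "C1_line p" "C1_line q" and \<sigma>: "\<And>y. \<bar>\<sigma> y\<bar> \<le> 1"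
    and p: "\<And>e. \<bar>e\<bar> > R \<Longrightarrow> p e = 0" and q: "\<And>y. \<bar>y\<bar> > R \<Longrightarrow> q y = 0" and x: "x \<ge> 0"
  shows "integrable lborel (\<lambda>\<xi>. f x \<xi> * flux_weight \<sigma> p q (\<phi> x) \<xi>)"
proof -
  obtain C where C: "\<And>t \<xi>. \<bar>t\<bar> \<le> \<bar>\<phi>\<^sub>b\<bar> \<Longrightarrow> \<bar>flux_weight \<sigma> p q t \<xi>\<bar> \<le> C"
    using flux_weight_bounded[where \<sigma>=\<sigma> and T="\<bar>\<phi>\<^sub>b\<bar>", OF C1(2,3) \<sigma> p q] by blast
  have [measurable]: "f x \<in> borel_measurable borel" "flux_weight \<sigma> p q (\<phi> x) \<in> borel_measurable borel"
    using f_integrable[OF x] flux_weight_measurable[OF C1] by (auto dest: borel_measurable_integrable)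
  show ?thesis
  proof (rule Bochner_Integration.integrable_bound[OF integrable_mult_right[OF f_integrable[OF x], of C]])
    show "AE \<xi> in lborel. norm (f x \<xi> * flux_weight \<sigma> p q (\<phi> x) \<xi>) \<le> norm (C * f x \<xi>)"
    proof (rule AE_I2)
      fix \<xi>
      have "\<bar>flux_weight \<sigma> p q (\<phi> x) \<xi>\<bar> \<le> \<bar>C\<bar>" using C[OF phi_bound[OF x], of \<xi>] by linarith
      then show "norm (f x \<xi> * flux_weight \<sigma> p q (\<phi> x) \<xi>) \<le> norm (C * f x \<xi>)"
        by (simp add: abs_mult mult.commute[of "\<bar>C\<bar>"] mult_left_mono)
    qed
  qed simp
qed

text \<open>With \<open>k = 0\<close> and \<open>B\<close> supported to the right of \<open>x0\<close> the wall is not seen, and the identity says that the flux is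
  orthogonal to all derivatives, hence constant. The constant is read off at infinity, where \<open>\<phi>\<close> vanishes.\<close>

lemma flux_conserved:
  assumes C1: "C1_line \<sigma>" "C1_line p" "C1_line q" and \<sigma>: "\<And>y. \<bar>\<sigma> y\<bar> \<le> 1"
    and p: "\<And>e. \<bar>e\<bar> > R \<Longrightarrow> p e = 0" and q: "\<And>y. \<bar>y\<bar> > R \<Longrightarrow> q y = 0"
    and g: "integrable lborel f_inf" and x0: "0 \<le> x0"
    and turning: "\<And>x y. x > x0 \<Longrightarrow> deriv \<sigma> y * p (y\<^sup>2 / 2 - \<phi> x) = 0"
  shows "flux \<sigma> p q x0 = (LINT \<xi>|lborel. f_inf \<xi> * flux_weight \<sigma> p q 0 \<xi>)"
proof -
  let ?M = "flux \<sigma> p q" and ?L = "LINT \<xi>|lborel. f_inf \<xi> * flux_weight \<sigma> p q 0 \<xi>"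
  have cont: "continuous_on {0..} ?M" by (rule flux_continuous[OF C1 \<sigma> p q])
  have const: "?M x = ?M y" if "x0 < x" "x0 < y" for x y
  proof (rule orthogonal_to_derivatives_imp_constant[OF cont x0 _ that])
    fix B X assume B: "C1_line B" and left: "\<And>x. x \<le> x0 \<Longrightarrow> B x = 0"
      and right: "\<And>x. X \<le> x \<Longrightarrow> B x = 0" and dB: "\<And>x. X < x \<Longrightarrow> deriv B x = 0" and X: "x0 < X"
    have t: "B x * deriv \<sigma> y * p (y\<^sup>2 / 2 - \<phi> x) = 0" for x y
      using left[of x] turning[of x y] by (cases "x \<le> x0") (auto simp: mult.assoc)
    show "integral {0..X} (\<lambda>x. deriv B x * ?M x) = 0"
    proof -
      have B0: "B 0 = 0" using left x0 by simp
      have "integral {0..X} (\<lambda>x. deriv B x * ?M x) + (LINT \<xi>:{\<xi>. \<xi>$1 > 0}|lborel. f\<^sub>b \<xi> *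
          (\<xi>$1 * ((0 + B 0 * \<sigma> (\<xi>$1)) * p ((\<xi>$1)\<^sup>2 / 2 - \<phi>\<^sub>b) * q (\<xi>$2) * q (\<xi>$3)))) = 0"
      proof (rule weak_flux_identity[OF B C1 \<sigma> p q dB _ _ t])
        show "0 < X" using X x0 by simp
        show "(0 + B x * \<sigma> y) * p (y\<^sup>2 / 2 - \<phi> x) = 0" if "X < x" for x y
          using right[of x] that by simp
        show "(\<alpha> * (0 + B 0 * \<sigma> y) - (0 + B 0 * \<sigma> (- y))) * p (y\<^sup>2 / 2 - \<phi>\<^sub>b) = 0" for y
          by (simp add: B0)
      qed
      then show ?thesis by (simp add: B0 set_lebesgue_integral_def)
    qed
  qed
  have L: "?M x = ?L" if "x0 < x" for x
  proof -
    have "\<forall>\<^sub>F y in at_top. ?M y = ?M x"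
      using const[OF that] by (intro eventually_mono[OF eventually_gt_at_top[of x0]]) auto
    then have "(?M \<longlongrightarrow> ?M x) at_top" by (rule tendsto_eventually)
    from tendsto_unique[OF _ this flux_limit[OF C1 \<sigma> p q g]] show ?thesis by simp
  qed
  have "(?M \<longlongrightarrow> ?M x0) (at_right x0)"
    by (rule tendsto_within_subset[where S = "{0..}"]) (use cont x0 in \<open>auto simp: continuous_on_def\<close>)
  moreover have "(?M \<longlongrightarrow> ?L) (at_right x0)"
    by (rule tendsto_eventually) (auto simp: eventually_at_filter L)
  ultimately show ?thesis by (rule tendsto_unique[OF trivial_limit_at_right_real])
qed

end

section \<open>Absence of trapped particles\<close>

context VP
begin

text \<open>At energies between \<open>- \<phi> x0\<close> and \<open>0\<close> particles travel between the wall and a turning point. Nothing is injected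
  at these energies, and each reflection at the wall keeps only the fraction \<open>\<alpha> < 1\<close>, so that nothing can survive.
  A single test function expresses this. At the wall its values for particles that leave and that arrive are \<open>1\<close>
  and \<open>\<alpha>\<close>, as the reflection condition requires; towards the turning point both move monotonically to
  \<open>(1 + \<alpha>) / 2\<close>. The transport derivative then has one sign, and the weak form forces the nonnegative flux to vanish.\<close>

lemma no_trapped_particles:
  assumes \<alpha>: "0 \<le> \<alpha>" "\<alpha> < 1" and x0: "x0 > 0" and pos: "\<phi> x0 > 0"
    and fb: "\<And>\<xi>. \<xi>$1 > 0 \<Longrightarrow> (\<xi>$1)\<^sup>2 \<le> 2 * \<phi>\<^sub>b \<Longrightarrow> f\<^sub>b \<xi> = 0"
  shows "AE \<xi> in lborel. \<xi>$1 \<noteq> 0 \<and> (\<xi>$1)\<^sup>2 / 2 < \<phi> x0 \<longrightarrow> f x0 \<xi> = 0"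
proof -
  have anti: "strict_antimono_on {0..} \<phi>"
    using phi_monotone pos x0 by (auto simp: not_le[symmetric])
  have dec: "\<phi> y < \<phi> x" if "0 \<le> x" "x < y" for x y
    using monotone_onD[OF anti, of x y] that by simp
  define \<kappa> where "\<kappa> n = 1 / real (Suc n)" for n
  have \<kappa>: "0 < \<kappa> n" for n by (simp add: \<kappa>_def)
  define p where "p n e = smooth_step ((e + \<phi> x0) / \<kappa> n - 1) * smooth_step (- e / \<kappa> n - 1)" for n e
  have p_C1: "C1_line (p n)" for n
  proof -
    have "C1_line (\<lambda>e. smooth_step ((1 / \<kappa> n) * e + (\<phi> x0 / \<kappa> n - 1)) * smooth_step ((- 1 / \<kappa> n) * e + (- 1)))"
      by (intro C1_line_mult C1_line_compose[OF C1_smooth_step] C1_line_scale)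
    moreover have "p n = (\<lambda>e. smooth_step ((1 / \<kappa> n) * e + (\<phi> x0 / \<kappa> n - 1)) * smooth_step ((- 1 / \<kappa> n) * e + (- 1)))"
      by (intro ext) (simp add: p_def add_divide_distrib add_diff_eq)
    ultimately show ?thesis by simp
  qed
  have p_left: "p n e = 0" if "e \<le> - \<phi> x0 + \<kappa> n" for n e
    using that \<kappa>[of n] by (simp add: p_def smooth_step_eq_0 field_simps)
  have p_right: "p n e = 0" if "- \<kappa> n \<le> e" for n e
  proof -
    have "- e / \<kappa> n - 1 \<le> 0" using that \<kappa>[of n] by (simp add: field_simps)
    then show ?thesis by (simp add: p_def smooth_step_eq_0)
  qed
  have p_pos: "0 < p n e" if "- \<phi> x0 + \<kappa> n < e" "e < - \<kappa> n" for n e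
  proof -
    have "0 < (e + \<phi> x0) / \<kappa> n - 1" "0 < - e / \<kappa> n - 1" using that \<kappa>[of n] by (simp_all add: field_simps)
    then show ?thesis by (simp add: p_def smooth_step_pos)
  qed
  have p_nonneg: "0 \<le> p n e" for n e by (simp add: p_def smooth_step_nonneg)
  define \<delta> where "\<delta> n = sqrt (\<kappa> n)" for n
  have \<delta>: "0 < \<delta> n" "(\<delta> n)\<^sup>2 = \<kappa> n" for n using \<kappa>[of n] by (simp_all add: \<delta>_def)
  have small: "y\<^sup>2 < \<kappa> n" if "\<bar>y\<bar> < \<delta> n" for y n
    using that \<delta>[of n] by (metis abs_ge_zero power2_abs power_strict_mono zero_less_numeral)
  have zero: "AE \<xi> in lborel. f x0 \<xi> * flux_weight (smooth_sign (\<delta> n)) (p n) (plateau n) (\<phi> x0) \<xi> = 0" for n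
  proof -
    let ?\<sigma> = "smooth_sign (\<delta> n)"
    define R where "R = \<phi> x0 + real n + 1"
    note C1 = C1_smooth_sign[of "\<delta> n"] p_C1[of n] C1_plateau[of n]
    have pR: "p n e = 0" if "\<bar>e\<bar> > R" for e
      using p_left[of e n] p_right[of n e] that pos \<kappa>[of n] by (auto simp: R_def abs_if split: if_splits)
    have qR: "plateau n y = 0" if "\<bar>y\<bar> > R" for y
      using that pos by (intro plateau_eq_0) (simp add: R_def)
    \<comment> \<open>The energy cutoff leaves a margin \<open>\<kappa> n\<close> above \<open>- \<phi> x0\<close>. Half of it pays for the drop of \<open>\<phi>\<close>
      between \<open>x0\<close> and \<open>x1\<close>, the other half for the kinetic energy below which the sign is regularised.\<close>
    obtain x1 where x1: "x0 < x1" "\<phi> x0 - \<kappa> n / 2 < \<phi> x1"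
    proof -
      have "(\<phi> \<longlongrightarrow> \<phi> x0) (at_right x0)"
        by (rule tendsto_within_subset[where S = "{0..}"])
           (use phi_continuous x0 in \<open>auto simp: continuous_on_def\<close>)
      then have "\<forall>\<^sub>F x in at_right x0. \<phi> x0 - \<kappa> n / 2 < \<phi> x"
        using \<kappa>[of n] by (intro order_tendstoD) auto
      moreover have "\<forall>\<^sub>F x in at_right x0. x0 < x" by (simp add: eventually_at_filter)
      ultimately have "\<forall>\<^sub>F x in at_right x0. x0 < x \<and> \<phi> x0 - \<kappa> n / 2 < \<phi> x" by eventually_elim simp
      from eventually_happens[OF this] show ?thesis using that by auto
    qed
    obtain X where X: "x1 < X" "\<And>x. x > X \<Longrightarrow> \<phi> x < \<kappa> n"
    proof -
      have "\<forall>\<^sub>F x in at_top. \<phi> x < \<kappa> n" using phi_limit \<kappa>[of n] by (intro order_tendstoD) auto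
      then obtain X0 where "\<And>x. x \<ge> X0 \<Longrightarrow> \<phi> x < \<kappa> n" unfolding eventually_at_top_linorder by blast
      then show ?thesis using that[of "max X0 x1 + 1"] by auto
    qed
    define k where "k = (1 + \<alpha>) / 2"
    define B where "B x = (1 - \<alpha>) / 2 * pos_square (1 - x / x1)" for x
    have B_deriv: "(B has_real_derivative (1 - \<alpha>) / 2 * (2 * max 0 (1 - x / x1) * (- (1 / x1)))) (at x)" for x
    proof -
      have "((\<lambda>x. 1 - x / x1) has_real_derivative - (1 / x1)) (at x)"
        using x0 x1 by (auto intro!: derivative_eq_intros)
      from DERIV_cmult[OF DERIV_chain2[OF pos_square_has_derivative this]]
      show ?thesis unfolding B_def .
    qed
    have dB: "deriv B x = - ((1 - \<alpha>) * max 0 (1 - x / x1) / x1)" for x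
      using DERIV_imp_deriv[OF B_deriv, of x] by simp
    have B_C1: "C1_line B"
      by (rule C1_lineI[OF B_deriv]) (use x0 x1 in \<open>auto intro!: continuous_intros\<close>)
    have B_right: "B x = 0" if "x \<ge> x1" for x
      using that x0 x1 by (simp add: B_def pos_square_def)
    have turning: "B x * deriv ?\<sigma> y * p n (y\<^sup>2 / 2 - \<phi> x) = 0" if x: "x > 0" for x y
    proof (cases "x \<ge> x1 \<or> \<delta> n \<le> \<bar>y\<bar>")
      case True
      then show ?thesis using B_right deriv_smooth_sign_eq_0[OF \<delta>(1)] by auto
    next
      case False
      then have "\<phi> x > \<phi> x1" "y\<^sup>2 < \<kappa> n" using dec[of x x1] x small by auto
      then have "p n (y\<^sup>2 / 2 - \<phi> x) = 0" using x1 by (intro p_left) linarith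
      then show ?thesis by simp
    qed
    have wall: "(\<alpha> * (k + B 0 * ?\<sigma> y) - (k + B 0 * ?\<sigma> (- y))) * p n (y\<^sup>2 / 2 - \<phi>\<^sub>b) = 0" if y: "y > 0" for y
    proof (cases "\<delta> n \<le> y")
      case True
      then have "?\<sigma> y = 1" "?\<sigma> (- y) = - 1" using smooth_sign_eq_1[OF \<delta>(1)] smooth_sign_minus by auto
      then show ?thesis by (simp add: k_def B_def pos_square_def field_simps)
    next
      case False
      then have "y\<^sup>2 < \<kappa> n" using y small[of y n] by simp
      then have "p n (y\<^sup>2 / 2 - \<phi>\<^sub>b) = 0" using dec[of 0 x0] x0 phi_0 \<kappa>[of n] by (intro p_left) linarith
      then show ?thesis by simp
    qed
    have "integral {0..X} (\<lambda>x. deriv B x * flux ?\<sigma> (p n) (plateau n) x)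
      + (LINT \<xi>:{\<xi>. \<xi>$1 > 0}|lborel. f\<^sub>b \<xi> * (\<xi>$1 * ((k + B 0 * ?\<sigma> (\<xi>$1))
            * p n ((\<xi>$1)\<^sup>2 / 2 - \<phi>\<^sub>b) * plateau n (\<xi>$2) * plateau n (\<xi>$3)))) = 0"
    proof (rule weak_flux_identity[OF B_C1 C1 abs_smooth_sign_le_1 pR qR _ _ _ turning wall])
      show "deriv B x = 0" if "X < x" for x using that X x0 x1 by (simp add: dB)
      show "0 < X" using X x0 x1 by simp
      show "(k + B x * ?\<sigma> y) * p n (y\<^sup>2 / 2 - \<phi> x) = 0" if "X < x" for x y
      proof -
        have "- \<kappa> n \<le> y\<^sup>2 / 2 - \<phi> x" using X(2)[OF that] by (smt (verit) zero_le_power2 divide_nonneg_pos)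
        from p_right[OF this] show ?thesis by simp
      qed
    qed
    moreover have "(LINT \<xi>:{\<xi>. \<xi>$1 > 0}|lborel. f\<^sub>b \<xi> * (\<xi>$1 * ((k + B 0 * ?\<sigma> (\<xi>$1))
            * p n ((\<xi>$1)\<^sup>2 / 2 - \<phi>\<^sub>b) * plateau n (\<xi>$2) * plateau n (\<xi>$3)))) = 0"
    proof -
      have "f\<^sub>b \<xi> * p n ((\<xi>$1)\<^sup>2 / 2 - \<phi>\<^sub>b) = 0" if "\<xi>$1 > 0" for \<xi>
        using fb[OF that] p_right[of n "(\<xi>$1)\<^sup>2 / 2 - \<phi>\<^sub>b"] \<kappa>[of n]
        by (cases "(\<xi>$1)\<^sup>2 \<le> 2 * \<phi>\<^sub>b") auto
      then have z: "indicator {\<xi>. \<xi>$1 > 0} \<xi> *\<^sub>R (f\<^sub>b \<xi> * (\<xi>$1 * ((k + B 0 * ?\<sigma> (\<xi>$1))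
            * p n ((\<xi>$1)\<^sup>2 / 2 - \<phi>\<^sub>b) * plateau n (\<xi>$2) * plateau n (\<xi>$3)))) = 0" for \<xi>
        by (auto simp: indicator_def)
      show ?thesis unfolding set_lebesgue_integral_def z by simp
    qed
    ultimately have int0: "integral {0..X} (\<lambda>x. - (deriv B x * flux ?\<sigma> (p n) (plateau n) x)) = 0" by simp
    have w_nonneg: "0 \<le> flux_weight ?\<sigma> (p n) (plateau n) t \<xi>" for t \<xi>
      unfolding flux_weight_def
      by (intro mult_nonneg_nonneg mult_smooth_sign_nonneg \<delta> p_nonneg plateau_nonneg)
    have fw_nonneg: "AE \<xi> in lborel. 0 \<le> f x \<xi> * flux_weight ?\<sigma> (p n) (plateau n) (\<phi> x) \<xi>" if "x \<ge> 0" for x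
      using f_nonneg[OF that] by eventually_elim (simp add: w_nonneg)
    have "0 \<le> flux ?\<sigma> (p n) (plateau n) x" if "x \<ge> 0" for x
      unfolding flux_def by (rule integral_nonneg_AE[OF fw_nonneg[OF that]])
    then have nn: "0 \<le> - (deriv B x * flux ?\<sigma> (p n) (plateau n) x)" if "x \<in> {0..X}" for x
      using that \<alpha> x0 x1 by (simp add: dB)
    have "continuous_on {0..X} (\<lambda>x. - (deriv B x * flux ?\<sigma> (p n) (plateau n) x))"
      by (intro continuous_on_minus continuous_on_mult C1_line_deriv_continuous[OF B_C1 continuous_on_id]
            continuous_on_subset[OF flux_continuous[OF C1 abs_smooth_sign_le_1 pR qR]]) auto
    from integral_eq_0_iff[OF this _ nn] int0 X x0 x1
    have "deriv B x0 * flux ?\<sigma> (p n) (plateau n) x0 = 0" by auto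
    moreover have "deriv B x0 \<noteq> 0" using x0 x1 \<alpha> by (simp add: dB)
    ultimately have "flux ?\<sigma> (p n) (plateau n) x0 = 0" by simp
    then show ?thesis
      unfolding flux_def
      using integral_nonneg_eq_0_iff_AE[OF flux_integrable[OF C1 abs_smooth_sign_le_1 pR qR] fw_nonneg] x0
      by simp
  qed
  have "AE \<xi> in lborel. \<forall>n. f x0 \<xi> * flux_weight (smooth_sign (\<delta> n)) (p n) (plateau n) (\<phi> x0) \<xi> = 0"
    using zero unfolding AE_all_countable by blast
  then show ?thesis
  proof eventually_elim
    case (elim \<xi>)
    show ?case
    proof (intro impI)
      assume \<xi>: "\<xi>$1 \<noteq> 0 \<and> (\<xi>$1)\<^sup>2 / 2 < \<phi> x0"
      define e where "e = (\<xi>$1)\<^sup>2 / 2 - \<phi> x0"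
      have e: "0 < e + \<phi> x0" "e < 0" using \<xi> by (auto simp: e_def)
      define s where "s = min (e + \<phi> x0) (- e)"
      have s: "s > 0" using e by (simp add: s_def)
      obtain n where n: "real n > max (1 / s) (max \<bar>\<xi>$2\<bar> \<bar>\<xi>$3\<bar>)" using reals_Archimedean2 by blast
      have "1 / s < real (Suc n)" using n by simp
      then have "\<kappa> n < s" using s unfolding \<kappa>_def by (simp add: field_simps)
      then have "0 < p n e" by (intro p_pos) (auto simp: s_def)
      moreover have "plateau n (\<xi>$2) = 1" "plateau n (\<xi>$3) = 1" using n by (auto intro!: plateau_eq_1)
      moreover have "\<xi>$1 * smooth_sign (\<delta> n) (\<xi>$1) > 0" using \<xi> by (intro mult_smooth_sign_pos \<delta>) auto
      ultimately have "flux_weight (smooth_sign (\<delta> n)) (p n) (plateau n) (\<phi> x0) \<xi> \<noteq> 0"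
        unfolding flux_weight_def e_def[symmetric] by auto
      then show "f x0 \<xi> = 0" using elim by (metis mult_eq_0_iff)
    qed
  qed
qed

end

section \<open>Density and current in terms of the data at infinity\<close>

text \<open>An energy cutoff that tends to the indicator of \<open>{a<..}\<close>. It vanishes up to \<open>a + 1 / (n + 1)\<close>; this
  margin is the kinetic energy at speed \<open>sqrt (2 / (n + 1))\<close>, below which the sign may be regularised.\<close>

definition window :: "real \<Rightarrow> nat \<Rightarrow> real \<Rightarrow> real" where
  "window a n e = smooth_step (real (Suc n) * (e - a) - 1) * smooth_step (real n + 1 - e)"

lemma C1_window: "C1_line (window a n)"
proof -
  have "C1_line (\<lambda>e. smooth_step (real (Suc n) * e + (- real (Suc n) * a - 1)) * smooth_step (real n + 1 - e))"
    by (intro C1_line_mult C1_line_compose[OF C1_smooth_step] C1_line_scale C1_line_diff C1_line_const C1_line_id)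
  then show ?thesis by (simp add: window_def[abs_def] algebra_simps)
qed

lemma window_nonneg: "0 \<le> window a n e" and window_le_1: "window a n e \<le> 1"
  by (auto simp: window_def smooth_step_nonneg smooth_step_le_1 mult_le_one)

lemma window_eq_0_left: "e \<le> a + 1 / real (Suc n) \<Longrightarrow> window a n e = 0"
  by (auto simp: window_def field_simps intro!: smooth_step_eq_0)

lemma window_eq_0_right: "real n + 1 \<le> e \<Longrightarrow> window a n e = 0"
  by (simp add: window_def smooth_step_eq_0)

lemma window_tendsto: "(\<lambda>n. window a n e) \<longlonglongrightarrow> indicator {a<..} e"
proof (cases "a < e")
  case True
  obtain N where N: "real N > max (2 / (e - a)) e" using reals_Archimedean2 by blast
  have "window a n e = 1" if "n \<ge> N" for n
  proof -
    have "real n \<ge> real N" using that by simp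
    then have n: "real (Suc n) \<ge> 2 / (e - a)" "e \<le> real n" using N by auto
    then have "2 \<le> real (Suc n) * (e - a)" using True by (simp add: pos_divide_le_eq)
    then show ?thesis using n by (simp add: window_def smooth_step_eq_1)
  qed
  then show ?thesis using True
    by (intro tendsto_eventually) (auto intro!: eventually_sequentiallyI[of N])
next
  case False
  have "window a n e = 0" for n using False by (intro window_eq_0_left) (simp add: add_increasing2)
  then show ?thesis using False by simp
qed

lemma plateau_tendsto: "(\<lambda>n. plateau n t) \<longlonglongrightarrow> 1"
proof -
  obtain N where "real N > \<bar>t\<bar>" using reals_Archimedean2 by blast
  then show ?thesis
    by (intro tendsto_eventually eventually_sequentiallyI[of N]) (auto intro!: plateau_eq_1)
qed

lemma windowed_weight:
  assumes a: "0 \<le> a + t" and \<sigma>: "\<And>y. sqrt (2 / real (Suc n)) \<le> \<bar>y\<bar> \<Longrightarrow> y * \<sigma> y = S y"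
  shows "flux_weight \<sigma> (\<lambda>e. window a n e * w e) q t \<xi> =
    S (\<xi>$1) * w ((\<xi>$1)\<^sup>2 / 2 - t) * window a n ((\<xi>$1)\<^sup>2 / 2 - t) * q (\<xi>$2) * q (\<xi>$3)"
proof (cases "sqrt (2 / real (Suc n)) \<le> \<bar>\<xi>$1\<bar>")
  case True
  then show ?thesis using \<sigma>[OF True] by (simp add: flux_weight_def)
next
  case False
  then have "\<bar>\<xi>$1\<bar>\<^sup>2 < (sqrt (2 / real (Suc n)))\<^sup>2"
    by (intro power_strict_mono) auto
  then have "(\<xi>$1)\<^sup>2 < 2 / real (Suc n)" by (simp del: of_nat_Suc)
  then have "(\<xi>$1)\<^sup>2 / 2 - t \<le> a + 1 / real (Suc n)" using a by (simp del: of_nat_Suc)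
  from window_eq_0_left[OF this] show ?thesis by (simp add: flux_weight_def)
qed

text \<open>Removal of the cutoffs. In its uses \<open>S\<close> is \<open>\<lambda>y. y\<close> or the absolute value, the latter arising as the limit of
  \<open>y \<sigma>(y)\<close> for regularised signs.\<close>

lemma windowed_flux_tendsto:
  fixes h :: "real^3 \<Rightarrow> real"
  assumes a: "0 \<le> a + t"
    and \<sigma>: "\<And>n y. sqrt (2 / real (Suc n)) \<le> \<bar>y\<bar> \<Longrightarrow> y * \<sigma> n y = S y" and S: "\<And>y. \<bar>S y\<bar> = \<bar>y\<bar>"
    and S_meas[measurable]: "S \<in> borel_measurable borel" and w_meas[measurable]: "w \<in> borel_measurable borel"
    and h_meas[measurable]: "h \<in> borel_measurable borel"
    and int: "integrable lborel
      (\<lambda>\<xi>. h \<xi> * (\<bar>\<xi>$1\<bar> * w ((\<xi>$1)\<^sup>2 / 2 - t) * indicator {a<..} ((\<xi>$1)\<^sup>2 / 2 - t)))"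
  shows "(\<lambda>n. LINT \<xi>|lborel. h \<xi> * flux_weight (\<sigma> n) (\<lambda>e. window a n e * w e) (plateau n) t \<xi>) \<longlonglongrightarrow>
    (LINT \<xi>|lborel. h \<xi> * (S (\<xi>$1) * w ((\<xi>$1)\<^sup>2 / 2 - t) * indicator {a<..} ((\<xi>$1)\<^sup>2 / 2 - t)))"
proof -
  have win[measurable]: "window a n \<in> borel_measurable borel" for n
    by (intro borel_measurable_continuous_onI C1_line_continuous[OF C1_window continuous_on_id])
  have plat[measurable]: "plateau n \<in> borel_measurable borel" for n
    by (intro borel_measurable_continuous_onI C1_line_continuous[OF C1_plateau continuous_on_id])
  have ind[measurable]: "(\<lambda>\<xi>::real^3. indicator {a<..} ((\<xi>$1)\<^sup>2 / 2 - t) :: real) \<in> borel_measurable borel"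
    by (rule measurable_compose[where g = "indicator {a<..}" and N = borel]) auto
  have w0: "window a n e = window a n e * indicator {a<..} e" for n e
    using window_eq_0_left[of e a n] by (auto simp: indicator_def add_increasing2)
  have weight: "flux_weight (\<sigma> n) (\<lambda>e. window a n e * w e) (plateau n) t \<xi> =
    S (\<xi>$1) * w ((\<xi>$1)\<^sup>2 / 2 - t) * window a n ((\<xi>$1)\<^sup>2 / 2 - t) * plateau n (\<xi>$2) * plateau n (\<xi>$3)" for n \<xi>
    by (rule windowed_weight[OF a]) (rule \<sigma>)
  show ?thesis unfolding weight
  proof (rule integral_dominated_convergence[OF _ _ integrable_abs[OF int]])
    show "AE \<xi> in lborel. (\<lambda>n. h \<xi> * (S (\<xi>$1) * w ((\<xi>$1)\<^sup>2 / 2 - t) * window a n ((\<xi>$1)\<^sup>2 / 2 - t)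
        * plateau n (\<xi>$2) * plateau n (\<xi>$3))) \<longlonglongrightarrow>
      h \<xi> * (S (\<xi>$1) * w ((\<xi>$1)\<^sup>2 / 2 - t) * indicator {a<..} ((\<xi>$1)\<^sup>2 / 2 - t))"
    proof (rule AE_I2)
      fix \<xi> :: "real^3"
      have "(\<lambda>n. h \<xi> * (S (\<xi>$1) * w ((\<xi>$1)\<^sup>2 / 2 - t) * window a n ((\<xi>$1)\<^sup>2 / 2 - t)
        * plateau n (\<xi>$2) * plateau n (\<xi>$3))) \<longlonglongrightarrow>
      h \<xi> * (S (\<xi>$1) * w ((\<xi>$1)\<^sup>2 / 2 - t) * indicator {a<..} ((\<xi>$1)\<^sup>2 / 2 - t) * 1 * 1)"
        by (intro tendsto_mult tendsto_const window_tendsto plateau_tendsto)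
      then show "(\<lambda>n. h \<xi> * (S (\<xi>$1) * w ((\<xi>$1)\<^sup>2 / 2 - t) * window a n ((\<xi>$1)\<^sup>2 / 2 - t)
        * plateau n (\<xi>$2) * plateau n (\<xi>$3))) \<longlonglongrightarrow>
      h \<xi> * (S (\<xi>$1) * w ((\<xi>$1)\<^sup>2 / 2 - t) * indicator {a<..} ((\<xi>$1)\<^sup>2 / 2 - t))" by simp
    qed
    show "AE \<xi> in lborel. norm (h \<xi> * (S (\<xi>$1) * w ((\<xi>$1)\<^sup>2 / 2 - t) * window a n ((\<xi>$1)\<^sup>2 / 2 - t)
        * plateau n (\<xi>$2) * plateau n (\<xi>$3))) \<le>
      \<bar>h \<xi> * (\<bar>\<xi>$1\<bar> * w ((\<xi>$1)\<^sup>2 / 2 - t) * indicator {a<..} ((\<xi>$1)\<^sup>2 / 2 - t))\<bar>" for n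
    proof (rule AE_I2)
      fix \<xi> :: "real^3"
      let ?e = "(\<xi>$1)\<^sup>2 / 2 - t"
      have "window a n ?e * plateau n (\<xi>$2) * plateau n (\<xi>$3) \<le> indicator {a<..} ?e * 1 * 1"
        by (subst w0) (intro mult_mono plateau_le_1 plateau_nonneg mult_nonneg_nonneg window_nonneg,
            auto intro: window_le_1 window_nonneg simp: indicator_def)
      then have "\<bar>h \<xi> * \<xi>$1 * w ?e\<bar> * (window a n ?e * plateau n (\<xi>$2) * plateau n (\<xi>$3))
          \<le> \<bar>h \<xi> * \<xi>$1 * w ?e\<bar> * indicator {a<..} ?e"
        by (intro mult_left_mono) auto
      then show "norm (h \<xi> * (S (\<xi>$1) * w ?e * window a n ?e * plateau n (\<xi>$2) * plateau n (\<xi>$3))) \<le>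
        \<bar>h \<xi> * (\<bar>\<xi>$1\<bar> * w ?e * indicator {a<..} ?e)\<bar>"
        by (simp add: abs_mult S window_nonneg plateau_nonneg mult_ac)
    qed
  qed simp_all
qed

lemma AE_nth_neq: "AE \<xi> in lborel. (\<xi>::real^3) $ 1 \<noteq> c"
proof -
  have "(axis 1 1 :: real^3) \<in> Basis" by (auto simp: Basis_vec_def)
  then have "negligible {\<xi>::real^3. \<xi> \<bullet> axis 1 1 = c}" by (rule negligible_standard_hyperplane)
  then have "{\<xi>::real^3. \<xi>$1 = c} \<in> null_sets lebesgue"
    by (simp add: negligible_iff_null_sets inner_axis)
  moreover have "{\<xi>::real^3. \<xi>$1 = c} \<in> sets borel"
    by (intro borel_closed closed_Collect_eq continuous_intros)
  ultimately have "{\<xi>::real^3. \<xi>$1 = c} \<in> null_sets lborel"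
    by (auto simp: null_sets_def)
  from AE_not_in[OF this] show ?thesis by simp
qed

context VP
begin

text \<open>The margin of the window excludes turning points to the right of \<open>x0\<close>, by \<open>phi_barrier\<close>.\<close>

lemma untrapped_flux:
  assumes g: "integrable lborel f_inf" and x0: "0 \<le> x0" and a: "a = max 0 (- \<phi> x0)"
    and w: "C1_line (\<lambda>e. window a n e * w e)"
    and \<sigma>: "\<sigma> = smooth_sign (sqrt (2 / real (Suc n))) \<or> \<sigma> = (\<lambda>_. 1)"
  shows "flux \<sigma> (\<lambda>e. window a n e * w e) (plateau n) x0 =
    (LINT \<xi>|lborel. f_inf \<xi> * flux_weight \<sigma> (\<lambda>e. window a n e * w e) (plateau n) 0 \<xi>)"
proof (rule flux_conserved[where R = "real n + 1", OF _ w C1_plateau _ _ _ g x0])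
  define \<delta> where "\<delta> = sqrt (2 / real (Suc n))"
  have \<delta>: "0 < \<delta>" by (simp add: \<delta>_def)
  show "C1_line \<sigma>" using \<sigma> C1_smooth_sign C1_line_const by auto
  show "\<bar>\<sigma> y\<bar> \<le> 1" for y using \<sigma> abs_smooth_sign_le_1 by auto
  show "plateau n y = 0" if "\<bar>y\<bar> > real n + 1" for y using that by (intro plateau_eq_0) simp
  show "window a n e * w e = 0" if "\<bar>e\<bar> > real n + 1" for e
  proof -
    have "window a n e = 0"
    proof (cases "e > 0")
      case True
      then show ?thesis using that by (intro window_eq_0_right) simp
    next
      case False
      then show ?thesis using a by (intro window_eq_0_left) (simp add: add_increasing2 max_def)
    qed
    then show ?thesis by simp
  qed
  show "deriv \<sigma> y * (window a n (y\<^sup>2 / 2 - \<phi> x) * w (y\<^sup>2 / 2 - \<phi> x)) = 0" if x: "x > x0" for x y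
  proof (cases "\<delta> \<le> \<bar>y\<bar> \<or> \<sigma> = (\<lambda>_. 1)")
    case True
    have "deriv \<sigma> y = 0"
    proof (cases "\<sigma> = (\<lambda>_. 1)")
      case False
      then show ?thesis using True \<sigma> deriv_smooth_sign_eq_0[OF \<delta>, of y] by (simp add: \<delta>_def)
    qed simp
    then show ?thesis by simp
  next
    case False
    then have "\<bar>y\<bar>\<^sup>2 < \<delta>\<^sup>2" by (intro power_strict_mono) auto
    then have "y\<^sup>2 < 2 / real (Suc n)" by (simp add: \<delta>_def del: of_nat_Suc)
    moreover have "- \<phi> x \<le> a" unfolding a using phi_barrier[OF x0, of x] x by simp
    ultimately have "y\<^sup>2 / 2 - \<phi> x \<le> a + 1 / real (Suc n)" by (simp del: of_nat_Suc)
    from window_eq_0_left[OF this] show ?thesis by simp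
  qed
qed

text \<open>Almost every particle present at \<open>x0\<close> has energy above the barrier, so its flux is the one prescribed at infinity.
  Division of the absolute flux by the speed \<open>sqrt (2 (e + \<phi> x0))\<close> that a particle of energy \<open>e\<close> has at \<open>x0\<close>
  yields the density; the signed flux is the current. At infinity the energy is \<open>\<xi>\<^sub>1\<^sup>2 / 2\<close>.\<close>

lemma moments_from_infinity:
  assumes \<alpha>: "0 \<le> \<alpha>" "\<alpha> < 1" and x0: "x0 > 0"
    and fb: "\<And>\<xi>. \<xi>$1 > 0 \<Longrightarrow> (\<xi>$1)\<^sup>2 \<le> 2 * \<phi>\<^sub>b \<Longrightarrow> f\<^sub>b \<xi> = 0"
    and g: "integrable lborel f_inf" and a: "a = max 0 (- \<phi> x0)"
    and g_moment: "integrable lborel (\<lambda>\<xi>. f_inf \<xi> * (\<bar>\<xi>$1\<bar> * indicator {a<..} ((\<xi>$1)\<^sup>2 / 2)))"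
    and g_density: "integrable lborel
      (\<lambda>\<xi>. f_inf \<xi> * (\<bar>\<xi>$1\<bar> * (1 / sqrt (2 * ((\<xi>$1)\<^sup>2 / 2 + \<phi> x0))) * indicator {a<..} ((\<xi>$1)\<^sup>2 / 2)))"
  shows "(LINT \<xi>|lborel. f x0 \<xi>) = (LINT \<xi>|lborel. f_inf \<xi> *
      (\<bar>\<xi>$1\<bar> * (1 / sqrt (2 * ((\<xi>$1)\<^sup>2 / 2 + \<phi> x0))) * indicator {a<..} ((\<xi>$1)\<^sup>2 / 2)))"
    and "(LINT \<xi>|lborel. \<xi>$1 * f x0 \<xi>) = (LINT \<xi>|lborel. f_inf \<xi> * (\<xi>$1 * indicator {a<..} ((\<xi>$1)\<^sup>2 / 2)))"
proof -
  define \<delta> where "\<delta> n = sqrt (2 / real (Suc n))" for n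
  have \<delta>: "0 < \<delta> n" for n by (simp add: \<delta>_def)
  have \<sigma>_choice: "smooth_sign (\<delta> n) = smooth_sign (sqrt (2 / real (Suc n))) \<or> smooth_sign (\<delta> n) = (\<lambda>_. 1)" for n
    by (simp only: \<delta>_def simp_thms)
  have x0': "0 \<le> x0" using x0 by simp
  have a0: "0 \<le> a" "0 \<le> a + \<phi> x0" unfolding a by auto
  have [measurable]: "f x0 \<in> borel_measurable borel" "f_inf \<in> borel_measurable borel"
    using f_integrable[OF x0'] g by (auto dest: borel_measurable_integrable)
  have sgn_abs: "y * smooth_sign (\<delta> n) y = \<bar>y\<bar>" if "sqrt (2 / real (Suc n)) \<le> \<bar>y\<bar>" for n y
    by (rule mult_smooth_sign_eq_abs[OF \<delta>]) (use that in \<open>simp add: \<delta>_def\<close>)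
  have untrapped: "AE \<xi> in lborel. f x0 \<xi> \<noteq> 0 \<longrightarrow> \<xi>$1 \<noteq> 0 \<and> a < (\<xi>$1)\<^sup>2 / 2 - \<phi> x0"
  proof (cases "\<phi> x0 > 0")
    case True
    have "AE \<xi> in lborel. \<xi>$1 \<noteq> 0 \<and> (\<xi>$1)\<^sup>2 / 2 < \<phi> x0 \<longrightarrow> f x0 \<xi> = 0"
      by (rule no_trapped_particles[OF \<alpha> x0 True]) (rule fb)
    with AE_nth_neq[of 0] AE_nth_neq[of "sqrt (2 * \<phi> x0)"] AE_nth_neq[of "- sqrt (2 * \<phi> x0)"]
    show ?thesis
    proof eventually_elim
      case (elim \<xi>)
      have "(\<xi>$1)\<^sup>2 / 2 \<noteq> \<phi> x0"
      proof
        assume "(\<xi>$1)\<^sup>2 / 2 = \<phi> x0"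
        then have "\<bar>\<xi>$1\<bar> = sqrt (2 * \<phi> x0)" by (metis nonzero_mult_div_cancel_left real_sqrt_abs times_divide_eq_right zero_neq_numeral)
        then show False using elim by (auto simp: abs_if split: if_splits)
      qed
      then show ?case using elim True by (auto simp: a)
    qed
  next
    case False
    from AE_nth_neq[of 0] show ?thesis
      by eventually_elim (use False in \<open>auto simp: a\<close>)
  qed
  let ?w = "\<lambda>e. 1 / sqrt (2 * (e + \<phi> x0))"
  have w_C1: "C1_line (\<lambda>e. window a n e * ?w e)" for n
  proof -
    \<comment> \<open>The inverse speed is singular where \<open>e + \<phi> x0\<close> vanishes. Where the window vanishes, \<open>e + \<phi> x0\<close> may be
      replaced by a positive number, which makes the product a \<open>C\<^sup>1\<close> function.\<close>
    define S where "S e = smooth_step (real (Suc n) * e + (- real (Suc n) * a))" for e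
    define h where "h e = 2 * (S e * (e + \<phi> x0) + (1 - S e))" for e
    have S_C1: "C1_line S" unfolding S_def[abs_def] by (intro C1_line_compose[OF C1_smooth_step] C1_line_scale)
    have h_C1: "C1_line h"
      unfolding h_def[abs_def] by (intro C1_line_mult C1_line_add C1_line_diff S_C1 C1_line_const C1_line_id)
    have S01: "0 \<le> S e" "S e \<le> 1" for e by (simp_all add: S_def smooth_step_nonneg smooth_step_le_1)
    have h_pos: "h e > 0" for e
    proof (cases "e \<le> a")
      case True
      then have "real (Suc n) * e \<le> real (Suc n) * a" by (intro mult_left_mono) auto
      then have "S e = 0" unfolding S_def by (intro smooth_step_eq_0) linarith
      then show ?thesis by (simp add: h_def)
    next
      case False
      then have "e + \<phi> x0 > 0" using a0 by linarith
      then have "S e * (e + \<phi> x0) + (1 - S e) > 0"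
        using S01[of e] by (cases "S e = 0") (auto intro!: add_pos_nonneg)
      then show ?thesis by (simp add: h_def)
    qed
    have "window a n e * ?w e = window a n e * (1 / sqrt (h e))" for e
    proof (cases "e \<le> a + 1 / real (Suc n)")
      case True
      then show ?thesis using window_eq_0_left by simp
    next
      case False
      then have "1 \<le> real (Suc n) * e + (- real (Suc n) * a)" by (simp add: field_simps)
      then have "S e = 1" unfolding S_def by (rule smooth_step_eq_1)
      then show ?thesis by (simp add: h_def)
    qed
    then have "(\<lambda>e. window a n e * ?w e) = (\<lambda>e. window a n e * (1 / sqrt (h e)))" by (rule ext)
    then show ?thesis using C1_line_mult[OF C1_window C1_line_inverse_sqrt[OF h_C1 h_pos]] by metis
  qed
  have fe: "AE \<xi> in lborel. f x0 \<xi> = f x0 \<xi> * (\<bar>\<xi>$1\<bar> * ?w ((\<xi>$1)\<^sup>2 / 2 - \<phi> x0) * indicator {a<..} ((\<xi>$1)\<^sup>2 / 2 - \<phi> x0))"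
    using untrapped by eventually_elim (auto simp: indicator_def)
  have [measurable]: "(\<lambda>\<xi>::real^3. indicator {a<..} ((\<xi>$1)\<^sup>2 / 2 - t) :: real) \<in> borel_measurable borel" for t
    by (rule measurable_compose[where g = "indicator {a<..}" and N = borel]) auto
  have fi: "integrable lborel (\<lambda>\<xi>. f x0 \<xi> * (\<bar>\<xi>$1\<bar> * ?w ((\<xi>$1)\<^sup>2 / 2 - \<phi> x0) * indicator {a<..} ((\<xi>$1)\<^sup>2 / 2 - \<phi> x0)))"
    by (rule Bochner_Integration.integrable_cong_AE_imp[OF f_integrable[OF x0']]) (use fe in auto)
  have "(\<lambda>n. flux (smooth_sign (\<delta> n)) (\<lambda>e. window a n e * ?w e) (plateau n) x0) \<longlonglongrightarrow>
      (LINT \<xi>|lborel. f x0 \<xi> * (\<bar>\<xi>$1\<bar> * ?w ((\<xi>$1)\<^sup>2 / 2 - \<phi> x0) * indicator {a<..} ((\<xi>$1)\<^sup>2 / 2 - \<phi> x0)))"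
    unfolding flux_def by (rule windowed_flux_tendsto[OF a0(2) sgn_abs _ _ _ _ fi]) auto
  moreover have "(\<lambda>n. flux (smooth_sign (\<delta> n)) (\<lambda>e. window a n e * ?w e) (plateau n) x0) \<longlonglongrightarrow>
      (LINT \<xi>|lborel. f_inf \<xi> * (\<bar>\<xi>$1\<bar> * ?w ((\<xi>$1)\<^sup>2 / 2 - 0) * indicator {a<..} ((\<xi>$1)\<^sup>2 / 2 - 0)))"
    unfolding untrapped_flux[OF g x0' a w_C1 \<sigma>_choice]
    by (rule windowed_flux_tendsto[OF _ sgn_abs]) (use a0 g_density in auto)
  ultimately have "(LINT \<xi>|lborel. f x0 \<xi> * (\<bar>\<xi>$1\<bar> * ?w ((\<xi>$1)\<^sup>2 / 2 - \<phi> x0) * indicator {a<..} ((\<xi>$1)\<^sup>2 / 2 - \<phi> x0)))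
     = (LINT \<xi>|lborel. f_inf \<xi> * (\<bar>\<xi>$1\<bar> * ?w ((\<xi>$1)\<^sup>2 / 2 - 0) * indicator {a<..} ((\<xi>$1)\<^sup>2 / 2 - 0)))"
    by (rule LIMSEQ_unique)
  moreover have "(LINT \<xi>|lborel. f x0 \<xi>) =
    (LINT \<xi>|lborel. f x0 \<xi> * (\<bar>\<xi>$1\<bar> * ?w ((\<xi>$1)\<^sup>2 / 2 - \<phi> x0) * indicator {a<..} ((\<xi>$1)\<^sup>2 / 2 - \<phi> x0)))"
    by (rule integral_cong_AE) (use fe in auto)
  ultimately show "(LINT \<xi>|lborel. f x0 \<xi>) = (LINT \<xi>|lborel. f_inf \<xi> *
      (\<bar>\<xi>$1\<bar> * (1 / sqrt (2 * ((\<xi>$1)\<^sup>2 / 2 + \<phi> x0))) * indicator {a<..} ((\<xi>$1)\<^sup>2 / 2)))"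
    by simp
  have one_C1: "C1_line (\<lambda>e. window a n e * 1)" for n using C1_window by simp
  let ?I = "\<lambda>\<xi>::real^3. indicator {a<..} ((\<xi>$1)\<^sup>2 / 2 - \<phi> x0) :: real"
  let ?F = "\<lambda>n \<xi>. f x0 \<xi> * flux_weight (smooth_sign (\<delta> n)) (\<lambda>e. window a n e * 1) (plateau n) (\<phi> x0) \<xi>"
  define C where "C = (LINT \<xi>|lborel. \<bar>f_inf \<xi> * (\<bar>\<xi>$1\<bar> * indicator {a<..} ((\<xi>$1)\<^sup>2 / 2))\<bar>)"
  have lim_inf: "(\<lambda>n. flux (smooth_sign (\<delta> n)) (\<lambda>e. window a n e * 1) (plateau n) x0) \<longlonglongrightarrow>
      (LINT \<xi>|lborel. f_inf \<xi> * (\<bar>\<xi>$1\<bar> * 1 * indicator {a<..} ((\<xi>$1)\<^sup>2 / 2 - 0)))"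
    unfolding untrapped_flux[OF g x0' a one_C1 \<sigma>_choice]
    by (rule windowed_flux_tendsto[OF _ sgn_abs, where w = "\<lambda>_. 1"]) (use a0 g_moment in auto)
  \<comment> \<open>A slice of a solution is only known to be integrable; its first moment is controlled by the absolute flux,
    through Fatou's lemma.\<close>
  have moment: "integrable lborel (\<lambda>\<xi>. f x0 \<xi> * (\<bar>\<xi>$1\<bar> * 1 * ?I \<xi>))"
  proof (rule integrableI_bounded)
    show "(\<lambda>\<xi>. f x0 \<xi> * (\<bar>\<xi>$1\<bar> * 1 * ?I \<xi>)) \<in> borel_measurable lborel" by simp
    have F_int: "integrable lborel (?F n)" for n
    proof (rule flux_integrable[where R = "real n + 1"])
      show "window a n e * 1 = 0" if "real n + 1 < \<bar>e\<bar>" for e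
        using window_eq_0_right[of n e a] window_eq_0_left[of e a n] that a0(1)
        by (cases "e > 0") (auto simp: add_increasing2)
      show "plateau n y = 0" if "real n + 1 < \<bar>y\<bar>" for y using that by (intro plateau_eq_0) simp
    qed (use x0' one_C1 in \<open>auto intro: C1_smooth_sign C1_plateau abs_smooth_sign_le_1\<close>)
    have F_nonneg: "AE \<xi> in lborel. 0 \<le> ?F n \<xi>" for n
      using f_nonneg[OF x0']
      by eventually_elim
         (auto simp: flux_weight_def intro!: mult_nonneg_nonneg mult_smooth_sign_nonneg \<delta> window_nonneg plateau_nonneg)
    have F_lim: "AE \<xi> in lborel. ennreal (norm (f x0 \<xi> * (\<bar>\<xi>$1\<bar> * 1 * ?I \<xi>))) = liminf (\<lambda>n. ennreal (?F n \<xi>))"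
      using f_nonneg[OF x0']
    proof eventually_elim
      case (elim \<xi>)
      have "(\<lambda>n. f x0 \<xi> * (\<bar>\<xi>$1\<bar> * 1 * window a n ((\<xi>$1)\<^sup>2 / 2 - \<phi> x0) * plateau n (\<xi>$2) * plateau n (\<xi>$3))) \<longlonglongrightarrow>
         f x0 \<xi> * (\<bar>\<xi>$1\<bar> * 1 * ?I \<xi> * 1 * 1)"
        by (intro tendsto_mult tendsto_const window_tendsto plateau_tendsto)
      moreover have "flux_weight (smooth_sign (\<delta> n)) (\<lambda>e. window a n e * 1) (plateau n) (\<phi> x0) \<xi> =
          \<bar>\<xi>$1\<bar> * 1 * window a n ((\<xi>$1)\<^sup>2 / 2 - \<phi> x0) * plateau n (\<xi>$2) * plateau n (\<xi>$3)" for n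
        by (rule windowed_weight[OF a0(2), where w = "\<lambda>_. 1"]) (rule sgn_abs)
      ultimately have "(\<lambda>n. ?F n \<xi>) \<longlonglongrightarrow> f x0 \<xi> * (\<bar>\<xi>$1\<bar> * 1 * ?I \<xi>)"
        by (simp only: mult_1_right)
      from tendsto_ennrealI[OF this] have "liminf (\<lambda>n. ennreal (?F n \<xi>)) = ennreal (f x0 \<xi> * (\<bar>\<xi>$1\<bar> * 1 * ?I \<xi>))"
        by (intro lim_imp_Liminf) auto
      moreover have "0 \<le> f x0 \<xi> * (\<bar>\<xi>$1\<bar> * 1 * ?I \<xi>)" using elim by (auto simp: indicator_def)
      ultimately show ?case by simp
    qed
    have "(\<integral>\<^sup>+ \<xi>. ennreal (norm (f x0 \<xi> * (\<bar>\<xi>$1\<bar> * 1 * ?I \<xi>))) \<partial>lborel) = (\<integral>\<^sup>+ \<xi>. liminf (\<lambda>n. ennreal (?F n \<xi>)) \<partial>lborel)"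
      by (rule nn_integral_cong_AE[OF F_lim])
    also have "\<dots> \<le> liminf (\<lambda>n. \<integral>\<^sup>+ \<xi>. ennreal (?F n \<xi>) \<partial>lborel)"
      by (rule nn_integral_liminf) (use F_int in \<open>auto intro!: measurable_compose[OF borel_measurable_integrable] simp del: mult_1_right\<close>)
    also have "(\<lambda>n. \<integral>\<^sup>+ \<xi>. ennreal (?F n \<xi>) \<partial>lborel) = (\<lambda>n. ennreal (flux (smooth_sign (\<delta> n)) (\<lambda>e. window a n e * 1) (plateau n) x0))"
      unfolding flux_def by (intro ext nn_integral_eq_integral F_int F_nonneg)
    also have "liminf \<dots> = ennreal (LINT \<xi>|lborel. f_inf \<xi> * (\<bar>\<xi>$1\<bar> * 1 * indicator {a<..} ((\<xi>$1)\<^sup>2 / 2 - 0)))"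
      by (intro lim_imp_Liminf tendsto_ennrealI lim_inf) auto
    also have "\<dots> < \<infinity>" by simp
    finally show "(\<integral>\<^sup>+ \<xi>. ennreal (norm (f x0 \<xi> * (\<bar>\<xi>$1\<bar> * 1 * ?I \<xi>))) \<partial>lborel) < \<infinity>" .
  qed
  have "(\<lambda>n. flux (\<lambda>_. 1) (\<lambda>e. window a n e * 1) (plateau n) x0) \<longlonglongrightarrow>
      (LINT \<xi>|lborel. f x0 \<xi> * (\<xi>$1 * 1 * ?I \<xi>))"
    unfolding flux_def
    by (rule windowed_flux_tendsto[OF a0(2), where S = "\<lambda>y. y" and w = "\<lambda>_. 1"]) (use moment in auto)
  moreover have "(\<lambda>n. flux (\<lambda>_. 1) (\<lambda>e. window a n e * 1) (plateau n) x0) \<longlonglongrightarrow>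
      (LINT \<xi>|lborel. f_inf \<xi> * (\<xi>$1 * 1 * indicator {a<..} ((\<xi>$1)\<^sup>2 / 2 - 0)))"
    unfolding untrapped_flux[OF g x0' a one_C1 disjI2[OF refl]]
    by (rule windowed_flux_tendsto[where S = "\<lambda>y. y" and w = "\<lambda>_. 1"]) (use a0 g_moment in auto)
  ultimately have "(LINT \<xi>|lborel. f x0 \<xi> * (\<xi>$1 * 1 * ?I \<xi>)) =
      (LINT \<xi>|lborel. f_inf \<xi> * (\<xi>$1 * 1 * indicator {a<..} ((\<xi>$1)\<^sup>2 / 2 - 0)))"
    by (rule LIMSEQ_unique)
  moreover have "(LINT \<xi>|lborel. \<xi>$1 * f x0 \<xi>) = (LINT \<xi>|lborel. f x0 \<xi> * (\<xi>$1 * 1 * ?I \<xi>))"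
    by (rule integral_cong_AE) (use untrapped in \<open>auto simp: indicator_def elim: eventually_mono\<close>)
  ultimately show "(LINT \<xi>|lborel. \<xi>$1 * f x0 \<xi>) = (LINT \<xi>|lborel. f_inf \<xi> * (\<xi>$1 * indicator {a<..} ((\<xi>$1)\<^sup>2 / 2)))"
    by simp
qed

end

section \<open>Averages over concentrated data\<close>

lemma mollifier_facts:
  assumes "mollifier \<eta>"
  shows "integrable lborel \<eta>" and "(LINT \<xi>|lborel. \<eta> \<xi>) = 1" and "0 \<le> \<eta> \<xi>"
    and "\<eta> \<xi> \<noteq> 0 \<Longrightarrow> \<bar>\<xi>$1\<bar> < 1"
proof -
  show one: "(LINT \<xi>|lborel. \<eta> \<xi>) = 1" and "0 \<le> \<eta> \<xi>"
    using assms unfolding mollifier_def by auto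
  show "integrable lborel \<eta>" using one not_integrable_integral_eq by fastforce
  assume "\<eta> \<xi> \<noteq> 0"
  then have "\<xi> \<in> closure {\<xi>. \<eta> \<xi> \<noteq> 0}" by (intro closure_subset[THEN subsetD]) simp
  then have "norm \<xi> < 1" using assms unfolding mollifier_def by auto
  then show "\<bar>\<xi>$1\<bar> < 1" using component_le_norm_cart[of \<xi> 1] by simp
qed

text \<open>The common shape of the three terms of the data at infinity; \<open>s = -1\<close> is the one that arises by reflection.\<close>

definition bump :: "(real^3 \<Rightarrow> real) \<Rightarrow> real \<Rightarrow> real \<Rightarrow> real \<Rightarrow> real^3 \<Rightarrow> real" where
  "bump \<eta> s a \<epsilon> \<xi> = 1 / \<epsilon>^3 * \<eta> ((1/\<epsilon>) *\<^sub>R vector [s * (\<xi>$1 - a), \<xi>$2, \<xi>$3])"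

lemma vec3_eq_iff: "(x::real^3) = y \<longleftrightarrow> x$1 = y$1 \<and> x$2 = y$2 \<and> x$3 = y$3"
  by (simp add: vec_eq_iff forall_3)

lemma bump_change_of_variables:
  fixes \<eta> :: "real^3 \<Rightarrow> real" and G :: "real \<Rightarrow> real"
  assumes \<epsilon>: "\<epsilon> > 0" and s: "\<bar>s\<bar> = 1"
    and [measurable]: "\<eta> \<in> borel_measurable borel" "G \<in> borel_measurable borel"
  shows "integrable lborel (\<lambda>\<xi>. bump \<eta> s a \<epsilon> \<xi> * G (\<xi>$1)) \<longleftrightarrow>
      integrable lborel (\<lambda>\<zeta>. \<eta> \<zeta> * G (a + s * \<epsilon> * \<zeta>$1))"
    and "(LINT \<xi>|lborel. bump \<eta> s a \<epsilon> \<xi> * G (\<xi>$1)) = (LINT \<zeta>|lborel. \<eta> \<zeta> * G (a + s * \<epsilon> * \<zeta>$1))"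
proof -
  define c :: "real^3 \<Rightarrow> real" where "c j = (if j = axis 1 1 then s * \<epsilon> else \<epsilon>)" for j
  define T :: "real^3 \<Rightarrow> real^3" where
    "T \<zeta> = axis 1 a + (\<Sum>j\<in>Basis. (c j * (\<zeta> \<bullet> j)) *\<^sub>R j)" for \<zeta>
  have s0: "s \<noteq> 0" "s * s = 1" using s by (auto simp: abs_if split: if_splits)
  have abs_c: "\<bar>c j\<bar> = \<epsilon>" for j using s \<epsilon> by (simp add: c_def abs_mult)
  have T: "T \<zeta> $ 1 = a + s * \<epsilon> * \<zeta>$1" "T \<zeta> $ 2 = \<epsilon> * \<zeta>$2" "T \<zeta> $ 3 = \<epsilon> * \<zeta>$3" for \<zeta>
  proof -
    have B: "(\<Sum>j\<in>(Basis :: (real^3) set). F j) = F (axis 1 1) + F (axis 2 1) + F (axis 3 1)" for F :: "real^3 \<Rightarrow> real^3"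
    proof -
      have basis: "(Basis :: (real^3) set) = {axis 1 1, axis 2 1, axis 3 1}"
        by (auto simp: Basis_vec_def) (metis exhaust_3)
      have "axis 1 (1::real) \<noteq> (axis 2 1 :: real^3)" "axis 1 (1::real) \<noteq> (axis 3 1 :: real^3)"
        "axis 2 (1::real) \<noteq> (axis 3 1 :: real^3)" by (auto simp: axis_eq_axis)
      then show ?thesis unfolding basis by (simp add: add.assoc)
    qed
    have ax: "(axis i x :: real^3) $ j = (if j = i then x else 0)" for i j x
      by (simp add: axis_def)
    show "T \<zeta> $ 1 = a + s * \<epsilon> * \<zeta>$1" "T \<zeta> $ 2 = \<epsilon> * \<zeta>$2" "T \<zeta> $ 3 = \<epsilon> * \<zeta>$3"
      unfolding T_def B by (simp_all add: c_def inner_axis axis_eq_axis ax)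
  qed
  have T_cont: "continuous_on UNIV T" unfolding T_def by (intro continuous_intros)
  have [measurable]: "T \<in> borel_measurable borel" by (rule borel_measurable_continuous_onI[OF T_cont])
  have lb: "lborel = density (distr lborel borel T) (\<lambda>_. ennreal (\<epsilon>^3))"
  proof -
    have "lborel = density (distr lborel borel T) (\<lambda>_. ennreal (\<Prod>j\<in>(Basis::(real^3) set). \<bar>c j\<bar>))"
      unfolding T_def by (rule lborel_affine_euclidean) (use s0 \<epsilon> in \<open>simp add: c_def\<close>)
    then show ?thesis by (simp add: abs_c)
  qed
  have vec_cont: "continuous_on UNIV (\<lambda>\<xi>::real^3. (1/\<epsilon>) *\<^sub>R (vector [s * (\<xi>$1 - a), \<xi>$2, \<xi>$3] :: real^3))"
  proof -
    have "(\<lambda>\<xi>::real^3. (1/\<epsilon>) *\<^sub>R (vector [s * (\<xi>$1 - a), \<xi>$2, \<xi>$3] :: real^3)) =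
      (\<lambda>\<xi>. (1/\<epsilon>) *\<^sub>R ((s * (\<xi>$1 - a)) *\<^sub>R axis 1 1 + (\<xi>$2) *\<^sub>R axis 2 1 + (\<xi>$3) *\<^sub>R axis 3 1))"
      by (intro ext) (simp add: vec3_eq_iff axis_def)
    then show ?thesis by (simp only:) (intro continuous_intros)
  qed
  have [measurable]: "bump \<eta> s a \<epsilon> \<in> borel_measurable borel"
    unfolding bump_def
    by (intro borel_measurable_times borel_measurable_const
        measurable_compose[OF borel_measurable_continuous_onI[OF vec_cont]]) simp
  let ?F = "\<lambda>\<xi>. bump \<eta> s a \<epsilon> \<xi> * G (\<xi>$1)"
  have inv: "(1/\<epsilon>) *\<^sub>R vector [s * (T \<zeta> $ 1 - a), T \<zeta> $ 2, T \<zeta> $ 3] = \<zeta>" for \<zeta>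
    using \<epsilon> s0 by (simp add: vec3_eq_iff T)
  have FT: "\<epsilon>^3 * ?F (T \<zeta>) = \<eta> \<zeta> * G (a + s * \<epsilon> * \<zeta>$1)" for \<zeta>
    unfolding bump_def inv using \<epsilon> by (simp add: T(1))
  have "integrable lborel ?F \<longleftrightarrow> integrable (density (distr lborel borel T) (\<lambda>_. ennreal (\<epsilon>^3))) ?F"
    using lb by simp
  also have "\<dots> \<longleftrightarrow> integrable (distr lborel borel T) (\<lambda>\<xi>. \<epsilon>^3 * ?F \<xi>)"
    using \<epsilon> by (subst integrable_density) auto
  also have "\<dots> \<longleftrightarrow> integrable lborel (\<lambda>\<zeta>. \<epsilon>^3 * ?F (T \<zeta>))"
    by (rule integrable_distr_eq) auto
  finally show "integrable lborel ?F \<longleftrightarrow> integrable lborel (\<lambda>\<zeta>. \<eta> \<zeta> * G (a + s * \<epsilon> * \<zeta>$1))"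
    unfolding FT .
  have "integral\<^sup>L lborel ?F = integral\<^sup>L (density (distr lborel borel T) (\<lambda>_. ennreal (\<epsilon>^3))) ?F"
    using lb by simp
  also have "\<dots> = (LINT \<xi>|distr lborel borel T. \<epsilon>^3 * ?F \<xi>)"
    using \<epsilon> by (subst integral_density) auto
  also have "\<dots> = (LINT \<zeta>|lborel. \<epsilon>^3 * ?F (T \<zeta>))"
    by (rule integral_distr) auto
  finally show "integral\<^sup>L lborel ?F = (LINT \<zeta>|lborel. \<eta> \<zeta> * G (a + s * \<epsilon> * \<zeta>$1))"
    unfolding FT .
qed

text \<open>The bump is a probability density concentrated in \<open>\<bar>\<xi>\<^sub>1 - a\<bar> \<le> \<epsilon>\<close>.\<close>

lemma bump_average:
  fixes \<eta> :: "real^3 \<Rightarrow> real" and G :: "real \<Rightarrow> real"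
  assumes \<eta>: "mollifier \<eta>" and \<epsilon>: "\<epsilon> > 0" and s: "\<bar>s\<bar> = 1"
    and G[measurable]: "G \<in> borel_measurable borel" and K: "\<And>y. \<bar>y - a\<bar> \<le> \<epsilon> \<Longrightarrow> \<bar>G y - G a\<bar> \<le> K"
  shows "integrable lborel (\<lambda>\<xi>. bump \<eta> s a \<epsilon> \<xi> * G (\<xi>$1))"
    and "\<bar>(LINT \<xi>|lborel. bump \<eta> s a \<epsilon> \<xi> * G (\<xi>$1)) - G a\<bar> \<le> K"
proof -
  note mf = mollifier_facts[OF \<eta>]
  have [measurable]: "\<eta> \<in> borel_measurable borel" using mf(1) by (auto dest: borel_measurable_integrable)
  let ?H = "\<lambda>\<zeta>::real^3. G (a + s * \<epsilon> * \<zeta>$1)"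
  have close: "\<eta> \<zeta> * \<bar>?H \<zeta> - G a\<bar> \<le> K * \<eta> \<zeta>" for \<zeta>
  proof (cases "\<eta> \<zeta> = 0")
    case False
    from mf(4)[OF this] have "\<bar>s * \<epsilon> * \<zeta>$1\<bar> \<le> \<epsilon>" using \<epsilon> s by (simp add: abs_mult mult_le_cancel_left2)
    then have "\<bar>?H \<zeta> - G a\<bar> \<le> K" by (intro K) simp
    then show ?thesis using mf(3)[of \<zeta>] by (simp add: mult.commute[of K] mult_left_mono)
  qed simp
  have diff_int: "integrable lborel (\<lambda>\<zeta>. \<eta> \<zeta> * (?H \<zeta> - G a))"
  proof (rule Bochner_Integration.integrable_bound[OF integrable_mult_right[OF mf(1), of K]])
    show "AE \<zeta> in lborel. norm (\<eta> \<zeta> * (?H \<zeta> - G a)) \<le> norm (K * \<eta> \<zeta>)"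
    proof (rule AE_I2)
      fix \<zeta>
      have "norm (\<eta> \<zeta> * (?H \<zeta> - G a)) = \<eta> \<zeta> * \<bar>?H \<zeta> - G a\<bar>" using mf(3)[of \<zeta>] by (simp add: abs_mult)
      then show "norm (\<eta> \<zeta> * (?H \<zeta> - G a)) \<le> norm (K * \<eta> \<zeta>)" using close[of \<zeta>] by simp
    qed
  qed simp
  have eq: "(\<lambda>\<zeta>. \<eta> \<zeta> * ?H \<zeta>) = (\<lambda>\<zeta>. \<eta> \<zeta> * (?H \<zeta> - G a) + \<eta> \<zeta> * G a)"
    by (auto simp: algebra_simps)
  have int: "integrable lborel (\<lambda>\<zeta>. \<eta> \<zeta> * ?H \<zeta>)"
    unfolding eq using diff_int mf(1) by auto
  then show "integrable lborel (\<lambda>\<xi>. bump \<eta> s a \<epsilon> \<xi> * G (\<xi>$1))"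
    by (subst bump_change_of_variables[OF \<epsilon> s]) auto
  have "(LINT \<xi>|lborel. bump \<eta> s a \<epsilon> \<xi> * G (\<xi>$1)) = (LINT \<zeta>|lborel. \<eta> \<zeta> * ?H \<zeta>)"
    by (rule bump_change_of_variables[OF \<epsilon> s]) auto
  also have "\<dots> = (LINT \<zeta>|lborel. \<eta> \<zeta> * (?H \<zeta> - G a)) + G a"
    unfolding eq using diff_int mf(1,2) by (subst Bochner_Integration.integral_add) auto
  finally have "(LINT \<xi>|lborel. bump \<eta> s a \<epsilon> \<xi> * G (\<xi>$1)) - G a = (LINT \<zeta>|lborel. \<eta> \<zeta> * (?H \<zeta> - G a))" by simp
  moreover have "norm (LINT \<zeta>|lborel. \<eta> \<zeta> * (?H \<zeta> - G a)) \<le> (LINT \<zeta>|lborel. K * \<eta> \<zeta>)"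
  proof (rule Bochner_Integration.integral_norm_bound_integral[OF diff_int])
    show "integrable lborel (\<lambda>\<zeta>. K * \<eta> \<zeta>)" using mf(1) by auto
    show "norm (\<eta> \<zeta> * (?H \<zeta> - G a)) \<le> K * \<eta> \<zeta>" for \<zeta>
      using close[of \<zeta>] mf(3)[of \<zeta>] by (simp add: abs_mult)
  qed
  ultimately show "\<bar>(LINT \<xi>|lborel. bump \<eta> s a \<epsilon> \<xi> * G (\<xi>$1)) - G a\<bar> \<le> K"
    using mf(2) by simp
qed

lemma g_inf_eq_bumps:
  "g_inf \<eta> \<alpha> m\<^sub>b m_inf v\<^sub>b v_inf \<epsilon> \<xi> =
    m_inf * bump \<eta> 1 (- v_inf) \<epsilon> \<xi> + m\<^sub>b * bump \<eta> 1 v\<^sub>b \<epsilon> \<xi> + \<alpha> * m_inf * bump \<eta> (- 1) v_inf \<epsilon> \<xi>"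
proof -
  have 1: "\<xi> - vector [a, 0, 0] = vector [1 * (\<xi>$1 - a), \<xi>$2, \<xi>$3]" for a
    by (simp add: vec3_eq_iff)
  have 2: "reflect1 \<xi> + vector [v_inf, 0, 0] = vector [- 1 * (\<xi>$1 - v_inf), \<xi>$2, \<xi>$3]"
    by (simp add: vec3_eq_iff)
  show ?thesis unfolding g_inf_def 1 2 bump_def by simp
qed

lemma g_inf_average:
  fixes \<eta> :: "real^3 \<Rightarrow> real" and G :: "real \<Rightarrow> real"
  assumes \<eta>: "mollifier \<eta>" and \<epsilon>: "\<epsilon> > 0"
    and m: "m\<^sub>b \<ge> 0" "m_inf \<ge> 0" "0 \<le> \<alpha>" "m\<^sub>b + (1 + \<alpha>) * m_inf = 1"
    and G: "G \<in> borel_measurable borel"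
    and K: "\<And>a y. a \<in> {- v_inf, v\<^sub>b, v_inf} \<Longrightarrow> \<bar>y - a\<bar> \<le> \<epsilon> \<Longrightarrow> \<bar>G y - G a\<bar> \<le> K"
  shows "integrable lborel (\<lambda>\<xi>. g_inf \<eta> \<alpha> m\<^sub>b m_inf v\<^sub>b v_inf \<epsilon> \<xi> * G (\<xi>$1))"
    and "\<bar>(LINT \<xi>|lborel. g_inf \<eta> \<alpha> m\<^sub>b m_inf v\<^sub>b v_inf \<epsilon> \<xi> * G (\<xi>$1))
      - (m_inf * G (- v_inf) + m\<^sub>b * G v\<^sub>b + \<alpha> * m_inf * G v_inf)\<bar> \<le> K"
proof -
  have b: "integrable lborel (\<lambda>\<xi>. bump \<eta> s a \<epsilon> \<xi> * G (\<xi>$1))"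
      "\<bar>(LINT \<xi>|lborel. bump \<eta> s a \<epsilon> \<xi> * G (\<xi>$1)) - G a\<bar> \<le> K"
    if "\<bar>s\<bar> = 1" "a \<in> {- v_inf, v\<^sub>b, v_inf}" for s a
    using bump_average[OF \<eta> \<epsilon> that(1) G K[OF that(2)]] by blast+
  have b1: "integrable lborel (\<lambda>\<xi>. bump \<eta> 1 (- v_inf) \<epsilon> \<xi> * G (\<xi>$1))"
    and b2: "integrable lborel (\<lambda>\<xi>. bump \<eta> 1 v\<^sub>b \<epsilon> \<xi> * G (\<xi>$1))"
    and b3: "integrable lborel (\<lambda>\<xi>. bump \<eta> (- 1) v_inf \<epsilon> \<xi> * G (\<xi>$1))"
    by (intro b(1); simp)+
  have eq: "(\<lambda>\<xi>. g_inf \<eta> \<alpha> m\<^sub>b m_inf v\<^sub>b v_inf \<epsilon> \<xi> * G (\<xi>$1)) =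
    (\<lambda>\<xi>. m_inf * (bump \<eta> 1 (- v_inf) \<epsilon> \<xi> * G (\<xi>$1)) + m\<^sub>b * (bump \<eta> 1 v\<^sub>b \<epsilon> \<xi> * G (\<xi>$1))
       + \<alpha> * m_inf * (bump \<eta> (- 1) v_inf \<epsilon> \<xi> * G (\<xi>$1)))"
    unfolding g_inf_eq_bumps by (auto simp: algebra_simps)
  show "integrable lborel (\<lambda>\<xi>. g_inf \<eta> \<alpha> m\<^sub>b m_inf v\<^sub>b v_inf \<epsilon> \<xi> * G (\<xi>$1))"
    unfolding eq by (intro Bochner_Integration.integrable_add integrable_mult_right b1 b2 b3)
  define I1 I2 I3 where I: "I1 = (LINT \<xi>|lborel. bump \<eta> 1 (- v_inf) \<epsilon> \<xi> * G (\<xi>$1))"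
    "I2 = (LINT \<xi>|lborel. bump \<eta> 1 v\<^sub>b \<epsilon> \<xi> * G (\<xi>$1))"
    "I3 = (LINT \<xi>|lborel. bump \<eta> (- 1) v_inf \<epsilon> \<xi> * G (\<xi>$1))"
  have "(LINT \<xi>|lborel. g_inf \<eta> \<alpha> m\<^sub>b m_inf v\<^sub>b v_inf \<epsilon> \<xi> * G (\<xi>$1)) = m_inf * I1 + m\<^sub>b * I2 + \<alpha> * m_inf * I3"
    unfolding eq I
    by (simp only: Bochner_Integration.integral_add Bochner_Integration.integrable_add integrable_mult_right
        integral_mult_right_zero b1 b2 b3)
  then have "\<bar>(LINT \<xi>|lborel. g_inf \<eta> \<alpha> m\<^sub>b m_inf v\<^sub>b v_inf \<epsilon> \<xi> * G (\<xi>$1))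
      - (m_inf * G (- v_inf) + m\<^sub>b * G v\<^sub>b + \<alpha> * m_inf * G v_inf)\<bar>
     = \<bar>m_inf * (I1 - G (- v_inf)) + m\<^sub>b * (I2 - G v\<^sub>b) + \<alpha> * m_inf * (I3 - G v_inf)\<bar>"
    by (simp add: algebra_simps)
  also have "\<dots> \<le> m_inf * K + m\<^sub>b * K + \<alpha> * m_inf * K"
  proof -
    have I_bound: "\<bar>I1 - G (- v_inf)\<bar> \<le> K" "\<bar>I2 - G v\<^sub>b\<bar> \<le> K" "\<bar>I3 - G v_inf\<bar> \<le> K"
      unfolding I by (intro b(2); simp)+
    have "\<bar>c * z\<bar> \<le> c * K" if "0 \<le> c" "\<bar>z\<bar> \<le> K" for c z
      using that by (simp add: abs_mult mult_left_mono)
    from this[OF m(2) I_bound(1)] this[OF m(1) I_bound(2)]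
      this[OF mult_nonneg_nonneg[OF m(3,2)] I_bound(3)]
    show ?thesis by linarith
  qed
  also have "\<dots> = (m\<^sub>b + (1 + \<alpha>) * m_inf) * K" by (simp add: algebra_simps)
  finally show "\<bar>(LINT \<xi>|lborel. g_inf \<eta> \<alpha> m\<^sub>b m_inf v\<^sub>b v_inf \<epsilon> \<xi> * G (\<xi>$1))
      - (m_inf * G (- v_inf) + m\<^sub>b * G v\<^sub>b + \<alpha> * m_inf * G v_inf)\<bar> \<le> K"
    using m(4) by simp
qed

text \<open>The ratio of the speed at infinity to the local speed enters the density. Its derivative
  \<open>2 t / (s\<^sup>2 + 2 t)\<^bsup>3/2\<^esup>\<close> is bounded because the bound on \<open>t\<close> keeps \<open>s\<^sup>2 + 2 t\<close> above \<open>v\<^sup>2 / 8\<close>.\<close>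

lemma speed_ratio_Lipschitz:
  assumes v: "v > 0" and t: "\<bar>t\<bar> \<le> v\<^sup>2 / 16" and x: "x \<ge> v / 2" and y: "y \<ge> v / 2"
  shows "\<bar>x / sqrt (x\<^sup>2 + 2 * t) - y / sqrt (y\<^sup>2 + 2 * t)\<bar> \<le> 1 / sqrt (v\<^sup>2 / 8) * \<bar>x - y\<bar>"
proof -
  define d where "d = v\<^sup>2 / 8"
  have d: "d > 0" using v by (simp add: d_def)
  have ge: "s\<^sup>2 + 2 * t \<ge> d" if "s \<ge> v / 2" for s
  proof -
    have "(v / 2)\<^sup>2 \<le> s\<^sup>2" using that v by (intro power_mono) auto
    then show ?thesis using t by (simp add: d_def power_divide abs_le_iff)
  qed
  have "norm (x / sqrt (x\<^sup>2 + 2 * t) - y / sqrt (y\<^sup>2 + 2 * t)) \<le> 1 / sqrt d * norm (x - y)"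
  proof (rule field_differentiable_bound[where S = "{v/2..}" and f' = "\<lambda>s. 2 * t / ((s\<^sup>2 + 2 * t) * sqrt (s\<^sup>2 + 2 * t))"])
    show "((\<lambda>s. s / sqrt (s\<^sup>2 + 2 * t)) has_field_derivative 2 * t / ((s\<^sup>2 + 2 * t) * sqrt (s\<^sup>2 + 2 * t)))
        (at s within {v/2..})" if "s \<in> {v/2..}" for s
    proof -
      have X: "s\<^sup>2 + 2 * t > 0" using ge[of s] that d by simp
      have "((\<lambda>s. s / sqrt (s\<^sup>2 + 2 * t)) has_real_derivative
          (1 * sqrt (s\<^sup>2 + 2 * t) - s * (2 * s * (inverse (sqrt (s\<^sup>2 + 2 * t)) / 2))) / (sqrt (s\<^sup>2 + 2 * t) * sqrt (s\<^sup>2 + 2 * t)))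
          (at s within {v/2..})"
        using X by (auto intro!: derivative_eq_intros)
      moreover have "(1 * sqrt (s\<^sup>2 + 2 * t) - s * (2 * s * (inverse (sqrt (s\<^sup>2 + 2 * t)) / 2))) / (sqrt (s\<^sup>2 + 2 * t) * sqrt (s\<^sup>2 + 2 * t))
          = 2 * t / ((s\<^sup>2 + 2 * t) * sqrt (s\<^sup>2 + 2 * t))"
        using X by (simp add: field_simps power2_eq_square)
      ultimately show ?thesis by simp
    qed
    show "norm (2 * t / ((s\<^sup>2 + 2 * t) * sqrt (s\<^sup>2 + 2 * t))) \<le> 1 / sqrt d" if "s \<in> {v/2..}" for s
    proof -
      have X: "s\<^sup>2 + 2 * t \<ge> d" using ge[of s] that by simp
      have "norm (2 * t / ((s\<^sup>2 + 2 * t) * sqrt (s\<^sup>2 + 2 * t))) = \<bar>2 * t\<bar> / ((s\<^sup>2 + 2 * t) * sqrt (s\<^sup>2 + 2 * t))"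
        using X d by (simp add: abs_mult)
      also have "\<dots> \<le> d / (d * sqrt d)"
        using X d t by (intro frac_le mult_mono) (auto simp: d_def)
      finally show ?thesis using d by simp
    qed
  qed (use x y in auto)
  then show ?thesis by (simp add: d_def)
qed

section \<open>Comparison of the potentials\<close>

text \<open>At an interior maximum with a value above \<open>K\<close> the first derivative vanishes and the second is positive, so the
  function would still increase to the right of it.\<close>

lemma comparison_principle:
  fixes w w' w'' :: "real \<Rightarrow> real"
  assumes cont: "continuous_on {0..} w" and lim: "(w \<longlongrightarrow> 0) at_top" and w0: "w 0 \<le> K" and K: "0 \<le> K"
    and d1: "\<And>x. x > 0 \<Longrightarrow> (w has_real_derivative w' x) (at x)"
    and d2: "\<And>x. x > 0 \<Longrightarrow> (w' has_real_derivative w'' x) (at x)"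
    and convex: "\<And>x. x > 0 \<Longrightarrow> w x > K \<Longrightarrow> w'' x > 0" and x: "x \<ge> 0"
  shows "w x \<le> K"
proof (rule ccontr)
  assume "\<not> w x \<le> K"
  then have big: "w x > K" by simp
  have "\<forall>\<^sub>F y in at_top. w y < w x" using big K by (intro order_tendstoD(2)[OF lim]) auto
  then obtain X where X: "\<And>y. y \<ge> X \<Longrightarrow> w y < w x" unfolding eventually_at_top_linorder by blast
  define Y where "Y = max X x"
  have "{0..Y} \<noteq> {}" using x by (auto simp: Y_def)
  moreover have "continuous_on {0..Y} w" by (rule continuous_on_subset[OF cont]) auto
  ultimately obtain z where z: "z \<in> {0..Y}" "\<And>y. y \<in> {0..Y} \<Longrightarrow> w y \<le> w z"
    using continuous_attains_sup[OF compact_Icc, of 0 Y w] by blast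
  have zx: "w z \<ge> w x" using z(2)[of x] x by (simp add: Y_def)
  have max: "w y \<le> w z" if "y \<ge> 0" for y
  proof (cases "y \<le> Y")
    case False
    then have "X \<le> y" by (simp add: Y_def)
    then show ?thesis using X[of y] zx by linarith
  qed (use z(2) that in auto)
  have "z > 0" using zx big w0 z(1) by (cases "z = 0") auto
  have "w' z = 0"
    by (rule DERIV_local_max[OF d1[OF \<open>z > 0\<close>], of z]) (use \<open>z > 0\<close> max in auto)
  moreover have "w'' z > 0" using convex[OF \<open>z > 0\<close>] zx big by simp
  ultimately obtain r where r: "r > 0" "\<And>h. h > 0 \<Longrightarrow> h < r \<Longrightarrow> w' (z + h) > 0"
    using DERIV_pos_inc_right[OF d2[OF \<open>z > 0\<close>]] by auto
  have "w z < w (z + r / 2)"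
  proof (rule DERIV_pos_imp_increasing_open[of z "z + r / 2" w])
    show "z < z + r / 2" using r by simp
    show "\<exists>y. (w has_real_derivative y) (at u) \<and> 0 < y" if "z < u" "u < z + r / 2" for u
      using d1[of u] r(2)[of "u - z"] that \<open>z > 0\<close> r(1) by auto
    show "continuous_on {z..z + r / 2} w"
      by (rule continuous_on_subset[OF cont]) (use \<open>z > 0\<close> in auto)
  qed
  with max[of "z + r / 2"] \<open>z > 0\<close> r(1) show False by simp
qed

text \<open>The solution classes are defined by derivatives relative to a set, the differential equations by ordinary ones.\<close>

lemma C2_on_derivatives:
  assumes "C2_on S \<phi>" and T: "open T" "T \<subseteq> S" and x: "x \<in> T"
  shows "(\<phi> has_real_derivative deriv \<phi> x) (at x)"
    and "(deriv \<phi> has_real_derivative deriv (deriv \<phi>) x) (at x)"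
proof -
  have at: "at y within S = at y" if "y \<in> T" for y
    using interior_maximal[OF T(2,1)] that by (intro at_within_interior) auto
  have first: "(\<phi> has_real_derivative deriv_on S \<phi> y) (at y)" if "y \<in> T" for y
  proof -
    have "\<phi> differentiable (at y)"
    proof -
      have "\<phi> differentiable (at y within S)"
        using assms(1) that T(2) unfolding C2_on_def C1_on_def differentiable_on_def by auto
      then show ?thesis unfolding at[OF that] .
    qed
    then show ?thesis unfolding deriv_on_def at[OF that]
      by (simp add: vector_derivative_works has_real_derivative_iff_has_vector_derivative)
  qed
  then have eq: "deriv \<phi> y = deriv_on S \<phi> y" if "y \<in> T" for y
    using that by (intro DERIV_imp_deriv) auto
  show "(\<phi> has_real_derivative deriv \<phi> x) (at x)" using first[OF x] eq[OF x] by simp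
  have "deriv_on S \<phi> differentiable (at x)"
  proof -
    have "deriv_on S \<phi> differentiable (at x within S)"
      using assms(1) x T(2) unfolding C2_on_def C1_on_def differentiable_on_def by auto
    then show ?thesis unfolding at[OF x] .
  qed
  then obtain D where "(deriv_on S \<phi> has_real_derivative D) (at x)"
    by (auto simp: real_differentiable_def)
  then have "(deriv \<phi> has_real_derivative D) (at x)"
    by (rule has_field_derivative_transform_within_open[OF _ T(1) x]) (simp add: eq)
  then show "(deriv \<phi> has_real_derivative deriv (deriv \<phi>) x) (at x)"
    using DERIV_imp_deriv by blast
qed

text \<open>The smallness of \<open>\<phi>\<^sub>b\<close> and \<open>\<epsilon>\<close> keeps the support of the data at infinity above the barrier, so the energy
  restriction disappears from the moments and they are averages over bumps of width \<open>\<epsilon>\<close>.\<close>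

lemma approximate_moments:
  fixes \<eta> :: "real^3 \<Rightarrow> real"
  assumes sol: "VP_solution n\<^sub>e \<alpha> \<phi>\<^sub>b (g_b \<eta> m\<^sub>b v\<^sub>b \<phi>\<^sub>b \<epsilon>) (g_inf \<eta> \<alpha> m\<^sub>b m_inf v\<^sub>b v_inf \<epsilon>) f \<phi>"
    and \<eta>: "mollifier \<eta>" and \<alpha>: "0 \<le> \<alpha>" "\<alpha> < 1"
    and m: "m\<^sub>b \<ge> 0" "m_inf \<ge> 0" "m\<^sub>b + (1 + \<alpha>) * m_inf = 1"
    and v: "v > 0" "v \<le> v\<^sub>b" "v \<le> v_inf"
    and \<phi>\<^sub>b: "\<bar>\<phi>\<^sub>b\<bar> \<le> v\<^sup>2 / 16" and \<epsilon>: "0 < \<epsilon>" "\<epsilon> \<le> v / 2" and x: "x > 0"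
  shows "\<bar>vp_density f x - lim_density \<alpha> m\<^sub>b m_inf v\<^sub>b v_inf \<phi> x\<bar> \<le> 1 / sqrt (v\<^sup>2 / 8) * \<epsilon>"
    and "\<bar>(LINT \<xi>|lborel. \<xi>$1 * f x \<xi>) - (m\<^sub>b * v\<^sub>b + (\<alpha> - 1) * m_inf * v_inf)\<bar> \<le> \<epsilon>"
proof -
  interpret VP n\<^sub>e \<alpha> \<phi>\<^sub>b "g_b \<eta> m\<^sub>b v\<^sub>b \<phi>\<^sub>b \<epsilon>" "g_inf \<eta> \<alpha> m\<^sub>b m_inf v\<^sub>b v_inf \<epsilon>" f \<phi>
    by unfold_locales (rule sol)
  define a where "a = max 0 (- \<phi> x)"
  have t: "\<bar>\<phi> x\<bar> \<le> v\<^sup>2 / 16" using phi_bound[of x] x \<phi>\<^sub>b by simp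
  let ?A = "{- v_inf, v\<^sub>b, v_inf}"
  let ?I = "\<lambda>y::real. indicator {a<..} (y\<^sup>2 / 2) :: real"
  have I_meas[measurable]: "?I \<in> borel_measurable borel"
    by (rule measurable_compose[where g = "indicator {a<..}" and N = borel]) auto
  have near: "v / 2 \<le> \<bar>y\<bar>" "?I y = 1" if "c \<in> ?A" "\<bar>y - c\<bar> \<le> \<epsilon>" for c y
  proof -
    have "v \<le> \<bar>c\<bar>" using that(1) v by auto
    then show y: "v / 2 \<le> \<bar>y\<bar>" using that(2) \<epsilon> by linarith
    then have "(v / 2)\<^sup>2 \<le> \<bar>y\<bar>\<^sup>2" using v by (intro power_mono) auto
    then have "v\<^sup>2 / 8 \<le> y\<^sup>2 / 2" by (simp add: power_divide)
    moreover have "v\<^sup>2 > 0" using v by simp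
    ultimately have "0 < y\<^sup>2 / 2" "- \<phi> x < y\<^sup>2 / 2" using t by linarith+
    then have "a < y\<^sup>2 / 2" unfolding a_def by (rule max_less_iff_conj[THEN iffD2, OF conjI])
    then show "?I y = 1" by simp
  qed
  have near_c: "v / 2 \<le> \<bar>c\<bar>" "?I c = 1" if "c \<in> ?A" for c using near[OF that, of c] \<epsilon> by auto
  define G where "G y = \<bar>y\<bar> * (1 / sqrt (2 * (y\<^sup>2 / 2 + \<phi> x))) * ?I y" for y
  have G_meas: "G \<in> borel_measurable borel" unfolding G_def by measurable
  have G_eq: "G y = \<bar>y\<bar> / sqrt (\<bar>y\<bar>\<^sup>2 + 2 * \<phi> x)" if "?I y = 1" for y
    using that by (simp add: G_def distrib_left)
  have L: "0 \<le> 1 / sqrt (v\<^sup>2 / 8)" by simp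
  have G_K: "\<bar>G y - G c\<bar> \<le> 1 / sqrt (v\<^sup>2 / 8) * \<epsilon>" if c: "c \<in> ?A" and y: "\<bar>y - c\<bar> \<le> \<epsilon>" for c y
  proof -
    have "\<bar>G y - G c\<bar> \<le> 1 / sqrt (v\<^sup>2 / 8) * \<bar>\<bar>y\<bar> - \<bar>c\<bar>\<bar>"
      unfolding G_eq[OF near(2)[OF c y]] G_eq[OF near_c(2)[OF c]]
      by (rule speed_ratio_Lipschitz[OF v(1) t near(1)[OF c y] near_c(1)[OF c]])
    also have "\<dots> \<le> 1 / sqrt (v\<^sup>2 / 8) * \<epsilon>"
      by (rule mult_left_mono[OF _ L]) (use y in linarith)
    finally show ?thesis .
  qed
  have density: "integrable lborel (\<lambda>\<xi>. g_inf \<eta> \<alpha> m\<^sub>b m_inf v\<^sub>b v_inf \<epsilon> \<xi> * G (\<xi>$1))"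
    "\<bar>(LINT \<xi>|lborel. g_inf \<eta> \<alpha> m\<^sub>b m_inf v\<^sub>b v_inf \<epsilon> \<xi> * G (\<xi>$1))
      - (m_inf * G (- v_inf) + m\<^sub>b * G v\<^sub>b + \<alpha> * m_inf * G v_inf)\<bar> \<le> 1 / sqrt (v\<^sup>2 / 8) * \<epsilon>"
    by (rule g_inf_average[OF \<eta> \<epsilon>(1) m(1,2) \<alpha>(1) m(3) G_meas]; fact G_K)+
  have I_K: "\<bar>S y * ?I y - S c * ?I c\<bar> \<le> \<epsilon>"
    if c: "c \<in> ?A" and y: "\<bar>y - c\<bar> \<le> \<epsilon>" and S: "S = abs \<or> S = (\<lambda>y. y)" for S and c y
    using near(2)[OF c y] near_c(2)[OF c] S y by (auto simp: abs_le_iff)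
  have g_int: "integrable lborel (g_inf \<eta> \<alpha> m\<^sub>b m_inf v\<^sub>b v_inf \<epsilon>)"
    using g_inf_average(1)[OF \<eta> \<epsilon>(1) m(1,2) \<alpha>(1) m(3), of "\<lambda>_. 1" v_inf v\<^sub>b 0] by simp
  have fb: "g_b \<eta> m\<^sub>b v\<^sub>b \<phi>\<^sub>b \<epsilon> \<xi> = 0" if "0 < \<xi>$1" "(\<xi>$1)\<^sup>2 \<le> 2 * \<phi>\<^sub>b" for \<xi>
    using that by (simp add: g_b_def)
  have abs_int: "integrable lborel (\<lambda>\<xi>. g_inf \<eta> \<alpha> m\<^sub>b m_inf v\<^sub>b v_inf \<epsilon> \<xi> * (\<bar>\<xi>$1\<bar> * indicator {a<..} ((\<xi>$1)\<^sup>2 / 2)))"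
    by (rule g_inf_average(1)[OF \<eta> \<epsilon>(1) m(1,2) \<alpha>(1) m(3), where G = "\<lambda>y. \<bar>y\<bar> * ?I y" and K = \<epsilon>])
       (simp, rule I_K, simp_all)
  have dens_int: "integrable lborel (\<lambda>\<xi>. g_inf \<eta> \<alpha> m\<^sub>b m_inf v\<^sub>b v_inf \<epsilon> \<xi> *
      (\<bar>\<xi>$1\<bar> * (1 / sqrt (2 * ((\<xi>$1)\<^sup>2 / 2 + \<phi> x))) * indicator {a<..} ((\<xi>$1)\<^sup>2 / 2)))"
    using density(1) by (simp only: G_def)
  have G_at: "m_inf * G (- v_inf) + m\<^sub>b * G v\<^sub>b + \<alpha> * m_inf * G v_inf = lim_density \<alpha> m\<^sub>b m_inf v\<^sub>b v_inf \<phi> x"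
    using G_eq[OF near_c(2), of "- v_inf"] G_eq[OF near_c(2), of v\<^sub>b] G_eq[OF near_c(2), of v_inf] v
    by (simp add: lim_density_def algebra_simps add_divide_distrib)
  have "vp_density f x = (LINT \<xi>|lborel. g_inf \<eta> \<alpha> m\<^sub>b m_inf v\<^sub>b v_inf \<epsilon> \<xi> * G (\<xi>$1))"
    unfolding vp_density_def G_def
    by (rule moments_from_infinity(1)[OF \<alpha> x _ g_int a_def abs_int dens_int]) (rule fb)
  then show "\<bar>vp_density f x - lim_density \<alpha> m\<^sub>b m_inf v\<^sub>b v_inf \<phi> x\<bar> \<le> 1 / sqrt (v\<^sup>2 / 8) * \<epsilon>"
    using density(2) unfolding G_at by simp
  have "\<bar>(LINT \<xi>|lborel. g_inf \<eta> \<alpha> m\<^sub>b m_inf v\<^sub>b v_inf \<epsilon> \<xi> * (\<xi>$1 * ?I (\<xi>$1)))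
      - (m_inf * (- v_inf * ?I (- v_inf)) + m\<^sub>b * (v\<^sub>b * ?I v\<^sub>b) + \<alpha> * m_inf * (v_inf * ?I v_inf))\<bar> \<le> \<epsilon>"
    by (rule g_inf_average(2)[OF \<eta> \<epsilon>(1) m(1,2) \<alpha>(1) m(3), where G = "\<lambda>y. y * ?I y" and K = \<epsilon>])
       (simp, rule I_K, simp_all)
  moreover have "m_inf * (- v_inf * ?I (- v_inf)) + m\<^sub>b * (v\<^sub>b * ?I v\<^sub>b) + \<alpha> * m_inf * (v_inf * ?I v_inf)
      = m\<^sub>b * v\<^sub>b + (\<alpha> - 1) * m_inf * v_inf"
    using near_c(2)[of "- v_inf"] near_c(2)[of v\<^sub>b] near_c(2)[of v_inf] by (simp add: algebra_simps)
  ultimately show "\<bar>(LINT \<xi>|lborel. \<xi>$1 * f x \<xi>) - (m\<^sub>b * v\<^sub>b + (\<alpha> - 1) * m_inf * v_inf)\<bar> \<le> \<epsilon>"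
    using moments_from_infinity(2)[OF \<alpha> x _ g_int a_def abs_int dens_int] fb by simp
qed

lemma limit_solution_bounded:
  assumes "limit_solution n\<^sub>e \<alpha> \<phi>\<^sub>b m\<^sub>b m_inf v\<^sub>b v_inf \<phi>" and x: "x \<ge> 0"
  shows "\<bar>\<phi> x\<bar> \<le> \<bar>\<phi>\<^sub>b\<bar>"
proof -
  have lim: "(\<phi> \<longlongrightarrow> 0) at_top" and \<phi>0: "\<phi> 0 = \<phi>\<^sub>b"
    using assms(1) unfolding limit_solution_def by auto
  from assms(1) have "monotone_on {0..} (\<le>) (\<le>) \<phi> \<or> monotone_on {0..} (\<le>) (\<ge>) \<phi>"
    unfolding limit_solution_def by blast
  then show ?thesis
  proof
    assume mono: "monotone_on {0..} (\<le>) (\<le>) \<phi>"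
    have "\<phi> x \<le> 0"
      by (rule tendsto_lowerbound[OF lim])
         (use monotone_onD[OF mono, of x] x in \<open>auto intro!: eventually_at_top_linorderI[of x]\<close>)
    moreover have "\<phi>\<^sub>b \<le> \<phi> x" using monotone_onD[OF mono, of 0 x] x \<phi>0 by simp
    ultimately show ?thesis by simp
  next
    assume mono: "monotone_on {0..} (\<le>) (\<ge>) \<phi>"
    have "0 \<le> \<phi> x"
      by (rule tendsto_upperbound[OF lim])
         (use monotone_onD[OF mono, of x] x in \<open>auto intro!: eventually_at_top_linorderI[of x]\<close>)
    moreover have "\<phi> x \<le> \<phi>\<^sub>b" using monotone_onD[OF mono, of 0 x] x \<phi>0 by simp
    ultimately show ?thesis by simp
  qed
qed

text \<open>The derivative of the charge density \<open>N - n\<^sub>e\<close> at \<open>0\<close> is \<open>1 - m\<^sub>b / v\<^sub>b\<^sup>2 - (1 + \<alpha>) m_inf / v_inf\<^sup>2\<close>, which the Bohm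
  condition makes positive; \<open>N\<close> and \<open>n\<^sub>e\<close> are continuously differentiable there.\<close>

lemma charge_monotone_near_0:
  fixes n\<^sub>e :: "real \<Rightarrow> real" and \<alpha> m\<^sub>b m_inf v\<^sub>b v_inf :: real
  defines "N \<equiv> lim_density \<alpha> m\<^sub>b m_inf v\<^sub>b v_inf (\<lambda>t. t)"
  assumes ne: "C2_on UNIV n\<^sub>e" "deriv n\<^sub>e 0 = -1"
    and v: "v\<^sub>b > 0" "v_inf > 0" and mass: "m\<^sub>b + (1 + \<alpha>) * m_inf = 1"
    and bohm: "m\<^sub>b / v\<^sub>b^2 + (1 + \<alpha>) * m_inf / v_inf^2 < 1"
  obtains \<delta> \<kappa> L where "\<delta> > 0" and "\<kappa> > 0" and "L \<ge> 0"
    and "\<And>s t. \<bar>s\<bar> < \<delta> \<Longrightarrow> \<bar>t\<bar> < \<delta> \<Longrightarrow> s < t \<Longrightarrow> \<kappa> * (t - s) \<le> (N t - n\<^sub>e t) - (N s - n\<^sub>e s)"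
    and "\<And>s t. \<bar>s\<bar> < \<delta> \<Longrightarrow> \<bar>t\<bar> < \<delta> \<Longrightarrow> \<bar>N t - N s\<bar> \<le> L * \<bar>t - s\<bar>"
    and "\<And>t. \<bar>t\<bar> < \<delta> \<Longrightarrow> 1 / 2 \<le> N t"
proof -
  define q where "q w t = w / ((w\<^sup>2 + 2 * t) * sqrt (w\<^sup>2 + 2 * t))" for w t :: real
  define N1 where "N1 t = - (m\<^sub>b * q v\<^sub>b t + (1 + \<alpha>) * m_inf * q v_inf t)" for t
  define r where "r = min (v\<^sub>b\<^sup>2) (v_inf\<^sup>2) / 2"
  have r: "r > 0" using v by (simp add: r_def)
  have pos: "v\<^sub>b\<^sup>2 + 2 * t > 0" "v_inf\<^sup>2 + 2 * t > 0" if "\<bar>t\<bar> < r" for t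
    using that by (auto simp: r_def abs_less_iff)
  have root: "((\<lambda>t. w / sqrt (w\<^sup>2 + 2 * t)) has_real_derivative - q w t) (at t)" if "w\<^sup>2 + 2 * t > 0" for w t
    unfolding q_def using that by (auto intro!: derivative_eq_intros simp: field_simps)
  have N_eq: "N = (\<lambda>t. m\<^sub>b * (v\<^sub>b / sqrt (v\<^sub>b\<^sup>2 + 2 * t)) + (1 + \<alpha>) * m_inf * (v_inf / sqrt (v_inf\<^sup>2 + 2 * t)))"
    by (simp add: N_def lim_density_def fun_eq_iff)
  have N_deriv: "(N has_real_derivative N1 t) (at t)" if "\<bar>t\<bar> < r" for t
  proof -
    have "(N has_real_derivative m\<^sub>b * - q v\<^sub>b t + (1 + \<alpha>) * m_inf * - q v_inf t) (at t)"
      unfolding N_eq by (intro DERIV_add DERIV_cmult root pos that)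
    then show ?thesis by (simp add: N1_def)
  qed
  have n_deriv: "(n\<^sub>e has_real_derivative deriv n\<^sub>e t) (at t)"
    and n1_cont: "isCont (deriv n\<^sub>e) t" for t
    using C2_on_derivatives[OF ne(1) open_UNIV subset_UNIV UNIV_I, of t] DERIV_isCont by auto
  have q0: "q w 0 = 1 / w\<^sup>2" if "w > 0" for w using that by (simp add: q_def)
  have q_cont: "isCont (q w) 0" if "w > 0" for w
    unfolding q_def using that by (intro continuous_intros) auto
  have N1_cont: "isCont N1 0" unfolding N1_def by (intro continuous_intros q_cont v)
  define \<kappa>0 where "\<kappa>0 = N1 0 - deriv n\<^sub>e 0"
  have \<kappa>0: "\<kappa>0 > 0" using bohm ne(2) v by (simp add: \<kappa>0_def N1_def q0)
  have N0: "N 0 = 1" using mass v by (simp add: N_eq)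
  have nhds: "(g \<longlongrightarrow> g 0) (nhds 0)" if "isCont g 0" for g :: "real \<Rightarrow> real"
    using that by (simp add: isCont_def tendsto_at_iff_tendsto_nhds)
  have "isCont (\<lambda>t. N1 t - deriv n\<^sub>e t) 0" by (intro continuous_intros N1_cont n1_cont)
  from order_tendstoD(1)[OF nhds[OF this], of "\<kappa>0 / 2"] \<kappa>0
  have "\<forall>\<^sub>F t in nhds 0. \<kappa>0 / 2 < N1 t - deriv n\<^sub>e t" by (simp add: \<kappa>0_def)
  moreover have "isCont (\<lambda>t. \<bar>N1 t\<bar>) 0" by (intro continuous_intros N1_cont)
  from order_tendstoD(2)[OF nhds[OF this], of "\<bar>N1 0\<bar> + 1"]
  have "\<forall>\<^sub>F t in nhds 0. \<bar>N1 t\<bar> < \<bar>N1 0\<bar> + 1" by simp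
  moreover have "isCont N 0" using DERIV_isCont[OF N_deriv] r by simp
  from order_tendstoD(1)[OF nhds[OF this], of "1 / 2"] N0
  have "\<forall>\<^sub>F t in nhds 0. 1 / 2 < N t" by simp
  ultimately have "\<forall>\<^sub>F t in nhds 0. \<kappa>0 / 2 < N1 t - deriv n\<^sub>e t \<and> \<bar>N1 t\<bar> < \<bar>N1 0\<bar> + 1 \<and> 1 / 2 < N t"
    by eventually_elim simp
  then obtain d where d: "d > 0" "\<And>t. \<bar>t\<bar> < d \<Longrightarrow>
      \<kappa>0 / 2 < N1 t - deriv n\<^sub>e t \<and> \<bar>N1 t\<bar> < \<bar>N1 0\<bar> + 1 \<and> 1 / 2 < N t"
    unfolding eventually_nhds_metric by (auto simp: dist_real_def)
  define \<delta> where "\<delta> = min d r"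
  have \<delta>: "\<delta> > 0" using d r by (simp add: \<delta>_def)
  show ?thesis
  proof (rule that[of \<delta> "\<kappa>0 / 2" "\<bar>N1 0\<bar> + 1"])
    fix s t :: real assume st: "\<bar>s\<bar> < \<delta>" "\<bar>t\<bar> < \<delta>"
    show "\<kappa>0 / 2 * (t - s) \<le> (N t - n\<^sub>e t) - (N s - n\<^sub>e s)" if "s < t"
    proof -
      have "((\<lambda>t. N t - n\<^sub>e t) has_real_derivative N1 z - deriv n\<^sub>e z) (at z)" if "s \<le> z" "z \<le> t" for z
        by (intro DERIV_diff N_deriv n_deriv) (use st that in \<open>auto simp: \<delta>_def\<close>)
      from MVT2[OF \<open>s < t\<close> this] obtain z where z: "s < z" "z < t"
        "(N t - n\<^sub>e t) - (N s - n\<^sub>e s) = (t - s) * (N1 z - deriv n\<^sub>e z)" by auto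
      have "\<bar>z\<bar> < d" using z st by (auto simp: \<delta>_def abs_less_iff)
      then have "\<kappa>0 / 2 \<le> N1 z - deriv n\<^sub>e z" using d(2) by fastforce
      then have "(t - s) * (\<kappa>0 / 2) \<le> (t - s) * (N1 z - deriv n\<^sub>e z)"
        using \<open>s < t\<close> by (intro mult_left_mono) auto
      then show ?thesis by (simp add: z(3) mult.commute)
    qed
    have "norm (N t - N s) \<le> (\<bar>N1 0\<bar> + 1) * norm (t - s)"
    proof (rule field_differentiable_bound[where S = "{-\<delta><..<\<delta>}" and f' = N1])
      show "(N has_real_derivative N1 z) (at z within {-\<delta><..<\<delta>})" if "z \<in> {-\<delta><..<\<delta>}" for z
        by (rule has_field_derivative_at_within[OF N_deriv]) (use that in \<open>auto simp: \<delta>_def\<close>)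
      show "norm (N1 z) \<le> \<bar>N1 0\<bar> + 1" if "z \<in> {-\<delta><..<\<delta>}" for z
      proof -
        have "\<bar>z\<bar> < d" using that by (auto simp: \<delta>_def abs_less_iff)
        then show ?thesis using d(2) by fastforce
      qed
    qed (use st in auto)
    then show "\<bar>N t - N s\<bar> \<le> (\<bar>N1 0\<bar> + 1) * \<bar>t - s\<bar>" by simp
  next
    show "1 / 2 \<le> N t" if "\<bar>t\<bar> < \<delta>" for t using d(2)[of t] that by (simp add: \<delta>_def)
  qed (use \<delta> \<kappa>0 in auto)
qed

text \<open>Where the difference exceeds \<open>e / \<kappa>\<close> it is convex, by \<open>growth\<close>. The conclusion is one-sided, to be used with the
  two potentials in either order.\<close>

lemma potential_stability:
  fixes u\<^sub>1 u\<^sub>2 :: "real \<Rightarrow> real"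
  assumes cont: "continuous_on {0..} u\<^sub>1" "continuous_on {0..} u\<^sub>2"
    and lim: "(u\<^sub>1 \<longlongrightarrow> 0) at_top" "(u\<^sub>2 \<longlongrightarrow> 0) at_top" and start: "u\<^sub>1 0 = u\<^sub>2 0"
    and d1: "\<And>x. x > 0 \<Longrightarrow> (u\<^sub>1 has_real_derivative u\<^sub>1' x) (at x)"
    and d1': "\<And>x. x > 0 \<Longrightarrow> (u\<^sub>1' has_real_derivative F1 x) (at x)"
    and d2: "\<And>x. x > 0 \<Longrightarrow> (u\<^sub>2 has_real_derivative u\<^sub>2' x) (at x)"
    and d2': "\<And>x. x > 0 \<Longrightarrow> (u\<^sub>2' has_real_derivative F2 x) (at x)"
    and \<kappa>: "\<kappa> > 0" and e: "e \<ge> 0"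
    and growth: "\<And>x. x > 0 \<Longrightarrow> u\<^sub>2 x < u\<^sub>1 x \<Longrightarrow> \<kappa> * (u\<^sub>1 x - u\<^sub>2 x) - e \<le> F1 x - F2 x"
    and x: "x \<ge> 0"
  shows "u\<^sub>1 x - u\<^sub>2 x \<le> e / \<kappa>"
proof (rule comparison_principle[where w = "\<lambda>x. u\<^sub>1 x - u\<^sub>2 x" and w' = "\<lambda>x. u\<^sub>1' x - u\<^sub>2' x" and w'' = "\<lambda>x. F1 x - F2 x"])
  show "continuous_on {0..} (\<lambda>x. u\<^sub>1 x - u\<^sub>2 x)" by (intro continuous_intros cont)
  show "((\<lambda>x. u\<^sub>1 x - u\<^sub>2 x) \<longlongrightarrow> 0) at_top" using tendsto_diff[OF lim] by simp
  show K: "0 \<le> e / \<kappa>" using \<kappa> e by simp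
  show "u\<^sub>1 0 - u\<^sub>2 0 \<le> e / \<kappa>" using start K by simp
  show "((\<lambda>x. u\<^sub>1 x - u\<^sub>2 x) has_real_derivative u\<^sub>1' y - u\<^sub>2' y) (at y)" if "y > 0" for y
    by (intro DERIV_diff d1 d2 that)
  show "((\<lambda>x. u\<^sub>1' x - u\<^sub>2' x) has_real_derivative F1 y - F2 y) (at y)" if "y > 0" for y
    by (intro DERIV_diff d1' d2' that)
  show "0 < F1 y - F2 y" if y: "y > 0" and big: "e / \<kappa> < u\<^sub>1 y - u\<^sub>2 y" for y
  proof -
    have "e < \<kappa> * (u\<^sub>1 y - u\<^sub>2 y)" using big \<kappa> by (simp add: pos_divide_less_eq mult.commute)
    moreover have "u\<^sub>2 y < u\<^sub>1 y" using big K by linarith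
    ultimately show ?thesis using growth[OF y] by linarith
  qed
qed (rule x)

theorem theorem2p7:
  fixes n\<^sub>e :: "real \<Rightarrow> real" and \<eta> :: "real^3 \<Rightarrow> real"
    and \<alpha> m\<^sub>b m_inf v\<^sub>b v_inf :: real
  assumes "C2_on UNIV n\<^sub>e" and "n\<^sub>e 0 = 1" and "deriv n\<^sub>e 0 = -1"
    and "mollifier \<eta>"
    and "0 \<le> \<alpha>" and "\<alpha> < 1"
    and "m\<^sub>b \<ge> 0" and "m_inf > 0" and "v\<^sub>b > 0" and "v_inf > 0"
    and "m\<^sub>b + (1 + \<alpha>) * m_inf = 1"
    and "m\<^sub>b / v\<^sub>b^2 + (1 + \<alpha>) * m_inf / v_inf^2 < 1"
  shows "\<exists>\<epsilon>\<^sub>0>0. \<exists>\<delta>\<^sub>0>0. \<exists>C\<^sub>0>0. \<forall>\<phi>\<^sub>b. \<phi>\<^sub>b \<noteq> 0 \<and> \<bar>\<phi>\<^sub>b\<bar> < \<delta>\<^sub>0 \<longrightarrow>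
    (\<forall>\<epsilon>\<in>{0<..<\<epsilon>\<^sub>0}. \<forall>f\<^sub>\<epsilon> \<phi>\<^sub>\<epsilon> \<phi>.
       VP_solution n\<^sub>e \<alpha> \<phi>\<^sub>b (g_b \<eta> m\<^sub>b v\<^sub>b \<phi>\<^sub>b \<epsilon>) (g_inf \<eta> \<alpha> m\<^sub>b m_inf v\<^sub>b v_inf \<epsilon>) f\<^sub>\<epsilon> \<phi>\<^sub>\<epsilon> \<and>
       limit_solution n\<^sub>e \<alpha> \<phi>\<^sub>b m\<^sub>b m_inf v\<^sub>b v_inf \<phi> \<longrightarrow>
       (SUP x\<in>{0<..}. ereal \<bar>vp_density f\<^sub>\<epsilon> x - lim_density \<alpha> m\<^sub>b m_inf v\<^sub>b v_inf \<phi> x\<bar>)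
       + (SUP x\<in>{0<..}. ereal \<bar>vp_density f\<^sub>\<epsilon> x * vp_velocity f\<^sub>\<epsilon> x
             - lim_density \<alpha> m\<^sub>b m_inf v\<^sub>b v_inf \<phi> x * lim_velocity \<alpha> m\<^sub>b m_inf v\<^sub>b v_inf \<phi> x\<bar>)
       + (SUP x\<in>{0<..}. ereal \<bar>\<phi>\<^sub>\<epsilon> x - \<phi> x\<bar>)
       \<le> ereal (C\<^sub>0 * \<epsilon>))"
proof -
  define N where "N = lim_density \<alpha> m\<^sub>b m_inf v\<^sub>b v_inf (\<lambda>t. t)"
  obtain \<delta> \<kappa> L where \<delta>: "\<delta> > 0" and \<kappa>: "\<kappa> > 0" and L: "L \<ge> 0"
    and grow: "\<And>s t. \<bar>s\<bar> < \<delta> \<Longrightarrow> \<bar>t\<bar> < \<delta> \<Longrightarrow> s < t \<Longrightarrow> \<kappa> * (t - s) \<le> (N t - n\<^sub>e t) - (N s - n\<^sub>e s)"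
    and lip: "\<And>s t. \<bar>s\<bar> < \<delta> \<Longrightarrow> \<bar>t\<bar> < \<delta> \<Longrightarrow> \<bar>N t - N s\<bar> \<le> L * \<bar>t - s\<bar>"
    and half: "\<And>t. \<bar>t\<bar> < \<delta> \<Longrightarrow> 1 / 2 \<le> N t"
    using charge_monotone_near_0[OF assms(1,3,9,10,11,12)] unfolding N_def by blast
  have N_at: "lim_density \<alpha> m\<^sub>b m_inf v\<^sub>b v_inf u x = N (u x)" for u x
    by (simp add: N_def lim_density_def)
  define v where "v = min v\<^sub>b v_inf"
  have v: "v > 0" "v \<le> v\<^sub>b" "v \<le> v_inf" using assms(9,10) by (auto simp: v_def)
  define M where "M = 1 / sqrt (v\<^sup>2 / 8)"
  have M: "M > 0" using v by (simp add: M_def)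
  \<comment> \<open>The second bound keeps the density away from \<open>0\<close>, so that its product with the velocity is the current.\<close>
  define \<epsilon>\<^sub>0 where "\<epsilon>\<^sub>0 = min (v / 2) (1 / (4 * M))"
  define \<delta>\<^sub>0 where "\<delta>\<^sub>0 = min \<delta> (v\<^sup>2 / 16)"
  define C\<^sub>0 where "C\<^sub>0 = (M + L * (M / \<kappa>)) + 1 + M / \<kappa>"
  have pos: "\<epsilon>\<^sub>0 > 0" "\<delta>\<^sub>0 > 0" "C\<^sub>0 > 0"
    using v M \<delta> \<kappa> L by (auto simp: \<epsilon>\<^sub>0_def \<delta>\<^sub>0_def C\<^sub>0_def intro!: add_nonneg_pos add_pos_nonneg)
  show ?thesis
  proof (rule exI[of _ \<epsilon>\<^sub>0], rule conjI[OF pos(1)], rule exI[of _ \<delta>\<^sub>0], rule conjI[OF pos(2)],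
      rule exI[of _ C\<^sub>0], rule conjI[OF pos(3)], intro allI impI ballI, elim conjE)
    fix \<phi>\<^sub>b \<epsilon> f\<^sub>\<epsilon> \<phi>\<^sub>\<epsilon> \<phi>
    assume \<phi>\<^sub>b: "\<bar>\<phi>\<^sub>b\<bar> < \<delta>\<^sub>0" and \<epsilon>: "\<epsilon> \<in> {0<..<\<epsilon>\<^sub>0}"
      and VP: "VP_solution n\<^sub>e \<alpha> \<phi>\<^sub>b (g_b \<eta> m\<^sub>b v\<^sub>b \<phi>\<^sub>b \<epsilon>) (g_inf \<eta> \<alpha> m\<^sub>b m_inf v\<^sub>b v_inf \<epsilon>) f\<^sub>\<epsilon> \<phi>\<^sub>\<epsilon>"
      and lim: "limit_solution n\<^sub>e \<alpha> \<phi>\<^sub>b m\<^sub>b m_inf v\<^sub>b v_inf \<phi>"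
    interpret VP n\<^sub>e \<alpha> \<phi>\<^sub>b "g_b \<eta> m\<^sub>b v\<^sub>b \<phi>\<^sub>b \<epsilon>" "g_inf \<eta> \<alpha> m\<^sub>b m_inf v\<^sub>b v_inf \<epsilon>" f\<^sub>\<epsilon> \<phi>\<^sub>\<epsilon>
      by unfold_locales (rule VP)
    have \<epsilon>': "0 < \<epsilon>" "\<epsilon> \<le> v / 2" "M * \<epsilon> \<le> 1 / 4"
    proof -
      have "M * \<epsilon> \<le> M * (1 / (4 * M))" using \<epsilon> M by (intro mult_left_mono) (auto simp: \<epsilon>\<^sub>0_def)
      then show "M * \<epsilon> \<le> 1 / 4" using M by simp
    qed (use \<epsilon> in \<open>auto simp: \<epsilon>\<^sub>0_def\<close>)
    have \<phi>\<^sub>b': "\<bar>\<phi>\<^sub>b\<bar> < \<delta>" "\<bar>\<phi>\<^sub>b\<bar> \<le> v\<^sup>2 / 16" using \<phi>\<^sub>b by (auto simp: \<delta>\<^sub>0_def)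
    have m_inf: "m_inf \<ge> 0" using assms(8) by simp
    note moments = approximate_moments[OF VP assms(4,5,6,7) m_inf assms(11) v \<phi>\<^sub>b'(2) \<epsilon>'(1,2),
        folded M_def, unfolded N_at]
    have small: "\<bar>\<phi>\<^sub>\<epsilon> x\<bar> < \<delta>" "\<bar>\<phi> x\<bar> < \<delta>" if "x \<ge> 0" for x
      using phi_bound[OF that] limit_solution_bounded[OF lim that] \<phi>\<^sub>b' by auto
    have lim_facts: "C2_on {0..} \<phi>" "\<phi> 0 = \<phi>\<^sub>b" "(\<phi> \<longlongrightarrow> 0) at_top"
      "\<And>x. x > 0 \<Longrightarrow> deriv (deriv \<phi>) x = N (\<phi> x) - n\<^sub>e (\<phi> x)"
      using lim unfolding limit_solution_def N_at by auto
    have cont: "continuous_on {0..} \<phi>"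
      using lim_facts(1) unfolding C2_on_def C1_on_def by (blast intro: differentiable_imp_continuous_on)
    have open_half: "open ({0<..} :: real set)" "({0<..} :: real set) \<subseteq> {0..}" "\<And>x::real. x > 0 \<Longrightarrow> x \<in> {0<..}" by auto
    note D = C2_on_derivatives[OF phi_C2 open_half(1) subset_refl open_half(3)]
    note D0 = C2_on_derivatives[OF lim_facts(1) open_half(1,2,3)]
    have F: "deriv (deriv \<phi>\<^sub>\<epsilon>) x = vp_density f\<^sub>\<epsilon> x - n\<^sub>e (\<phi>\<^sub>\<epsilon> x)" if "x > 0" for x
      using poisson[OF that] by (simp add: vp_density_def)
    have start: "\<phi>\<^sub>\<epsilon> 0 = \<phi> 0" using phi_0 lim_facts(2) by simp
    have M\<epsilon>: "0 \<le> M * \<epsilon>" using M \<epsilon>'(1) by simp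
    have up: "\<phi>\<^sub>\<epsilon> x - \<phi> x \<le> M * \<epsilon> / \<kappa>" if x: "x \<ge> 0" for x
    proof (rule potential_stability[OF phi_continuous cont phi_limit lim_facts(3) start D D0 \<kappa> M\<epsilon> _ x])
      fix y :: real assume y: "y > 0" and less: "\<phi> y < \<phi>\<^sub>\<epsilon> y"
      show "\<kappa> * (\<phi>\<^sub>\<epsilon> y - \<phi> y) - M * \<epsilon> \<le> deriv (deriv \<phi>\<^sub>\<epsilon>) y - deriv (deriv \<phi>) y"
        using grow[OF small(2,1) less] moments(1)[OF y] y
        unfolding F[OF y] lim_facts(4)[OF y] by (simp add: abs_le_iff)
    qed
    have down: "\<phi> x - \<phi>\<^sub>\<epsilon> x \<le> M * \<epsilon> / \<kappa>" if x: "x \<ge> 0" for x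
    proof (rule potential_stability[OF cont phi_continuous lim_facts(3) phi_limit start[symmetric] D0 D \<kappa> M\<epsilon> _ x])
      fix y :: real assume y: "y > 0" and less: "\<phi>\<^sub>\<epsilon> y < \<phi> y"
      show "\<kappa> * (\<phi> y - \<phi>\<^sub>\<epsilon> y) - M * \<epsilon> \<le> deriv (deriv \<phi>) y - deriv (deriv \<phi>\<^sub>\<epsilon>) y"
        using grow[OF small(1,2) less] moments(1)[OF y] y
        unfolding F[OF y] lim_facts(4)[OF y] by (simp add: abs_le_iff)
    qed
    have pot: "\<bar>\<phi>\<^sub>\<epsilon> x - \<phi> x\<bar> \<le> M / \<kappa> * \<epsilon>" if "x > 0" for x
      using up[of x] down[of x] that by (simp add: abs_le_iff)
    have dens: "\<bar>vp_density f\<^sub>\<epsilon> x - N (\<phi> x)\<bar> \<le> (M + L * (M / \<kappa>)) * \<epsilon>" if x: "x > 0" for x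
    proof -
      have "\<bar>N (\<phi>\<^sub>\<epsilon> x) - N (\<phi> x)\<bar> \<le> L * \<bar>\<phi>\<^sub>\<epsilon> x - \<phi> x\<bar>" using lip[OF small(2,1)] x by simp
      also have "\<dots> \<le> L * (M / \<kappa> * \<epsilon>)" by (rule mult_left_mono[OF pot[OF x] L])
      finally show ?thesis using moments(1)[OF x] by (simp add: algebra_simps)
    qed
    have flow: "\<bar>vp_density f\<^sub>\<epsilon> x * vp_velocity f\<^sub>\<epsilon> x
             - N (\<phi> x) * lim_velocity \<alpha> m\<^sub>b m_inf v\<^sub>b v_inf \<phi> x\<bar> \<le> 1 * \<epsilon>" if x: "x > 0" for x
    proof -
      have "vp_density f\<^sub>\<epsilon> x \<noteq> 0"
      proof -
        have "1 / 2 \<le> N (\<phi>\<^sub>\<epsilon> x)" using half[OF small(1), of x] x by simp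
        then show ?thesis using moments(1)[OF x] \<epsilon>'(3) by linarith
      qed
      moreover have "N (\<phi> x) \<noteq> 0" using half[OF small(2), of x] x by auto
      ultimately show ?thesis
        using moments(2)[OF x] by (simp add: vp_velocity_def lim_velocity_def N_at)
    qed
    have "(SUP x\<in>{0<..}. ereal \<bar>vp_density f\<^sub>\<epsilon> x - N (\<phi> x)\<bar>)
       + (SUP x\<in>{0<..}. ereal \<bar>vp_density f\<^sub>\<epsilon> x * vp_velocity f\<^sub>\<epsilon> x
             - N (\<phi> x) * lim_velocity \<alpha> m\<^sub>b m_inf v\<^sub>b v_inf \<phi> x\<bar>)
       + (SUP x\<in>{0<..}. ereal \<bar>\<phi>\<^sub>\<epsilon> x - \<phi> x\<bar>)
       \<le> ereal ((M + L * (M / \<kappa>)) * \<epsilon>) + ereal (1 * \<epsilon>) + ereal (M / \<kappa> * \<epsilon>)"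
      by (intro add_mono SUP_least) (use dens flow pot in auto)
    also have "\<dots> = ereal (C\<^sub>0 * \<epsilon>)" by (simp add: C\<^sub>0_def algebra_simps)
    finally show "(SUP x\<in>{0<..}. ereal \<bar>vp_density f\<^sub>\<epsilon> x - lim_density \<alpha> m\<^sub>b m_inf v\<^sub>b v_inf \<phi> x\<bar>)
       + (SUP x\<in>{0<..}. ereal \<bar>vp_density f\<^sub>\<epsilon> x * vp_velocity f\<^sub>\<epsilon> x
             - lim_density \<alpha> m\<^sub>b m_inf v\<^sub>b v_inf \<phi> x * lim_velocity \<alpha> m\<^sub>b m_inf v\<^sub>b v_inf \<phi> x\<bar>)
       + (SUP x\<in>{0<..}. ereal \<bar>\<phi>\<^sub>\<epsilon> x - \<phi> x\<bar>)
       \<le> ereal (C\<^sub>0 * \<epsilon>)"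
      unfolding N_at .
  qed
qed

end
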